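(* Let $\Delta\subset\mathfrak d^*$ be an $n$-dimensional convex polytope with chosen inward-pointing normals $X_1,\dots,X_d$ and quasilattice $Q$ containing them, let $M=\Psi^{-1}(0)/N$ be the associated topological space and $\Phi\colon M\to\mathfrak d^*$ the associated mapping, and let $\mathcal T_F$ ($F$ a singular face of $\Delta$) and $\mathcal T_\Delta$ be the subsets of $M$ defined in the context. Then, for each $p$-dimensional singular face $F$ of $\Delta$, the subset $\mathcal T_F$ of $M$ is a $2p$-dimensional quasifold. The subset $\mathcal T_\Delta$ is a $2n$-dimensional quasifold. These subsets give a decomposition by quasifolds of $M$.
   Context: **The space $M$.** Let $\mathfrak d$ be a real vector space of dimension $n$ and $\Delta\subset\mathfrak d^*$ an $n$-dimensional convex polytope, $\Delta=\bigcap_{j=1}^d\{\mu\in\mathfrak d^*\mid\langle\mu,X_j\rangle\ge\lambda_j\}$, where $X_1,\dots,X_d\in\mathfrak d$ are inward-pointing normals, one for each codimension-$1$ face, and $\lambda_j\in\mathbb R$. A quasilattice in $\mathfrak d$ is the $\mathbb Z$-span of a finite set of $\mathbb R$-spanning vectors; $Q$ is a quasilattice containing all $X_j$. Let $\pi\colon\mathbb R^d\to\mathfrak d$ be linear with $\pi(e_j)=X_j$. Let $T^d=\mathbb R^d/\mathbb Z^d$ act on $\mathbb C^d$ by $\exp(x)\cdot\underline z=(e^{2\pi i x_j}z_j)_j$, where $\exp\colon\mathbb R^d\to T^d$ is the quotient map. Let $N$ be the kernel of the homomorphism $T^d\to\mathfrak d/Q$ induced by $\pi$; its Lie algebra is $\mathfrak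 n=\ker\pi$, with inclusion $\iota\colon\mathfrak n\to\mathbb R^d$. Let $\Upsilon(\underline z)=\sum_j(|z_j|^2+\lambda_j)e_j^*$, $\Psi=\iota^*\circ\Upsilon\colon\mathbb C^d\to\mathfrak n^*$, and $M=\Psi^{-1}(0)/N$ with the quotient topology. The continuous map $\Phi\colon M\to\mathfrak d^*$ is defined by $\pi^*(\Phi([\underline z]))=\Upsilon(\underline z)$; its image is $\Delta$. **Faces and pieces.** $\Delta$ is the disjoint union of its open faces; an open face is described by $F=\{\mu\in\Delta\mid\langle\mu,X_j\rangle=\lambda_j\text{ if and only if }j\in I_F\}$ for a subset $I_F\subset\{1,\dots,d\}$ (the interior $\mathrm{Int}(\Delta)$ corresponds to $\emptyset$). Put $F\le F'$ if $F\subseteq\overline{F'}$, and $r_F=\mathrm{card}(I_F)$. A $p$-dimensional face $F$ is singular if $r_F>n-p$ and nonsingular if $r_F=n-p$. For $F$ singular, $\mathcal T_F=\Phi^{-1}(F)$; moreover $\mathcal T_\Delta=\bigcup_{F\text{ nonsingular}}\Phi^{-1}(F)$. All these have the subspace topology. The index set is the set of singular faces together with the maximal element $\Delta$ (index of $\mathcal T_\Delta$), ordered by $\le$. **Quasifolds.** A model of dimension $k$ is a quotient $\tilde U/\Gamma$ (with quotient topology and projection $p\colon\tilde U\to\tilde U/\Gamma$), where $\tilde U$ is a connected, simply connected $k$-manifold and $\Gamma$ is a discrete (possibly infinite) group acting smoothly on $\tilde U$ so that the set of points where the action is free is connected and dense. If $\tilde U$ satisfies all requirements except simple connectedness, then $\tilde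 U/\Gamma$ is regarded as a model by replacing $\tilde U$ with its universal cover $U^\sharp\to\tilde U$ and $\Gamma$ with the group $\Lambda$ of all diffeomorphisms of $U^\sharp$ covering the action of some element of $\Gamma$; then $U^\sharp/\Lambda=\tilde U/\Gamma$. An open subset $W\subset\tilde U/\Gamma$ is a submodel if $(W,p,p^{-1}(W))$ defines a model in this way. A map of models $f\colon\tilde U/\Gamma\to\tilde W/\Delta'$ is smooth if it lifts to a smooth map $\tilde f\colon\tilde U\to\tilde W$, and is a diffeomorphism of models if it is bijective and the lift $\tilde f$ is a diffeomorphism. A $k$-dimensional quasifold structure on a topological space $T$ is a maximal atlas of charts $(U_\alpha,\phi_\alpha,\tilde U_\alpha/\Gamma_\alpha)$ such that: the $U_\alpha$ form an open cover of $T$; each $\tilde U_\alpha/\Gamma_\alpha$ is a model with $\tilde U_\alpha$ an open, connected, simply connected subset of $\mathbb R^k$, and $\phi_\alpha\colon\tilde U_\alpha/\Gamma_\alpha\to U_\alpha$ is a homeomorphism; whenever $U_\alpha\cap U_\beta\ne\emptyset$, $\phi_\alpha^{-1}(U_\alpha\cap U_\beta)$ and $\phi_\beta^{-1}(U_\alpha\cap U_\beta)$ are submodels and $\phi_\beta^{-1}\circ\phi_\alpha$ is a diffeomorphism of models between them. **Decomposition by quasifolds.** A decomposition by quasifolds of a topological space $M$ is a collection of disjoint, locally closed, connected quasifolds $\mathcal T_F$ ($F\in\mathcal F$), called pieces, such that: (1) $\mathcal F$ is finite and partially ordered; (2) $M=\bigcup_F\mathcal T_F$; (3) $\mathcal T_F\cap\overline{\mathcal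 T}_{F'}\neq\emptyset$ if and only if $\mathcal T_F\subseteq\overline{\mathcal T}_{F'}$ if and only if $F\le F'$. It is also required that $\mathcal F$ has a maximal element whose piece (the regular piece) is open and dense in $M$; the other pieces are called singular. *)

theory Defs
  imports "HOL-Analysis.Analysis" "HOL-Algebra.Bij"
begin

section \<open>Quotient spaces\<close>

definition quotient_topology :: "'a topology \<Rightarrow> ('a \<Rightarrow> 'b) \<Rightarrow> 'b topology" where
  "quotient_topology X p =
     topology (\<lambda>W. W \<subseteq> p ` topspace X \<and> openin X {x \<in> topspace X. p x \<in> W})"

lemma openin_quotient_topology:
  "openin (quotient_topology X p) W \<longleftrightarrow>
     W \<subseteq> p ` topspace X \<and> openin X {x \<in> topspace X. p x \<in> W}"
proof -
  let ?P = "\<lambda>W. W \<subseteq> p ` topspace X \<and> openin X {x \<in> topspace X. p x \<in> W}"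
  have int: "?P (S \<inter> T)" if "?P S" "?P T" for S T
  proof -
    have "{x \<in> topspace X. p x \<in> S \<inter> T}
        = {x \<in> topspace X. p x \<in> S} \<inter> {x \<in> topspace X. p x \<in> T}" by blast
    with that show ?thesis by (metis (no_types, lifting) le_infI1 openin_Int)
  qed
  have un: "?P (\<Union>K)" if "\<forall>S\<in>K. ?P S" for K
  proof -
    have "{x \<in> topspace X. p x \<in> \<Union>K} = (\<Union>S\<in>K. {x \<in> topspace X. p x \<in> S})" by blast
    moreover have "openin X (\<Union>S\<in>K. {x \<in> topspace X. p x \<in> S})" using that by blast
    ultimately show ?thesis using that by auto
  qed
  have "istopology ?P"
    unfolding istopology_def using int un by blast
  then show ?thesis
    unfolding quotient_topology_def by (simp add: topology_inverse')
qed

lemma topspace_quotient_topology: "topspace (quotient_topology X p) = p ` topspace X"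
proof -
  have "{x \<in> topspace X. p x \<in> p ` topspace X} = topspace X" by blast
  then have "openin (quotient_topology X p) (p ` topspace X)"
    by (simp add: openin_quotient_topology)
  then show ?thesis
    by (meson openin_quotient_topology openin_subset openin_topspace subset_antisym)
qed

lemma quotient_map_quotient_topology: "quotient_map X (quotient_topology X p) p"
  unfolding quotient_map_def by (simp add: topspace_quotient_topology openin_quotient_topology)


section \<open>Smooth maps\<close>

text \<open>\<open>\<real>\<^sup>k\<close> is \<^const>\<open>Euclidean_space\<close> \<open>k\<close>, i.e. the sequences that vanish from index \<open>k\<close> on, so
  that the dimension \<open>k\<close> may be \<open>0\<close> and may depend on the piece.\<close>

type_synonym rvec = "nat \<Rightarrow> real"

primrec iterated_partial :: "nat list \<Rightarrow> (rvec \<Rightarrow> real) \<Rightarrow> rvec \<Rightarrow> real" where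
  "iterated_partial [] f = f"
| "iterated_partial (i # is) f = (\<lambda>x. deriv (\<lambda>t. iterated_partial is f (x(i := t))) (x i))"

definition smooth_fun :: "nat \<Rightarrow> rvec set \<Rightarrow> (rvec \<Rightarrow> real) \<Rightarrow> bool" where
  "smooth_fun k S f \<longleftrightarrow>
     (\<forall>is. set is \<subseteq> {..<k} \<longrightarrow>
        continuous_on S (iterated_partial is f) \<and>
        (\<forall>i<k. \<forall>x\<in>S. (\<lambda>t. iterated_partial is f (x(i := t))) differentiable (at (x i))))"

definition smooth_on :: "nat \<Rightarrow> rvec set \<Rightarrow> (rvec \<Rightarrow> rvec) \<Rightarrow> bool" where
  "smooth_on k S f \<longleftrightarrow> (\<forall>i. smooth_fun k S (\<lambda>x. f x i))"

text \<open>The only manifolds that occur in the definition of a quasifold are open subsets of \<open>\<real>\<^sup>k\<close> and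
  coverings \<open>q : C \<rightarrow> V\<close> of such open subsets. The manifold structure of \<open>C\<close> is the one for which
  \<open>q\<close> is a local diffeomorphism, so the local restrictions of \<open>q\<close> serve as charts; an open subset
  of \<open>\<real>\<^sup>k\<close> is the case \<open>q = id\<close>.\<close>

definition smooth_cover_map ::
  "nat \<Rightarrow> rvec set \<Rightarrow> (rvec \<Rightarrow> rvec) \<Rightarrow> rvec set \<Rightarrow> (rvec \<Rightarrow> rvec) \<Rightarrow> (rvec \<Rightarrow> rvec) \<Rightarrow> bool" where
  "smooth_cover_map k C q C' q' h \<longleftrightarrow>
     continuous_on C h \<and> h ` C \<subseteq> C' \<and>
     (\<forall>c\<in>C. \<exists>A s. c \<in> A \<and> openin (top_of_set C) A \<and> openin (Euclidean_space k) (q ` A) \<and>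
        homeomorphism A (q ` A) q s \<and> smooth_on k (q ` A) (\<lambda>y. q' (h (s y))))"

definition cover_diffeo ::
  "nat \<Rightarrow> rvec set \<Rightarrow> (rvec \<Rightarrow> rvec) \<Rightarrow> rvec set \<Rightarrow> (rvec \<Rightarrow> rvec) \<Rightarrow> (rvec \<Rightarrow> rvec) \<Rightarrow> bool" where
  "cover_diffeo k C q C' q' h \<longleftrightarrow>
     bij_betw h C C' \<and> smooth_cover_map k C q C' q' h \<and>
     smooth_cover_map k C' q' C q (inv_into C h)"

text \<open>A connected manifold is separable and metrizable and hence embeds in \<open>\<real>\<^sup>\<omega>\<close>; so no generality is
  lost by looking for universal covers among the subspaces of \<^typ>\<open>rvec\<close>.\<close>

definition universal_cover :: "rvec set \<Rightarrow> (rvec \<Rightarrow> rvec) \<Rightarrow> rvec set \<Rightarrow> bool" where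
  "universal_cover C q V \<longleftrightarrow> covering_space C q V \<and> simply_connected C"


section \<open>Models\<close>

definition orb :: "('a \<Rightarrow> 'a) set \<Rightarrow> 'a \<Rightarrow> 'a set" where
  "orb G x = (\<lambda>g. g x) ` G"

definition orbit_space :: "rvec set \<Rightarrow> (rvec \<Rightarrow> rvec) set \<Rightarrow> rvec set topology" where
  "orbit_space V G = quotient_topology (top_of_set V) (orb G)"

definition free_points :: "rvec set \<Rightarrow> (rvec \<Rightarrow> rvec) set \<Rightarrow> rvec set" where
  "free_points V G = {x \<in> V. \<forall>g\<in>G. g x = x \<longrightarrow> g = (\<lambda>v\<in>V. v)}"

text \<open>All requirements on a model \<open>V/G\<close>, with \<open>V\<close> open in \<open>\<real>\<^sup>k\<close>, except simple connectedness of \<open>V\<close>.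
  An action that is free at some point is effective, hence the discrete group may be given as a
  group \<open>G\<close> of self-maps of \<open>V\<close>. The elements of \<^const>\<open>BijGroup\<close> are the bijections of \<open>V\<close>,
  normalized outside \<open>V\<close>. No condition relates \<open>G\<close> to the topology: the discrete group may act
  with dense orbits.\<close>

definition premodel :: "nat \<Rightarrow> rvec set \<Rightarrow> (rvec \<Rightarrow> rvec) set \<Rightarrow> bool" where
  "premodel k V G \<longleftrightarrow>
     openin (Euclidean_space k) V \<and> connected V \<and>
     subgroup G (BijGroup V) \<and> (\<forall>g\<in>G. smooth_on k V g) \<and>
     connected (free_points V G) \<and> V \<subseteq> closure (free_points V G)"

definition model :: "nat \<Rightarrow> rvec set \<Rightarrow> (rvec \<Rightarrow> rvec) set \<Rightarrow> bool" where
  "model k V G \<longleftrightarrow> premodel k V G \<and> simply_connected V"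

definition preimg :: "rvec set \<Rightarrow> (rvec \<Rightarrow> rvec) set \<Rightarrow> rvec set set \<Rightarrow> rvec set" where
  "preimg V G W = {x \<in> V. orb G x \<in> W}"

definition restrict_group :: "(rvec \<Rightarrow> rvec) set \<Rightarrow> rvec set \<Rightarrow> (rvec \<Rightarrow> rvec) set" where
  "restrict_group G V' = (\<lambda>g. restrict g V') ` G"

definition submodel :: "nat \<Rightarrow> rvec set \<Rightarrow> (rvec \<Rightarrow> rvec) set \<Rightarrow> rvec set set \<Rightarrow> bool" where
  "submodel k V G W \<longleftrightarrow>
     openin (orbit_space V G) W \<and>
     premodel k (preimg V G W) (restrict_group G (preimg V G W))"

text \<open>A premodel \<open>V/G\<close> is regarded as the model \<open>C/L\<close>, where \<open>q : C \<rightarrow> V\<close> is the universal cover and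
  \<open>L\<close> is the group of all diffeomorphisms of \<open>C\<close> that cover the action of some element of \<open>G\<close>. The
  \<open>L\<close>-orbits are the fibres of \<open>c \<mapsto> orb G (q c)\<close>, which is the projection \<open>C \<rightarrow> C/L = V/G\<close>; a map of
  models is lifted with respect to these projections, and \<open>L\<close> enters in no other way. If \<open>V\<close> is
  simply connected, \<open>C = V\<close> and \<open>q = id\<close> is a possible choice, and then \<open>L = G\<close>.\<close>

definition model_diffeo ::
  "nat \<Rightarrow> rvec set \<Rightarrow> (rvec \<Rightarrow> rvec) set \<Rightarrow> rvec set \<Rightarrow> (rvec \<Rightarrow> rvec) set \<Rightarrow>
   (rvec set \<Rightarrow> rvec set) \<Rightarrow> bool" where
  "model_diffeo k V G V' G' f \<longleftrightarrow>
     bij_betw f (orb G ` V) (orb G' ` V') \<and>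
     (\<exists>C q C' q' h.
        universal_cover C q V \<and> universal_cover C' q' V' \<and>
        cover_diffeo k C q C' q' h \<and>
        (\<forall>c\<in>C. f (orb G (q c)) = orb G' (q' (h c))))"


section \<open>Quasifolds\<close>

text \<open>A chart \<open>(U, \<phi>, V, G)\<close> of a space consists of a model \<open>V/G\<close> and a homeomorphism \<open>\<phi>\<close> from
  \<open>V/G\<close> onto \<open>U\<close>.\<close>

type_synonym 'm qchart = "'m set \<times> (rvec set \<Rightarrow> 'm) \<times> rvec set \<times> (rvec \<Rightarrow> rvec) set"

definition is_qchart :: "nat \<Rightarrow> 'm topology \<Rightarrow> 'm qchart \<Rightarrow> bool" where
  "is_qchart k T = (\<lambda>(U, \<phi>, V, G).
     openin T U \<and> model k V G \<and> homeomorphic_map (orbit_space V G) (subtopology T U) \<phi>)"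

definition qcompatible :: "nat \<Rightarrow> 'm qchart \<Rightarrow> 'm qchart \<Rightarrow> bool" where
  "qcompatible k = (\<lambda>(U, \<phi>, V, G) (U', \<phi>', V', G').
     U \<inter> U' \<noteq> {} \<longrightarrow>
       (let W = {w \<in> orb G ` V. \<phi> w \<in> U \<inter> U'};
            W' = {w \<in> orb G' ` V'. \<phi>' w \<in> U \<inter> U'};
            P = preimg V G W;
            P' = preimg V' G' W'
        in submodel k V G W \<and> submodel k V' G' W' \<and>
           model_diffeo k P (restrict_group G P) P' (restrict_group G' P')
             (\<lambda>w. inv_into (orb G' ` V') \<phi>' (\<phi> w))))"

definition qatlas :: "nat \<Rightarrow> 'm topology \<Rightarrow> 'm qchart set \<Rightarrow> bool" where
  "qatlas k T A \<longleftrightarrow>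
     (\<forall>a\<in>A. is_qchart k T a) \<and> (\<Union>a\<in>A. fst a) = topspace T \<and>
     (\<forall>a\<in>A. \<forall>b\<in>A. qcompatible k a b)"

definition quasifold_structure :: "nat \<Rightarrow> 'm topology \<Rightarrow> 'm qchart set \<Rightarrow> bool" where
  "quasifold_structure k T A \<longleftrightarrow>
     qatlas k T A \<and> (\<forall>B. qatlas k T B \<and> A \<subseteq> B \<longrightarrow> B = A)"

definition quasifold :: "nat \<Rightarrow> 'm topology \<Rightarrow> bool" where
  "quasifold k T \<longleftrightarrow> (\<exists>A. quasifold_structure k T A)"

definition locally_closed_in :: "'m topology \<Rightarrow> 'm set \<Rightarrow> bool" where
  "locally_closed_in X S \<longleftrightarrow> (\<exists>U K. openin X U \<and> closedin X K \<and> S = U \<inter> K)"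

definition decomposition_by_quasifolds ::
  "'m topology \<Rightarrow> 'i set \<Rightarrow> ('i \<Rightarrow> 'i \<Rightarrow> bool) \<Rightarrow> ('i \<Rightarrow> 'm set) \<Rightarrow> bool" where
  "decomposition_by_quasifolds X I leq T \<longleftrightarrow>
     disjoint_family_on T I \<and>
     (\<forall>i\<in>I. locally_closed_in X (T i) \<and> connectedin X (T i) \<and>
             (\<exists>k. quasifold k (subtopology X (T i)))) \<and>
     finite I \<and> partial_order_on I (relation_of leq I) \<and>
     topspace X = (\<Union>i\<in>I. T i) \<and>
     (\<forall>i\<in>I. \<forall>j\<in>I.
        (T i \<inter> X closure_of T j \<noteq> {} \<longleftrightarrow> T i \<subseteq> X closure_of T j) \<and>
        (T i \<subseteq> X closure_of T j \<longleftrightarrow> leq i j)) \<and>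
     (\<exists>m\<in>I. (\<forall>i\<in>I. leq m i \<longrightarrow> i = m) \<and>
             openin X (T m) \<and> X closure_of T m = topspace X)"


section \<open>Polytopes and their faces\<close>

text \<open>\<open>\<dd>\<close> is a finite-dimensional \<^typ>\<open>'v\<close> (the norm is auxiliary: it only serves to write
  \<open>\<dd>\<^sup>*\<close> as \<^typ>\<open>'v \<Rightarrow>\<^sub>L real\<close>, and in finite dimension every linear functional is bounded and all
  norms give the same topology). The index set \<open>{1,\<dots>,d}\<close> is \<^term>\<open>{..<d}\<close>.\<close>

definition affine_dim :: "'a::real_vector set \<Rightarrow> nat" where
  "affine_dim S = dim {x - y | x y. x \<in> S \<and> y \<in> S}"

definition half_space_intersection ::
  "nat \<Rightarrow> (nat \<Rightarrow> 'v::real_normed_vector) \<Rightarrow> (nat \<Rightarrow> real) \<Rightarrow> ('v \<Rightarrow>\<^sub>L real) set" where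
  "half_space_intersection d X lam = {\<mu>. \<forall>j<d. blinfun_apply \<mu> (X j) \<ge> lam j}"

text \<open>The last condition says that each codimension-one face has exactly one normal among the \<open>X j\<close>.\<close>

definition polytope_with_normals ::
  "nat \<Rightarrow> nat \<Rightarrow> (nat \<Rightarrow> 'v::real_normed_vector) \<Rightarrow> (nat \<Rightarrow> real) \<Rightarrow> ('v \<Rightarrow>\<^sub>L real) set \<Rightarrow> bool" where
  "polytope_with_normals n d X lam \<Delta> \<longleftrightarrow>
     \<Delta> = half_space_intersection d X lam \<and>
     polytope \<Delta> \<and> \<Delta> \<noteq> {} \<and> affine_dim \<Delta> = n \<and>
     bij_betw (\<lambda>j. {\<mu> \<in> \<Delta>. blinfun_apply \<mu> (X j) = lam j}) {..<d}
       {K. K face_of \<Delta> \<and> K \<noteq> {} \<and> affine_dim K + 1 = n}"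

definition quasilattice :: "'v::real_vector set \<Rightarrow> bool" where
  "quasilattice Q \<longleftrightarrow>
     (\<exists>S. finite S \<and> span S = UNIV \<and> Q = {(\<Sum>v\<in>S. of_int (c v) *\<^sub>R v) | c. True})"

definition open_face_of_index ::
  "nat \<Rightarrow> (nat \<Rightarrow> 'v::real_normed_vector) \<Rightarrow> (nat \<Rightarrow> real) \<Rightarrow> nat set \<Rightarrow> ('v \<Rightarrow>\<^sub>L real) set" where
  "open_face_of_index d X lam I =
     {\<mu> \<in> half_space_intersection d X lam. \<forall>j<d. blinfun_apply \<mu> (X j) = lam j \<longleftrightarrow> j \<in> I}"

definition open_faces ::
  "nat \<Rightarrow> (nat \<Rightarrow> 'v::real_normed_vector) \<Rightarrow> (nat \<Rightarrow> real) \<Rightarrow> ('v \<Rightarrow>\<^sub>L real) set set" where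
  "open_faces d X lam = open_face_of_index d X lam ` Pow {..<d} - {{}}"

definition face_index ::
  "nat \<Rightarrow> (nat \<Rightarrow> 'v::real_normed_vector) \<Rightarrow> (nat \<Rightarrow> real) \<Rightarrow> ('v \<Rightarrow>\<^sub>L real) set \<Rightarrow> nat set" where
  "face_index d X lam F = (THE I. I \<subseteq> {..<d} \<and> F = open_face_of_index d X lam I)"

lemma face_index_open_face_of_index:
  assumes "I \<subseteq> {..<d}" and "open_face_of_index d X lam I \<noteq> {}"
  shows "face_index d X lam (open_face_of_index d X lam I) = I"
  unfolding face_index_def
proof (rule the_equality)
  fix J assume J: "J \<subseteq> {..<d} \<and> open_face_of_index d X lam I = open_face_of_index d X lam J"
  obtain \<mu> where "\<mu> \<in> open_face_of_index d X lam I" using assms(2) by blast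
  with J have "\<forall>j<d. j \<in> I \<longleftrightarrow> j \<in> J" unfolding open_face_of_index_def by blast
  with J assms(1) show "J = I" by blast
qed (use assms in simp)

text \<open>\<open>n - p\<close> is written without truncated subtraction.\<close>

definition singular_faces ::
  "nat \<Rightarrow> nat \<Rightarrow> (nat \<Rightarrow> 'v::real_normed_vector) \<Rightarrow> (nat \<Rightarrow> real) \<Rightarrow> ('v \<Rightarrow>\<^sub>L real) set set" where
  "singular_faces n d X lam =
     {F \<in> open_faces d X lam. card (face_index d X lam F) + affine_dim F > n}"

definition nonsingular_faces ::
  "nat \<Rightarrow> nat \<Rightarrow> (nat \<Rightarrow> 'v::real_normed_vector) \<Rightarrow> (nat \<Rightarrow> real) \<Rightarrow> ('v \<Rightarrow>\<^sub>L real) set set" where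
  "nonsingular_faces n d X lam =
     {F \<in> open_faces d X lam. card (face_index d X lam F) + affine_dim F = n}"

definition face_le :: "'a::topological_space set \<Rightarrow> 'a set \<Rightarrow> bool" where
  "face_le F F' \<longleftrightarrow> F \<subseteq> closure F'"


section \<open>The space \<open>M\<close>\<close>

abbreviation Rspace :: "nat \<Rightarrow> rvec set" where
  "Rspace d \<equiv> topspace (Euclidean_space d)"

definition Cspace :: "nat \<Rightarrow> (nat \<Rightarrow> complex) set" where
  "Cspace d = {z. \<forall>j\<ge>d. z j = 0}"

definition proj :: "nat \<Rightarrow> (nat \<Rightarrow> 'v::real_vector) \<Rightarrow> rvec \<Rightarrow> 'v" where
  "proj d X x = (\<Sum>j<d. x j *\<^sub>R X j)"

definition ker_proj :: "nat \<Rightarrow> (nat \<Rightarrow> 'v::real_vector) \<Rightarrow> rvec set" where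
  "ker_proj d X = {x \<in> Rspace d. proj d X x = 0}"

text \<open>Elements of \<open>T\<^sup>d = \<real>\<^sup>d/\<int>\<^sup>d\<close> are cosets of \<open>\<int>\<^sup>d\<close>.\<close>

definition torus_exp :: "nat \<Rightarrow> rvec \<Rightarrow> rvec set" where
  "torus_exp d x = {y \<in> Rspace d. \<forall>j. y j - x j \<in> \<int>}"

definition torus :: "nat \<Rightarrow> rvec set set" where
  "torus d = torus_exp d ` Rspace d"

definition torus_act :: "rvec set \<Rightarrow> (nat \<Rightarrow> complex) \<Rightarrow> nat \<Rightarrow> complex" where
  "torus_act t z = the_elem ((\<lambda>x j. exp (2 * of_real pi * \<i> * of_real (x j)) * z j) ` t)"

definition lattice_coset :: "'v::real_vector set \<Rightarrow> 'v \<Rightarrow> 'v set" where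
  "lattice_coset Q v = (\<lambda>q. v + q) ` Q"

definition torus_hom ::
  "nat \<Rightarrow> (nat \<Rightarrow> 'v::real_vector) \<Rightarrow> 'v set \<Rightarrow> rvec set \<Rightarrow> 'v set" where
  "torus_hom d X Q t = the_elem ((\<lambda>x. lattice_coset Q (proj d X x)) ` t)"

definition N_group :: "nat \<Rightarrow> (nat \<Rightarrow> 'v::real_vector) \<Rightarrow> 'v set \<Rightarrow> rvec set set" where
  "N_group d X Q = {t \<in> torus d. torus_hom d X Q t = lattice_coset Q 0}"

text \<open>Linear functionals on \<open>\<real>\<^sup>d\<close> and on \<open>\<nn> = ker \<pi>\<close> are functions; the dual of the inclusion
  \<open>\<nn> \<rightarrow> \<real>\<^sup>d\<close> is restriction to \<open>\<nn>\<close>.\<close>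

definition Upsilon :: "nat \<Rightarrow> (nat \<Rightarrow> real) \<Rightarrow> (nat \<Rightarrow> complex) \<Rightarrow> rvec \<Rightarrow> real" where
  "Upsilon d lam z = (\<lambda>x\<in>Rspace d. \<Sum>j<d. ((cmod (z j))\<^sup>2 + lam j) * x j)"

definition Psi ::
  "nat \<Rightarrow> (nat \<Rightarrow> 'v::real_vector) \<Rightarrow> (nat \<Rightarrow> real) \<Rightarrow> (nat \<Rightarrow> complex) \<Rightarrow> rvec \<Rightarrow> real" where
  "Psi d X lam z = restrict (Upsilon d lam z) (ker_proj d X)"

definition zero_level ::
  "nat \<Rightarrow> (nat \<Rightarrow> 'v::real_vector) \<Rightarrow> (nat \<Rightarrow> real) \<Rightarrow> (nat \<Rightarrow> complex) set" where
  "zero_level d X lam = {z \<in> Cspace d. Psi d X lam z = (\<lambda>x\<in>ker_proj d X. 0)}"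

text \<open>Points of \<open>M\<close> are \<open>N\<close>-orbits.\<close>

definition M_space ::
  "nat \<Rightarrow> (nat \<Rightarrow> 'v::real_vector) \<Rightarrow> (nat \<Rightarrow> real) \<Rightarrow> 'v set \<Rightarrow> (nat \<Rightarrow> complex) set topology" where
  "M_space d X lam Q =
     quotient_topology (top_of_set (zero_level d X lam)) (orb (torus_act ` N_group d X Q))"

definition Phi ::
  "nat \<Rightarrow> (nat \<Rightarrow> 'v::real_normed_vector) \<Rightarrow> (nat \<Rightarrow> real) \<Rightarrow> (nat \<Rightarrow> complex) set \<Rightarrow> 'v \<Rightarrow>\<^sub>L real" where
  "Phi d X lam m =
     (THE \<mu>. \<forall>z\<in>m. (\<lambda>x\<in>Rspace d. blinfun_apply \<mu> (proj d X x)) = Upsilon d lam z)"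

definition Phi_preimage ::
  "nat \<Rightarrow> (nat \<Rightarrow> 'v::real_normed_vector) \<Rightarrow> (nat \<Rightarrow> real) \<Rightarrow> 'v set \<Rightarrow> ('v \<Rightarrow>\<^sub>L real) set \<Rightarrow>
   (nat \<Rightarrow> complex) set set" where
  "Phi_preimage d X lam Q F = {m \<in> topspace (M_space d X lam Q). Phi d X lam m \<in> F}"

definition regular_piece ::
  "nat \<Rightarrow> nat \<Rightarrow> (nat \<Rightarrow> 'v::real_normed_vector) \<Rightarrow> (nat \<Rightarrow> real) \<Rightarrow> 'v set \<Rightarrow>
   (nat \<Rightarrow> complex) set set" where
  "regular_piece n d X lam Q =
     (\<Union>F\<in>nonsingular_faces n d X lam. Phi_preimage d X lam Q F)"

text \<open>The pieces are indexed by the singular faces and by the polytope \<open>\<Delta>\<close> itself, which is not a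
  singular open face. On this index set the order is \<^const>\<open>face_le\<close>, for which \<open>\<Delta>\<close>, being
  closed, is above all the faces and below none of the singular ones.\<close>

definition piece_index ::
  "nat \<Rightarrow> nat \<Rightarrow> (nat \<Rightarrow> 'v::real_normed_vector) \<Rightarrow> (nat \<Rightarrow> real) \<Rightarrow> ('v \<Rightarrow>\<^sub>L real) set set" where
  "piece_index n d X lam = insert (half_space_intersection d X lam) (singular_faces n d X lam)"

definition piece ::
  "nat \<Rightarrow> nat \<Rightarrow> (nat \<Rightarrow> 'v::real_normed_vector) \<Rightarrow> (nat \<Rightarrow> real) \<Rightarrow> 'v set \<Rightarrow>
   ('v \<Rightarrow>\<^sub>L real) set \<Rightarrow> (nat \<Rightarrow> complex) set set" where
  "piece n d X lam Q F =
     (if F = half_space_intersection d X lam then regular_piece n d X lam Q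
      else Phi_preimage d X lam Q F)"

end

theory Submission
  imports Defs
begin

text \<open>Let \<open>K\<close> be the index set of a face and choose normals \<open>X b\<close>, \<open>b \<in> B\<close>, that form a basis of
  \<open>\<dd>\<close> modulo the span of the \<open>X k\<close>, \<open>k \<in> K\<close>. Over the face the level set is a family of tori, the
  torus of \<open>N\<close> rotates all the coordinates outside \<open>B\<close> to positive reals, and the piece of a singular
  face becomes the quotient of \<open>F \<times> \<real>\<^sup>p\<close> (squared moduli and arguments of the coordinates in
  \<open>B\<close>) by the translations coming from \<open>Q\<close>: a single global chart.

  For \<open>K = {}\<close> and a nonsingular face with index set \<open>I\<close> choose \<open>B \<supseteq> I\<close>. Keeping the coordinates in \<open>I\<close>
  complex gives a chart around the orbits over the face, and these charts cover the regular piece. Two of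
  them, for \<open>I\<close> and \<open>I'\<close>, overlap in the set that belongs to \<open>A = I \<inter> I'\<close>. Its preimages in both charts
  have the domain of the chart for \<open>A\<close> as universal covering, by polar coordinates in the directions
  of \<open>I - A\<close> and \<open>I' - A\<close>, and the lift of the transition map is a change of basis.\<close>

section \<open>Topological preliminaries\<close>

text \<open>The group \<open>N\<close> need not be closed in the torus, so the charts cannot come
  from slices of a proper action; each comes from an open parametrization of the level set, and only
  orbits are compared. The problem becomes linear because squared moduli of coordinates are the
  slacks of the defining inequalities, hence affine functions of the squared moduli in
  \<open>B\<close>. Contractions, closures of strata and the existence of smaller index sets all
  come from moving squared moduli along segments and taking square roots. A coordinate outside
  \<open>B\<close> can be turned to a positive real inside \<open>N\<close> because its normal is a
  combination of the basis vectors modulo the normals in \<open>K\<close>, and turning the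
  coordinates in \<open>K\<close>, which vanish over the face, has no effect. The remaining
  ambiguity by full turns lies in the structure group because \<open>Q\<close> contains every
  \<open>X j\<close>. Overlaps of charts are in general not simply connected, but only a lift to
  universal covers is asked for. On the polar cover the transition is an explicit formula, and all
  formulas, including the local inverse of polar coordinates by \<open>arctan\<close>, stay in one
  class of elementary functions, which settles smoothness.\<close>

text \<open>The library has the next two facts for normed spaces only, which excludes \<^typ>\<open>rvec\<close>.\<close>

lemma contractible_imp_simply_connected':
  fixes S :: "'a::topological_space set"
  assumes "contractible S"
  shows "simply_connected S"
proof -
  obtain a where a: "homotopic_with_canon (\<lambda>x. True) S S id (\<lambda>x. a)"
    using assms by (force simp: contractible_def)
  \<comment> \<open>The contraction composed with the loop is a homotopy through loops. Its base
    point may move, since \<open>homotopic_loops\<close> is free homotopy.\<close>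
  have null: "homotopic_loops S p (\<lambda>_. a)"
    if "path p" "pathfinish p = pathstart p" "path_image p \<subseteq> S" for p
    using that a
    apply (clarsimp simp: homotopic_loops_def homotopic_with_def path_defs)
    apply (rule_tac x="(h \<circ> (\<lambda>y. (fst y, (p \<circ> snd) y)))" in exI)
    apply (intro conjI continuous_on_compose continuous_intros; force elim: continuous_on_subset)
    done
  show ?thesis
    unfolding simply_connected_def
    using null by (meson homotopic_loops_sym homotopic_loops_trans)
qed

lemma contractible_imp_connected':
  fixes S :: "'a::topological_space set"
  assumes "contractible S"
  shows "connected S"
proof -
  obtain a and h :: "real \<times> 'a \<Rightarrow> 'a"
    where h: "continuous_on ({0..1} \<times> S) h" "h ` ({0..1} \<times> S) \<subseteq> S"
      "\<And>x. h (0, x) = x" "\<And>x. h (1, x) = a"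
    using assms by (auto simp: contractible_def homotopic_with_def)
  have "\<exists>T. connected T \<and> T \<subseteq> S \<and> x \<in> T \<and> a \<in> T" if "x \<in> S" for x
  proof (intro exI conjI)
    let ?T = "(\<lambda>t. h (t, x)) ` {0..1}"
    show "connected ?T"
      by (intro connected_continuous_image continuous_on_compose2[OF h(1)] continuous_intros)
        (use that in auto)
    show "?T \<subseteq> S" using h(2) that by auto
    show "x \<in> ?T" using h(3) by (intro image_eqI[where x = 0]) auto
    show "a \<in> ?T" using h(4) by (intro image_eqI[where x = 1]) auto
  qed
  then obtain T where T: "\<And>x. x \<in> S \<Longrightarrow> connected (T x) \<and> T x \<subseteq> S \<and> x \<in> T x \<and> a \<in> T x"
    by metis
  have "S = (\<Union>x\<in>S. T x)" using T by blast
  moreover have "connected (\<Union>x\<in>S. T x)"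
    by (rule connected_Union) (use T in blast)+
  ultimately show ?thesis by simp
qed

lemma contractibleI:
  fixes S :: "'a::topological_space set" and h :: "real \<times> 'a \<Rightarrow> 'a"
  assumes "continuous_on ({0..1} \<times> S) h" "\<And>t x. t \<in> {0..1} \<Longrightarrow> x \<in> S \<Longrightarrow> h (t, x) \<in> S"
    "\<And>x. x \<in> S \<Longrightarrow> h (0, x) = x" "\<And>x. x \<in> S \<Longrightarrow> h (1, x) = a"
  shows "contractible S"
  unfolding contractible_def
  using assms by (intro exI[where x = a]) (auto simp: homotopic_with)

text \<open>Two quotients of one space with the same fibres are homeomorphic. In the application
  \<open>X\<close> is a chart domain, \<open>q1\<close> its projection to the orbit space and
  \<open>q2\<close> its map into \<open>M\<close>.\<close>

lemma homeomorphic_map_from_quotient_maps: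
  assumes q1: "quotient_map X Y q1" and q2: "quotient_map X Z q2"
    and fib: "\<And>x y. x \<in> topspace X \<Longrightarrow> y \<in> topspace X \<Longrightarrow> q2 x = q2 y \<Longrightarrow> q1 x = q1 y"
    and \<phi>: "\<And>x. x \<in> topspace X \<Longrightarrow> \<phi> (q1 x) = q2 x"
  shows "homeomorphic_map Y Z \<phi>"
proof -
  have "quotient_map X Z (\<phi> \<circ> q1)"
    using quotient_map_eq[OF q2] \<phi> by simp
  then have "quotient_map Y Z \<phi>"
    using q1 quotient_map_compose_eq by blast
  moreover have "inj_on \<phi> (topspace Y)"
  proof (rule inj_onI)
    fix u v assume "u \<in> topspace Y" "v \<in> topspace Y" "\<phi> u = \<phi> v"
    moreover have "topspace Y = q1 ` topspace X"
      using q1 by (simp add: quotient_map_def)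
    ultimately obtain x y where "x \<in> topspace X" "y \<in> topspace X" "u = q1 x" "v = q1 y"
      by blast
    with \<open>\<phi> u = \<phi> v\<close> show "u = v" using fib[of x y] \<phi> by metis
  qed
  ultimately show ?thesis by (simp add: homeomorphic_map_def)
qed

text \<open>The union of a chain of atlases is an atlas, because any two charts lie in a common
  member. Zorn's lemma then gives the maximal atlas, whereas collecting all charts compatible with
  \<open>A\<close> would require transitivity of \<open>qcompatible\<close>.\<close>

lemma quasifold_if_qatlas:
  assumes "qatlas k T A"
  shows "quasifold k T"
proof -
  define \<A> where "\<A> = {B. qatlas k T B \<and> A \<subseteq> B}"
  have "\<exists>M\<in>\<A>. \<forall>X\<in>\<A>. M \<subseteq> X \<longrightarrow> X = M"
  proof (rule subset_Zorn_nonempty)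
    show "\<A> \<noteq> {}" using assms unfolding \<A>_def by blast
  next
    fix C assume C: "C \<noteq> {}" "subset.chain \<A> C"
    then have sub: "\<And>B. B \<in> C \<Longrightarrow> qatlas k T B \<and> A \<subseteq> B"
      and ch: "\<And>B B'. B \<in> C \<Longrightarrow> B' \<in> C \<Longrightarrow> B \<subseteq> B' \<or> B' \<subseteq> B"
      unfolding subset_chain_def \<A>_def by blast+
    have "is_qchart k T a" if "a \<in> \<Union>C" for a
      using that sub unfolding qatlas_def by blast
    moreover have "(\<Union>a\<in>\<Union>C. fst a) = topspace T"
    proof -
      obtain B where "B \<in> C" using C by blast
      have "(\<Union>a\<in>B. fst a) = topspace T" if "B \<in> C" for B
        using sub[OF that] unfolding qatlas_def by blast
      then show ?thesis using \<open>B \<in> C\<close> by blast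
    qed
    moreover have "qcompatible k a b" if a: "a \<in> \<Union>C" and b: "b \<in> \<Union>C" for a b
    proof -
      obtain B where "B \<in> C" "a \<in> B" "b \<in> B"
        using a b ch by blast
      then show ?thesis using sub unfolding qatlas_def by blast
    qed
    ultimately have "qatlas k T (\<Union>C)" unfolding qatlas_def by blast
    moreover have "A \<subseteq> \<Union>C" using C sub by blast
    ultimately show "\<Union>C \<in> \<A>" unfolding \<A>_def by (intro CollectI conjI)
  qed
  then obtain M where "qatlas k T M" "A \<subseteq> M"
    and max: "\<And>B. qatlas k T B \<and> A \<subseteq> B \<Longrightarrow> M \<subseteq> B \<Longrightarrow> B = M"
    unfolding \<A>_def by (metis (no_types, lifting) mem_Collect_eq)
  have "quasifold_structure k T M"
    unfolding quasifold_structure_def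
  proof (intro conjI allI impI)
    fix B assume B: "qatlas k T B \<and> M \<subseteq> B"
    with \<open>A \<subseteq> M\<close> show "B = M" by (intro max) auto
  qed fact
  then show ?thesis unfolding quasifold_def by (rule exI)
qed

lemma continuous_on_coord [continuous_intros]: "continuous_on S (\<lambda>x. x k :: 'b::topological_space)"
  by (rule continuous_on_subset[OF continuous_on_product_coordinates]) simp

lemma openin_Euclidean_iff:
  "openin (Euclidean_space k) S \<longleftrightarrow> (\<exists>U. open U \<and> S = Rspace k \<inter> U)"
  unfolding Euclidean_space_def topspace_subtopology
  by (auto simp: openin_subtopology euclidean_product_topology)

lemma openin_Euclidean_iff':
  "openin (Euclidean_space k) S \<longleftrightarrow> openin (top_of_set (Rspace k)) S"
  by (auto simp: openin_Euclidean_iff openin_open)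


section \<open>Elementary functions are smooth\<close>

text \<open>This class is closed under composition and under partial derivatives; hence an explicit formula
  for a map proves its smoothness.\<close>

inductive elem_fun :: "rvec set \<Rightarrow> (rvec \<Rightarrow> real) \<Rightarrow> bool" for S where
  const: "elem_fun S (\<lambda>_. c)"
| coord: "elem_fun S (\<lambda>x. x i)"
| add: "elem_fun S f \<Longrightarrow> elem_fun S g \<Longrightarrow> elem_fun S (\<lambda>x. f x + g x)"
| mult: "elem_fun S f \<Longrightarrow> elem_fun S g \<Longrightarrow> elem_fun S (\<lambda>x. f x * g x)"
| sin: "elem_fun S f \<Longrightarrow> elem_fun S (\<lambda>x. sin (f x))"
| cos: "elem_fun S f \<Longrightarrow> elem_fun S (\<lambda>x. cos (f x))"
| arctan: "elem_fun S f \<Longrightarrow> elem_fun S (\<lambda>x. arctan (f x))"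
| sqrt: "elem_fun S f \<Longrightarrow> (\<And>x. x \<in> S \<Longrightarrow> f x > 0) \<Longrightarrow> elem_fun S (\<lambda>x. sqrt (f x))"
| inverse: "elem_fun S f \<Longrightarrow> (\<And>x. x \<in> S \<Longrightarrow> f x \<noteq> 0) \<Longrightarrow> elem_fun S (\<lambda>x. inverse (f x))"
| cong: "elem_fun S f \<Longrightarrow> (\<And>x. x \<in> S \<Longrightarrow> f x = g x) \<Longrightarrow> elem_fun S g"

lemma elem_fun_minus: "elem_fun S f \<Longrightarrow> elem_fun S (\<lambda>x. - f x)"
  using elem_fun.mult[OF elem_fun.const[of S "-1"], of f] by simp

lemma elem_fun_diff: "elem_fun S f \<Longrightarrow> elem_fun S g \<Longrightarrow> elem_fun S (\<lambda>x. f x - g x)"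
  using elem_fun.add[OF _ elem_fun_minus, of S f g] by simp

lemma elem_fun_divide:
  "elem_fun S f \<Longrightarrow> elem_fun S g \<Longrightarrow> (\<And>x. x \<in> S \<Longrightarrow> g x \<noteq> 0) \<Longrightarrow> elem_fun S (\<lambda>x. f x / g x)"
  using elem_fun.mult[OF _ elem_fun.inverse, of S f g] by (simp add: divide_inverse)

lemma elem_fun_power: "elem_fun S f \<Longrightarrow> elem_fun S (\<lambda>x. f x ^ n)"
  by (induction n) (auto intro: elem_fun.const elem_fun.mult)

lemma elem_fun_sum:
  "(\<And>i. i \<in> I \<Longrightarrow> elem_fun S (f i)) \<Longrightarrow> elem_fun S (\<lambda>x. \<Sum>i\<in>I. f i x)"
  by (induction I rule: infinite_finite_induct) (auto intro: elem_fun.const elem_fun.add)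

lemmas elem_fun_intros =
  elem_fun.const elem_fun.coord elem_fun.add elem_fun.mult elem_fun.sin elem_fun.cos
  elem_fun.arctan elem_fun_minus elem_fun_diff elem_fun_power elem_fun_sum

lemma elem_fun_compose:
  assumes "elem_fun T f" "\<And>i. elem_fun S (\<lambda>x. u x i)" "u ` S \<subseteq> T"
  shows "elem_fun S (\<lambda>x. f (u x))"
  using assms(1)
proof induction
  case (cong f g)
  show ?case by (rule elem_fun.cong[OF cong.IH]) (use cong assms(3) in auto)
next
  case (sqrt f)
  show ?case by (rule elem_fun.sqrt[OF sqrt.IH]) (use sqrt assms(3) in auto)
next
  case (inverse f)
  show ?case by (rule elem_fun.inverse[OF inverse.IH]) (use inverse assms(3) in auto)
qed (use assms in \<open>auto intro: elem_fun_intros\<close>)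

lemma elem_fun_continuous: "elem_fun S f \<Longrightarrow> continuous_on S f"
proof (induction rule: elem_fun.induct)
  case (coord i)
  show ?case by (rule continuous_on_subset[OF continuous_on_product_coordinates]) simp
next
  case (cong f g)
  then show ?case using continuous_on_cong by force
qed (auto intro!: continuous_intros)

text \<open>A partial derivative at a point of an open set sees only values inside the set. This is
  what makes equality on \<open>S\<close> enough to compare derivatives; \<open>i < k\<close> keeps
  the varied point in the Euclidean space.\<close>

lemma eventually_fun_upd_in_open:
  assumes "openin (Euclidean_space k) S" "i < k" "x \<in> S"
  shows "eventually (\<lambda>t. x(i := t) \<in> S) (nhds (x i))"
proof -
  obtain U where U: "open U" "S = Rspace k \<inter> U"
    using assms(1) openin_Euclidean_iff by blast
  have "continuous_on UNIV (\<lambda>t. x(i := t) :: rvec)"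
  proof (rule continuous_on_coordinatewise_then_product)
    show "continuous_on UNIV (\<lambda>t. (x(i := t)) j)" for j
      by (cases "j = i") auto
  qed
  then have "open ((\<lambda>t. x(i := t)) -` U)"
    using U(1) by (simp add: continuous_on_open_vimage)
  moreover have "x i \<in> (\<lambda>t. x(i := t)) -` U" using assms(3) U(2) by simp
  ultimately have "eventually (\<lambda>t. t \<in> (\<lambda>t. x(i := t)) -` U) (nhds (x i))"
    by (rule eventually_nhds_in_open)
  then show ?thesis
    by eventually_elim (use assms U in \<open>auto simp: topspace_Euclidean_space\<close>)
qed

text \<open>The derivative of each generator is again built from generators, and the side conditions
  of \<open>sqrt\<close> and \<open>inverse\<close> are exactly what keeps the new denominators
  nonzero.\<close>

lemma elem_fun_partial:
  assumes S: "openin (Euclidean_space k) S" and i: "i < k" and f: "elem_fun S f"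
  shows "\<exists>g. elem_fun S g \<and>
    (\<forall>x\<in>S. ((\<lambda>t. f (x(i := t))) has_real_derivative g x) (at (x i)))"
  using f
proof induction
  case (const c)
  show ?case by (intro exI[where x = "\<lambda>_. 0"]) (auto intro: elem_fun.const)
next
  case (coord j)
  show ?case
    by (intro exI[where x = "\<lambda>_. if i = j then 1 else 0"]) (auto intro: elem_fun.const)
next
  case (add f g)
  then obtain f' g' where *: "elem_fun S f'" "elem_fun S g'"
    "\<And>x. x \<in> S \<Longrightarrow> ((\<lambda>t. f (x(i := t))) has_real_derivative f' x) (at (x i))"
    "\<And>x. x \<in> S \<Longrightarrow> ((\<lambda>t. g (x(i := t))) has_real_derivative g' x) (at (x i))" by blast
  show ?case
    by (intro exI[where x = "\<lambda>x. f' x + g' x"] conjI ballI elem_fun.add * DERIV_add)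
next
  case (mult f g)
  then obtain f' g' where *: "elem_fun S f'" "elem_fun S g'"
    "\<And>x. x \<in> S \<Longrightarrow> ((\<lambda>t. f (x(i := t))) has_real_derivative f' x) (at (x i))"
    "\<And>x. x \<in> S \<Longrightarrow> ((\<lambda>t. g (x(i := t))) has_real_derivative g' x) (at (x i))" by blast
  have "((\<lambda>t. f (x(i := t)) * g (x(i := t))) has_real_derivative f' x * g x + g' x * f x) (at (x i))"
    if "x \<in> S" for x
    using DERIV_mult[OF *(3,4)[OF that]] by simp
  then show ?case
    by (intro exI[where x = "\<lambda>x. f' x * g x + g' x * f x"] conjI ballI elem_fun.add elem_fun.mult * mult.hyps)
next
  case (sin f)
  then obtain f' where *: "elem_fun S f'"
    "\<And>x. x \<in> S \<Longrightarrow> ((\<lambda>t. f (x(i := t))) has_real_derivative f' x) (at (x i))" by blast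
  have "elem_fun S (\<lambda>x. cos (f x) * f' x)"
    by (intro elem_fun_intros * sin.hyps)
  moreover have "((\<lambda>t. sin (f (x(i := t)))) has_real_derivative cos (f x) * f' x) (at (x i))"
    if "x \<in> S" for x
    using DERIV_chain2[OF DERIV_sin *(2)[OF that]] by simp
  ultimately show ?case by blast
next
  case (cos f)
  then obtain f' where *: "elem_fun S f'"
    "\<And>x. x \<in> S \<Longrightarrow> ((\<lambda>t. f (x(i := t))) has_real_derivative f' x) (at (x i))" by blast
  have "elem_fun S (\<lambda>x. - sin (f x) * f' x)"
    by (intro elem_fun_intros * cos.hyps)
  moreover have "((\<lambda>t. cos (f (x(i := t)))) has_real_derivative - sin (f x) * f' x) (at (x i))"
    if "x \<in> S" for x
    using DERIV_chain2[OF DERIV_cos *(2)[OF that]] by simp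
  ultimately show ?case by blast
next
  case (arctan f)
  then obtain f' where *: "elem_fun S f'"
    "\<And>x. x \<in> S \<Longrightarrow> ((\<lambda>t. f (x(i := t))) has_real_derivative f' x) (at (x i))" by blast
  have "1 + (f x)\<^sup>2 \<noteq> 0" for x
    by (smt (verit) zero_le_power2)
  then have "elem_fun S (\<lambda>x. inverse (1 + (f x)\<^sup>2) * f' x)"
    by (intro elem_fun_intros elem_fun.inverse * arctan.hyps)
  moreover have "((\<lambda>t. arctan (f (x(i := t)))) has_real_derivative inverse (1 + (f x)\<^sup>2) * f' x) (at (x i))"
    if "x \<in> S" for x
    using DERIV_chain2[OF DERIV_arctan *(2)[OF that]] by simp
  ultimately show ?case by blast
next
  case (sqrt f)
  then obtain f' where f': "elem_fun S f'"
    "\<And>x. x \<in> S \<Longrightarrow> ((\<lambda>t. f (x(i := t))) has_real_derivative f' x) (at (x i))" by blast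
  show ?case
  proof (intro exI[where x = "\<lambda>x. f' x / (2 * sqrt (f x))"] conjI ballI)
    show "elem_fun S (\<lambda>x. f' x / (2 * sqrt (f x)))"
    proof (intro elem_fun_divide elem_fun_intros elem_fun.sqrt sqrt.hyps f')
      show "2 * sqrt (f x) \<noteq> 0" if "x \<in> S" for x
        using sqrt.hyps(2)[OF that] by simp
    qed
    fix x assume x: "x \<in> S"
    have "DERIV (\<lambda>y. sqrt y) (f (x(i := x i))) :> inverse (sqrt (f x)) / 2"
      using DERIV_real_sqrt[OF sqrt.hyps(2)[OF x]] by simp
    from DERIV_chain2[OF this f'(2)[OF x]]
    show "((\<lambda>t. sqrt (f (x(i := t)))) has_real_derivative f' x / (2 * sqrt (f x))) (at (x i))"
      by (simp add: field_simps)
  qed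
next
  case (inverse f)
  then obtain f' where f': "elem_fun S f'"
    "\<And>x. x \<in> S \<Longrightarrow> ((\<lambda>t. f (x(i := t))) has_real_derivative f' x) (at (x i))" by blast
  show ?case
  proof (intro exI[where x = "\<lambda>x. - f' x / (f x)\<^sup>2"] conjI ballI)
    show "elem_fun S (\<lambda>x. - f' x / (f x)\<^sup>2)"
      by (intro elem_fun_divide elem_fun_intros inverse.hyps f') (use inverse in auto)
    fix x assume x: "x \<in> S"
    show "((\<lambda>t. inverse (f (x(i := t)))) has_real_derivative - f' x / (f x)\<^sup>2) (at (x i))"
      using DERIV_inverse'[OF f'(2)[OF x]] inverse.hyps(2)[OF x]
      by (simp add: field_simps power2_eq_square)
  qed
next
  case (cong f g)
  then obtain f' where f': "elem_fun S f'"
    "\<And>x. x \<in> S \<Longrightarrow> ((\<lambda>t. f (x(i := t))) has_real_derivative f' x) (at (x i))" by blast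
  \<comment> \<open>Only here is openness of \<open>S\<close> essential: \<open>f\<close> and
    \<open>g\<close> agree on \<open>S\<close>, hence near each of its points.\<close>
  have "((\<lambda>t. g (x(i := t))) has_real_derivative f' x) (at (x i))" if x: "x \<in> S" for x
  proof -
    have "eventually (\<lambda>t. f (x(i := t)) = g (x(i := t))) (nhds (x i))"
      using eventually_fun_upd_in_open[OF S i x] by eventually_elim (use cong in auto)
    from DERIV_cong_ev[OF refl this refl] show ?thesis
      using f'(2)[OF x] by blast
  qed
  with f' show ?case by blast
qed

lemma elem_fun_imp_smooth_fun:
  assumes S: "openin (Euclidean_space k) S" and f: "elem_fun S f"
  shows "smooth_fun k S f"
proof -
  \<comment> \<open>Off \<open>S\<close> an iterated \<open>deriv\<close> may take any value. Hence
    the induction carries agreement on \<open>S\<close> with an elementary function, not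
    elementarity of \<open>iterated_partial\<close> by its own formula.\<close>
  have ip: "\<exists>g. elem_fun S g \<and> (\<forall>x\<in>S. iterated_partial is f x = g x)"
    if "set is \<subseteq> {..<k}" for "is"
    using that
  proof (induction "is")
    case Nil
    then show ?case using f by auto
  next
    case (Cons i "is")
    then obtain g where g: "elem_fun S g" "\<And>x. x \<in> S \<Longrightarrow> iterated_partial is f x = g x" by auto
    have i: "i < k" using Cons by simp
    obtain g' where g': "elem_fun S g'"
      "\<And>x. x \<in> S \<Longrightarrow> ((\<lambda>t. g (x(i := t))) has_real_derivative g' x) (at (x i))"
      using elem_fun_partial[OF S i g(1)] by blast
    have "iterated_partial (i # is) f x = g' x" if x: "x \<in> S" for x
    proof -
      have "eventually (\<lambda>t. g (x(i := t)) = iterated_partial is f (x(i := t))) (nhds (x i))"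
        using eventually_fun_upd_in_open[OF S i x] by eventually_elim (use g in auto)
      from DERIV_cong_ev[OF refl this refl]
      have "((\<lambda>t. iterated_partial is f (x(i := t))) has_real_derivative g' x) (at (x i))"
        using g'(2)[OF x] by blast
      then show ?thesis by (simp add: DERIV_imp_deriv)
    qed
    then show ?case using g' by blast
  qed
  show ?thesis
    unfolding smooth_fun_def
  proof (intro allI impI conjI ballI)
    fix "is" assume "set is \<subseteq> {..<k}"
    then obtain g where g: "elem_fun S g" "\<And>x. x \<in> S \<Longrightarrow> iterated_partial is f x = g x"
      using ip by blast
    show "continuous_on S (iterated_partial is f)"
      using elem_fun_continuous[OF g(1)] g(2) continuous_on_cong by force
    fix i x assume i: "i < k" and x: "x \<in> S"
    obtain g' where g': "((\<lambda>t. g (x(i := t))) has_real_derivative g') (at (x i))"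
      using elem_fun_partial[OF S i g(1)] x by blast
    have "eventually (\<lambda>t. g (x(i := t)) = iterated_partial is f (x(i := t))) (nhds (x i))"
      using eventually_fun_upd_in_open[OF S i x] by eventually_elim (use g in auto)
    from DERIV_cong_ev[OF refl this refl]
    have "((\<lambda>t. iterated_partial is f (x(i := t))) has_real_derivative g') (at (x i))"
      using g' by blast
    then show "(\<lambda>t. iterated_partial is f (x(i := t))) differentiable (at (x i))"
      using real_differentiable_def by blast
  qed
qed

lemma smooth_onI:
  assumes "openin (Euclidean_space k) S" "\<And>i. elem_fun S (\<lambda>x. f x i)"
  shows "smooth_on k S f"
  unfolding smooth_on_def using assms elem_fun_imp_smooth_fun by blast

section \<open>Adapted bases among the normals\<close>

lemma span_image_eq_range_sum:
  fixes X :: "nat \<Rightarrow> 'v::real_vector"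
  assumes "finite J"
  shows "span (X ` J) = range (\<lambda>x. \<Sum>j\<in>J. x j *\<^sub>R X j)"
proof
  show "span (X ` J) \<subseteq> range (\<lambda>x. \<Sum>j\<in>J. x j *\<^sub>R X j)"
  proof (rule span_minimal)
    show "X ` J \<subseteq> range (\<lambda>x. \<Sum>j\<in>J. x j *\<^sub>R X j)"
    proof clarify
      fix i assume "i \<in> J"
      then have "X i = (\<Sum>j\<in>J. (if j = i then 1 else 0) *\<^sub>R X j)"
        using assms by (simp add: if_distrib[of "\<lambda>c. c *\<^sub>R _"] cong: if_cong)
      then show "X i \<in> range (\<lambda>x. \<Sum>j\<in>J. x j *\<^sub>R X j)"
        by (rule range_eqI[where x = "\<lambda>j. if j = i then 1 else 0"])
    qed
    show "subspace (range (\<lambda>x. \<Sum>j\<in>J. x j *\<^sub>R X j))"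
    proof (rule subspaceI)
      show "0 \<in> range (\<lambda>x. \<Sum>j\<in>J. x j *\<^sub>R X j)"
        by (rule range_eqI[where x = "\<lambda>_. 0"]) simp
    next
      fix v w assume "v \<in> range (\<lambda>x. \<Sum>j\<in>J. x j *\<^sub>R X j)" "w \<in> range (\<lambda>x. \<Sum>j\<in>J. x j *\<^sub>R X j)"
      then obtain x y where "v = (\<Sum>j\<in>J. x j *\<^sub>R X j)" "w = (\<Sum>j\<in>J. y j *\<^sub>R X j)" by blast
      then show "v + w \<in> range (\<lambda>x. \<Sum>j\<in>J. x j *\<^sub>R X j)"
        by (intro range_eqI[where x = "\<lambda>j. x j + y j"]) (simp add: scaleR_add_left sum.distrib)
    next
      fix c v assume "v \<in> range (\<lambda>x. \<Sum>j\<in>J. x j *\<^sub>R X j)"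
      then obtain x where "v = (\<Sum>j\<in>J. x j *\<^sub>R X j)" by blast
      then show "c *\<^sub>R v \<in> range (\<lambda>x. \<Sum>j\<in>J. x j *\<^sub>R X j)"
        by (intro range_eqI[where x = "\<lambda>j. c * x j"]) (simp add: scaleR_sum_right)
    qed
  qed
  show "range (\<lambda>x. \<Sum>j\<in>J. x j *\<^sub>R X j) \<subseteq> span (X ` J)"
    by (intro image_subsetI span_sum span_scale span_base imageI)
qed

text \<open>Independence is stated for families of indices, because different indices could carry the
  same vector.\<close>

definition indep_mod :: "(nat \<Rightarrow> 'v::real_vector) \<Rightarrow> nat set \<Rightarrow> nat set \<Rightarrow> bool" where
  "indep_mod X K B \<longleftrightarrow>
     (\<forall>a. (\<Sum>b\<in>B. a b *\<^sub>R X b) \<in> span (X ` K) \<longrightarrow> (\<forall>b\<in>B. a b = 0))"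

text \<open>The row \<open>g j\<close> holds the coordinates of \<open>X j\<close> with respect to
  the basis vectors \<open>X b\<close> modulo the span of the normals in \<open>K\<close>. The
  columns of \<open>g\<close> later serve as the dual basis.\<close>

definition adapted ::
  "nat \<Rightarrow> (nat \<Rightarrow> 'v::real_vector) \<Rightarrow> nat set \<Rightarrow> nat set \<Rightarrow> (nat \<Rightarrow> nat \<Rightarrow> real) \<Rightarrow> bool" where
  "adapted d X K B g \<longleftrightarrow>
     B \<subseteq> {..<d} - K \<and> indep_mod X K B \<and>
     (\<forall>j<d. X j - (\<Sum>b\<in>B. g j b *\<^sub>R X b) \<in> span (X ` K))"

lemma indep_modD:
  "indep_mod X K B \<Longrightarrow> (\<Sum>b\<in>B. a b *\<^sub>R X b) \<in> span (X ` K) \<Longrightarrow> b \<in> B \<Longrightarrow> a b = 0"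
  unfolding indep_mod_def by blast

lemma indep_mod_empty: "indep_mod X K {}"
  unfolding indep_mod_def by simp

lemma indep_mod_subset:
  assumes "indep_mod X K B" "A \<subseteq> B" "finite B"
  shows "indep_mod X K A"
  unfolding indep_mod_def
proof (intro allI impI ballI)
  fix a b assume a: "(\<Sum>b\<in>A. a b *\<^sub>R X b) \<in> span (X ` K)" and b: "b \<in> A"
  have "(\<Sum>b\<in>B. (if b \<in> A then a b else 0) *\<^sub>R X b) = (\<Sum>b\<in>A. a b *\<^sub>R X b)"
    using assms(2,3) by (intro sum.mono_neutral_cong_right) auto
  then show "a b = 0"
    using indep_modD[OF assms(1), of "\<lambda>b. if b \<in> A then a b else 0" b] a b assms(2) by auto
qed

text \<open>Basis extension on index sets: \<open>B\<close> is maximal among the independent sets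
  containing \<open>I\<close>. Any further index gives a dependency whose coefficient at that index
  cannot vanish, so it can be solved for the new vector.\<close>

lemma adapted_exists:
  fixes X :: "nat \<Rightarrow> 'v::real_vector"
  assumes I: "I \<subseteq> {..<d}" "indep_mod X K I"
  obtains B g where "I \<subseteq> B" "adapted d X K B g"
proof -
  define \<A> where "\<A> = {B. B \<subseteq> {..<d} \<and> indep_mod X K B}"
  have "finite \<A>"
    by (rule finite_subset[of _ "Pow {..<d}"]) (auto simp: \<A>_def)
  moreover have "I \<in> \<A>" using I unfolding \<A>_def by simp
  ultimately obtain B where "B \<in> \<A>" "I \<subseteq> B" and mx: "\<forall>B'\<in>\<A>. B \<subseteq> B' \<longrightarrow> B = B'"
    by (metis finite_has_maximal2)
  then have B: "B \<subseteq> {..<d}" "indep_mod X K B" "I \<subseteq> B"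
    unfolding \<A>_def by auto
  have max: "B = B'" if "B' \<subseteq> {..<d}" "indep_mod X K B'" "B \<subseteq> B'" for B'
    using mx that unfolding \<A>_def by simp
  have fin: "finite B" using B(1) finite_subset by blast
  have disj: "b \<notin> K" if "b \<in> B" for b
  proof
    assume "b \<in> K"
    then have "(\<Sum>c\<in>B. (if c = b then 1 else 0) *\<^sub>R X c) \<in> span (X ` K)"
      using fin that
      by (simp add: if_distrib[of "\<lambda>c. c *\<^sub>R _"] span_base cong: if_cong)
    from indep_modD[OF B(2) this that] show False by simp
  qed
  have "\<exists>c. X j - (\<Sum>b\<in>B. c b *\<^sub>R X b) \<in> span (X ` K)" if j: "j < d" for j
  proof (cases "j \<in> B")
    case True
    then have "X j - (\<Sum>b\<in>B. (if b = j then 1 else 0) *\<^sub>R X b) = 0"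
      using fin by (simp add: if_distrib[of "\<lambda>c. c *\<^sub>R _"] cong: if_cong)
    then show ?thesis by (metis span_zero)
  next
    case False
    then have "\<not> indep_mod X K (insert j B)"
      using max[of "insert j B"] j B(1) by blast
    then obtain a i where a: "(\<Sum>b\<in>insert j B. a b *\<^sub>R X b) \<in> span (X ` K)"
      and i: "i \<in> insert j B" "a i \<noteq> 0"
      unfolding indep_mod_def by blast
    have aj: "a j \<noteq> 0"
    proof
      assume "a j = 0"
      then have "(\<Sum>b\<in>B. a b *\<^sub>R X b) \<in> span (X ` K)" using a fin False by simp
      with indep_modD[OF B(2)] i \<open>a j = 0\<close> show False by blast
    qed
    have "(1 / a j) *\<^sub>R (\<Sum>b\<in>insert j B. a b *\<^sub>R X b) \<in> span (X ` K)"
      using a by (rule span_scale)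
    also have "(1 / a j) *\<^sub>R (\<Sum>b\<in>insert j B. a b *\<^sub>R X b)
      = X j - (\<Sum>b\<in>B. (- a b / a j) *\<^sub>R X b)"
      using fin False aj by (simp add: scaleR_add_right scaleR_sum_right sum_negf)
    finally show ?thesis by (rule exI[where x = "\<lambda>b. - a b / a j"])
  qed
  then obtain g where "\<And>j. j < d \<Longrightarrow> X j - (\<Sum>b\<in>B. g j b *\<^sub>R X b) \<in> span (X ` K)" by metis
  then have "adapted d X K B g"
    unfolding adapted_def using B disj by auto
  with B(3) that show ?thesis by blast
qed

lemma adapted_finite: "adapted d X K B g \<Longrightarrow> finite B"
  unfolding adapted_def using finite_subset[of B "{..<d} - K"] by blast

lemma adapted_unique:
  assumes "adapted d X K B g" "v - (\<Sum>b\<in>B. a b *\<^sub>R X b) \<in> span (X ` K)"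
    "v - (\<Sum>b\<in>B. a' b *\<^sub>R X b) \<in> span (X ` K)" "b \<in> B"
  shows "a b = a' b"
proof -
  have "(v - (\<Sum>b\<in>B. a' b *\<^sub>R X b)) - (v - (\<Sum>b\<in>B. a b *\<^sub>R X b)) \<in> span (X ` K)"
    by (intro span_diff assms)
  also have "(v - (\<Sum>b\<in>B. a' b *\<^sub>R X b)) - (v - (\<Sum>b\<in>B. a b *\<^sub>R X b)) =
    (\<Sum>b\<in>B. (a b - a' b) *\<^sub>R X b)"
    by (simp add: scaleR_diff_left sum_subtractf)
  finally show ?thesis
    using indep_modD[of X K B "\<lambda>b. a b - a' b" b] assms unfolding adapted_def by simp
qed

lemma adapted_coeff:
  assumes "adapted d X K B g" "j < d" "X j - (\<Sum>b\<in>B. a b *\<^sub>R X b) \<in> span (X ` K)" "b \<in> B"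
  shows "g j b = a b"
  using adapted_unique[OF assms(1) _ assms(3,4)] assms(1,2) unfolding adapted_def by blast

lemma adapted_coeff_zero:
  assumes "adapted d X K B g" "j < d" "j \<in> K" "b \<in> B"
  shows "g j b = 0"
  by (rule adapted_coeff[OF assms(1,2) _ assms(4)]) (use assms in \<open>simp add: span_base\<close>)

lemma adapted_coeff_basis:
  assumes "adapted d X K B g" "j \<in> B" "b \<in> B"
  shows "g j b = (if b = j then 1 else 0)"
proof (rule adapted_coeff[OF assms(1) _ _ assms(3)])
  show "j < d" using assms unfolding adapted_def by blast
  show "X j - (\<Sum>b\<in>B. (if b = j then 1 else 0) *\<^sub>R X b) \<in> span (X ` K)"
    using adapted_finite[OF assms(1)] assms(2)
    by (simp add: if_distrib[of "\<lambda>c. c *\<^sub>R _"] span_zero cong: if_cong)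
qed

lemma adapted_sum:
  assumes "adapted d X K B g" "J \<subseteq> {..<d}"
  shows "(\<Sum>j\<in>J. x j *\<^sub>R X j) - (\<Sum>b\<in>B. (\<Sum>j\<in>J. x j * g j b) *\<^sub>R X b) \<in> span (X ` K)"
proof -
  have "(\<Sum>b\<in>B. (\<Sum>j\<in>J. x j * g j b) *\<^sub>R X b) = (\<Sum>b\<in>B. \<Sum>j\<in>J. (x j * g j b) *\<^sub>R X b)"
    by (simp add: scaleR_sum_left)
  also have "\<dots> = (\<Sum>j\<in>J. \<Sum>b\<in>B. (x j * g j b) *\<^sub>R X b)"
    by (rule sum.swap)
  finally have "(\<Sum>j\<in>J. x j *\<^sub>R X j) - (\<Sum>b\<in>B. (\<Sum>j\<in>J. x j * g j b) *\<^sub>R X b)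
    = (\<Sum>j\<in>J. x j *\<^sub>R (X j - (\<Sum>b\<in>B. g j b *\<^sub>R X b)))"
    by (simp add: sum_subtractf[symmetric] scaleR_diff_right scaleR_sum_right)
  also have "\<dots> \<in> span (X ` K)"
    using assms unfolding adapted_def by (intro span_sum span_scale) auto
  finally show ?thesis .
qed

text \<open>Each column of \<open>g\<close> respects every linear relation among the normals, so it
  is the value table of a functional on the whole space that vanishes on the normals in
  \<open>K\<close>.\<close>

lemma adapted_relation:
  assumes "adapted d X K B g" "(\<Sum>j<d. x j *\<^sub>R X j) \<in> span (X ` K)" "b \<in> B"
  shows "(\<Sum>j<d. x j * g j b) = 0"
proof -
  have "(\<Sum>b\<in>B. (\<Sum>j<d. x j * g j b) *\<^sub>R X b) \<in> span (X ` K)"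
    using span_diff[OF assms(2) adapted_sum[OF assms(1) order_refl, of x]] by simp
  then show ?thesis
    using indep_modD[of X K B "\<lambda>b. \<Sum>j<d. x j * g j b" b] assms unfolding adapted_def by blast
qed

text \<open>Expanding \<open>X j\<close> first in the basis \<open>B'\<close> and then in
  \<open>B\<close> must give its unique coordinates in \<open>B\<close>: the change-of-basis formula
  behind the transition maps.\<close>

lemma adapted_change:
  assumes "adapted d X K B g" "adapted d X K B' g'" "j < d" "b \<in> B"
  shows "g j b = (\<Sum>c\<in>B'. g' j c * g c b)"
proof (rule adapted_coeff[OF assms(1,3) _ assms(4)])
  have B': "B' \<subseteq> {..<d}" using assms(2) unfolding adapted_def by blast
  have "X j - (\<Sum>c\<in>B'. g' j c *\<^sub>R X c) \<in> span (X ` K)"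
    using assms unfolding adapted_def by blast
  from span_add[OF this adapted_sum[OF assms(1) B', of "g' j"]]
  show "X j - (\<Sum>b\<in>B. (\<Sum>c\<in>B'. g' j c * g c b) *\<^sub>R X b) \<in> span (X ` K)" by simp
qed


section \<open>Linear functionals on a finite-dimensional normed space\<close>

text \<open>One half of the equivalence of norms in finite dimension: by independence the continuous
  map from coefficients to the norm of the combination has a positive minimum on the compact
  \<open>l1\<close> unit sphere, and scaling gives the rest.\<close>

lemma independent_norm_bound:
  fixes B :: "'v::real_normed_vector set"
  assumes "finite B" "independent B"
  obtains \<delta> where "\<delta> > 0" "\<And>c. \<delta> * (\<Sum>b\<in>B. \<bar>c b\<bar>) \<le> norm (\<Sum>b\<in>B. c b *\<^sub>R b)"
proof (cases "B = {}")
  case True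
  with that[of 1] show ?thesis by simp
next
  case False
  \<comment> \<open>Coefficients are forced to 0 off \<open>B\<close> and to the interval from -1 to
    1 on \<open>B\<close>, so the sphere is a closed part of a product of compact sets.\<close>
  define C :: "('v \<Rightarrow> real) set"
    where "C = Pi\<^sub>E UNIV (\<lambda>b. if b \<in> B then {-1..1} else {0}) \<inter> {c. (\<Sum>b\<in>B. \<bar>c b\<bar>) = 1}"
  have coord: "continuous_on S (\<lambda>c. c b :: real)" for S and b :: 'v
    by (rule continuous_on_subset[OF continuous_on_product_coordinates]) simp
  have "compactin (product_topology (\<lambda>_. euclidean) UNIV)
      (Pi\<^sub>E UNIV (\<lambda>b. if b \<in> B then {-1..1::real} else {0}))"
    by (auto simp: compactin_PiE)
  then have "compact (Pi\<^sub>E UNIV (\<lambda>b. if b \<in> B then {-1..1::real} else {0}))"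
    by (simp add: euclidean_product_topology)
  moreover have "closed {c :: 'v \<Rightarrow> real. (\<Sum>b\<in>B. \<bar>c b\<bar>) = 1}"
    by (intro closed_Collect_eq continuous_intros coord)
  ultimately have "compact C" unfolding C_def by (rule compact_Int_closed)
  moreover have "C \<noteq> {}"
  proof -
    obtain b0 where b0: "b0 \<in> B" using False by blast
    have "(\<Sum>b\<in>B. \<bar>if b = b0 then 1 else 0 :: real\<bar>) = (\<Sum>b\<in>B. if b = b0 then 1 else 0)"
      by (intro sum.cong) auto
    also have "\<dots> = 1" using b0 assms(1) by simp
    finally have "(\<lambda>b. if b = b0 then 1 else 0) \<in> C"
      using b0 unfolding C_def by auto
    then show ?thesis by blast
  qed
  moreover have "continuous_on C (\<lambda>c. norm (\<Sum>b\<in>B. c b *\<^sub>R b))"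
    by (intro continuous_intros coord)
  ultimately have "\<exists>c0\<in>C. \<forall>c\<in>C. norm (\<Sum>b\<in>B. c0 b *\<^sub>R b) \<le> norm (\<Sum>b\<in>B. c b *\<^sub>R b)"
    by (rule continuous_attains_inf)
  then obtain c0 where c0: "c0 \<in> C"
    and min: "\<And>c. c \<in> C \<Longrightarrow> norm (\<Sum>b\<in>B. c0 b *\<^sub>R b) \<le> norm (\<Sum>b\<in>B. c b *\<^sub>R b)"
    by (elim bexE) simp
  let ?\<delta> = "norm (\<Sum>b\<in>B. c0 b *\<^sub>R b)"
  have "?\<delta> \<noteq> 0"
  proof
    assume "?\<delta> = 0"
    then have "(\<Sum>b\<in>B. c0 b *\<^sub>R b) = 0" by simp
    then have "c0 b = 0" if "b \<in> B" for b
      using independentD[OF assms(2,1) order_refl] that by blast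
    then have "(\<Sum>b\<in>B. \<bar>c0 b\<bar>) = 0" by simp
    with c0 show False unfolding C_def by auto
  qed
  show ?thesis
  proof (rule that)
    show "?\<delta> > 0" using \<open>?\<delta> \<noteq> 0\<close> by simp
    fix c :: "'v \<Rightarrow> real"
    let ?s = "\<Sum>b\<in>B. \<bar>c b\<bar>"
    show "?\<delta> * ?s \<le> norm (\<Sum>b\<in>B. c b *\<^sub>R b)"
    proof (cases "?s = 0")
      case False
      have s: "?s > 0" using False by (simp add: order_less_le sum_nonneg)
      have cs: "\<bar>c b\<bar> \<le> ?s" if "b \<in> B" for b
        using that assms(1) by (intro member_le_sum) auto
      have "(\<Sum>b\<in>B. \<bar>if b \<in> B then c b / ?s else 0\<bar>) = (\<Sum>b\<in>B. \<bar>c b\<bar> / ?s)"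
        using s by (intro sum.cong) auto
      also have "\<dots> = 1" using s by (simp add: sum_divide_distrib[symmetric])
      finally have "(\<lambda>b. if b \<in> B then c b / ?s else 0) \<in> C"
        using cs s unfolding C_def
        by (auto simp: pos_divide_le_eq pos_le_divide_eq abs_le_iff minus_le_iff)
      from min[OF this] have "?\<delta> \<le> norm (\<Sum>b\<in>B. (c b / ?s) *\<^sub>R b)"
        by (simp cong: sum.cong)
      also have "(\<Sum>b\<in>B. (c b / ?s) *\<^sub>R b) = (1 / ?s) *\<^sub>R (\<Sum>b\<in>B. c b *\<^sub>R b)"
        by (simp add: scaleR_sum_right)
      finally show ?thesis using s by (simp add: field_simps)
    qed simp
  qed
qed

text \<open>The dual space is modelled by bounded functionals, so a functional defined through
  coordinates must be shown bounded before it is an element of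
  \<open>'v \<Rightarrow>\<^sub>L real\<close>.\<close>

lemma finite_dim_linear_imp_bounded_linear:
  fixes f :: "'v::real_normed_vector \<Rightarrow> real"
  assumes "linear f" and fin: "\<exists>B. finite B \<and> span B = (UNIV :: 'v set)"
  shows "bounded_linear f"
proof -
  obtain S where S: "finite S" "span S = (UNIV :: 'v set)" using fin by blast
  obtain B where B: "B \<subseteq> S" "independent B" "S \<subseteq> span B"
    using maximal_independent_subset by blast
  have finB: "finite B" using B(1) S(1) finite_subset by blast
  have spB: "span B = UNIV" using S(2) B(3) span_minimal[of S "span B"] by auto
  obtain \<delta> where \<delta>: "\<delta> > 0" "\<And>c. \<delta> * (\<Sum>b\<in>B. \<bar>c b\<bar>) \<le> norm (\<Sum>b\<in>B. c b *\<^sub>R b)"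
    using independent_norm_bound[OF finB B(2)] by blast
  define M where "M = (\<Sum>b\<in>B. \<bar>f b\<bar>)"
  have "\<bar>f v\<bar> \<le> norm v * (M / \<delta>)" for v
  proof -
    have "v \<in> span B" using spB by simp
    then obtain c where c: "v = (\<Sum>b\<in>B. c b *\<^sub>R b)"
      using span_finite[OF finB] by auto
    have "f v = (\<Sum>b\<in>B. c b * f b)"
      using assms(1) by (simp add: c linear_sum linear_scale)
    also have "\<bar>\<dots>\<bar> \<le> (\<Sum>b\<in>B. \<bar>c b\<bar> * \<bar>f b\<bar>)"
      by (rule order_trans[OF sum_abs]) (simp add: abs_mult)
    also have "\<dots> \<le> (\<Sum>b\<in>B. \<bar>c b\<bar> * M)"
      unfolding M_def by (intro sum_mono mult_left_mono member_le_sum finB) auto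
    also have "\<dots> = (\<Sum>b\<in>B. \<bar>c b\<bar>) * M" by (simp add: sum_distrib_right)
    also have "\<dots> \<le> (norm v / \<delta>) * M"
      using \<delta>(1) \<delta>(2)[of c]
      by (intro mult_right_mono) (auto simp: c field_simps M_def sum_nonneg)
    finally show ?thesis by simp
  qed
  then show ?thesis
    using assms(1) by (intro bounded_linear_intro[where K = "M / \<delta>"])
      (auto simp: linear_add linear_scale)
qed

text \<open>Values prescribed on a spanning family extend linearly as soon as they respect all
  linear relations, since the sum then does not depend on the chosen representation. This converts
  the equation of the level set into a point of the dual space.\<close>

lemma functional_with_values:
  fixes X :: "nat \<Rightarrow> 'v::real_normed_vector"
  assumes fin: "\<exists>B. finite B \<and> span B = (UNIV :: 'v set)"
    and sp: "span (X ` {..<d}) = UNIV"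
    and rel: "\<And>x. (\<Sum>j<d. x j *\<^sub>R X j) = 0 \<Longrightarrow> (\<Sum>j<d. x j * a j) = 0"
  shows "\<exists>\<mu> :: 'v \<Rightarrow>\<^sub>L real. \<forall>j<d. blinfun_apply \<mu> (X j) = a j"
proof -
  have "\<exists>x. v = (\<Sum>j<d. x j *\<^sub>R X j)" for v
    using sp span_image_eq_range_sum[of "{..<d}" X] by auto
  then obtain r where r: "\<And>v. v = (\<Sum>j<d. r v j *\<^sub>R X j)" by metis
  define f where "f v = (\<Sum>j<d. r v j * a j)" for v
  have f: "f v = (\<Sum>j<d. x j * a j)" if "v = (\<Sum>j<d. x j *\<^sub>R X j)" for v x
  proof -
    have "(\<Sum>j<d. (r v j - x j) *\<^sub>R X j) = 0"
      using r[of v] that by (simp add: scaleR_diff_left sum_subtractf)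
    from rel[OF this] show ?thesis
      unfolding f_def by (simp add: left_diff_distrib sum_subtractf)
  qed
  have "linear f"
  proof (rule linearI)
    fix v w c
    have "v + w = (\<Sum>j<d. (r v j + r w j) *\<^sub>R X j)"
      using r[of v] r[of w] by (simp add: scaleR_add_left sum.distrib)
    from f[OF this] show "f (v + w) = f v + f w"
      unfolding f_def by (simp add: distrib_right sum.distrib)
    have "c *\<^sub>R v = c *\<^sub>R (\<Sum>j<d. r v j *\<^sub>R X j)"
      using r[of v] by simp
    then have "c *\<^sub>R v = (\<Sum>j<d. (c * r v j) *\<^sub>R X j)"
      by (simp add: scaleR_sum_right)
    from f[OF this] show "f (c *\<^sub>R v) = c *\<^sub>R f v"
      unfolding f_def by (simp add: sum_distrib_left mult.assoc)
  qed
  then have bl: "bounded_linear f"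
    using finite_dim_linear_imp_bounded_linear fin by blast
  have "f (X j) = a j" if "j < d" for j
    using f[of "X j" "\<lambda>i. if i = j then 1 else 0"] that
    by (simp add: if_distrib[of "\<lambda>c. c *\<^sub>R _"] if_distrib[of "\<lambda>c. c * _"] cong: if_cong)
  with bl show ?thesis by (intro exI[where x = "Blinfun f"]) (simp add: bounded_linear_Blinfun_apply)
qed

lemma blinfun_eq_on_span:
  fixes \<mu> \<nu> :: "'v::real_normed_vector \<Rightarrow>\<^sub>L real"
  assumes "span S = UNIV" "\<And>v. v \<in> S \<Longrightarrow> blinfun_apply \<mu> v = blinfun_apply \<nu> v"
  shows "\<mu> = \<nu>"
proof (rule blinfun_eqI)
  fix v
  have "v \<in> span S" using assms by simp
  then show "blinfun_apply \<mu> v = blinfun_apply \<nu> v"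
    by (induction rule: span_induct_alt)
      (auto simp: blinfun.add_right blinfun.scaleR_right assms(2))
qed

lemma blinfun_zero_on_span:
  fixes \<mu> :: "'v::real_normed_vector \<Rightarrow>\<^sub>L real"
  assumes "v \<in> span S" "\<And>v. v \<in> S \<Longrightarrow> blinfun_apply \<mu> v = 0"
  shows "blinfun_apply \<mu> v = 0"
  using assms(1)
  by (induction rule: span_induct_alt) (auto simp: blinfun.add_right blinfun.scaleR_right assms(2))

lemma indep_card_le_dim:
  fixes X :: "nat \<Rightarrow> 'v::real_vector"
  assumes fin: "\<exists>B. finite B \<and> span B = (UNIV :: 'v set)"
    and J: "indep_mod X {} J" "finite J"
  shows "card J \<le> dim (UNIV :: 'v set)"
proof -
  have inj: "inj_on X J"
  proof (rule inj_onI, rule ccontr)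
    fix i j assume ij: "i \<in> J" "j \<in> J" "X i = X j" "i \<noteq> j"
    let ?a = "\<lambda>k. (if k = i then 1 else 0 :: real) - (if k = j then 1 else 0)"
    have "(\<Sum>k\<in>J. ?a k *\<^sub>R X k) = 0"
      using ij J(2)
      by (simp add: scaleR_diff_left sum_subtractf if_distrib[of "\<lambda>c. c *\<^sub>R _"] cong: if_cong)
    then have "?a i = 0" using indep_modD[OF J(1), of ?a i] ij by simp
    with ij show False by simp
  qed
  have ind: "independent (X ` J)"
  proof (rule independent_if_scalars_zero)
    fix f v assume f: "(\<Sum>v\<in>X ` J. f v *\<^sub>R v) = 0" and v: "v \<in> X ` J"
    have "(\<Sum>j\<in>J. f (X j) *\<^sub>R X j) = 0"
      using f by (simp add: sum.reindex[OF inj])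
    then show "f v = 0" using indep_modD[OF J(1), of "\<lambda>j. f (X j)"] v by auto
  qed (use J in simp)
  obtain S where S: "finite S" "span S = (UNIV :: 'v set)" using fin by blast
  obtain B :: "'v set"
    where "B \<subseteq> UNIV" and B: "independent B" "UNIV \<subseteq> span B" "card B = dim (UNIV :: 'v set)"
    by (rule basis_exists)
  have "finite B" using independent_span_bound[OF S(1) B(1)] S(2) by simp
  from independent_span_bound[OF this ind] B
  have "card (X ` J) \<le> dim (UNIV :: 'v set)" by auto
  then show ?thesis by (simp add: card_image[OF inj])
qed

lemma dim_le_card_spanning:
  fixes X :: "nat \<Rightarrow> 'v::real_vector"
  assumes "finite J" "span (X ` J) = UNIV"
  shows "dim (UNIV :: 'v set) \<le> card J"
proof -
  have "dim (UNIV :: 'v set) \<le> card (X ` J)"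
    using assms by (intro dim_le_card) auto
  also have "\<dots> \<le> card J" by (rule card_image_le) fact
  finally show ?thesis .
qed

lemma adapted_spans:
  fixes X :: "nat \<Rightarrow> 'v::real_vector"
  assumes "adapted d X K B g" "span (X ` {..<d}) = UNIV"
  shows "span (X ` (K \<union> B)) = UNIV"
proof -
  have "X j \<in> span (X ` (K \<union> B))" if "j < d" for j
  proof -
    have "X j - (\<Sum>b\<in>B. g j b *\<^sub>R X b) \<in> span (X ` (K \<union> B))"
      using assms(1) that span_mono[of "X ` K" "X ` (K \<union> B)"] unfolding adapted_def by blast
    moreover have "(\<Sum>b\<in>B. g j b *\<^sub>R X b) \<in> span (X ` (K \<union> B))"
      by (intro span_sum span_scale span_base) auto
    ultimately show ?thesis using span_add by fastforce
  qed
  then have "span (X ` {..<d}) \<subseteq> span (X ` (K \<union> B))"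
    by (intro span_minimal) auto
  with assms(2) show ?thesis by blast
qed

lemma adapted_card_ge:
  fixes X :: "nat \<Rightarrow> 'v::real_vector"
  assumes "adapted d X K B g" "span (X ` {..<d}) = UNIV" "K \<subseteq> {..<d}"
  shows "dim (UNIV :: 'v set) \<le> card K + card B"
proof -
  have "finite (K \<union> B)"
    using adapted_finite[OF assms(1)] finite_subset[OF assms(3)] by simp
  from dim_le_card_spanning[OF this adapted_spans[OF assms(1,2)]]
  show ?thesis using card_Un_le[of K B] by linarith
qed

text \<open>Once \<open>card B\<close> is known to be the dimension of the face, this turns
  nonsingularity into linear independence of its normals. Equality of the numbers makes the spanning
  family over \<open>K \<union> B\<close> minimal: a dependent normal in \<open>K\<close> could be
  dropped and leave too few spanning vectors.\<close>

lemma adapted_card_eq_iff: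
  fixes X :: "nat \<Rightarrow> 'v::real_vector"
  assumes ad: "adapted d X K B g" and sp: "span (X ` {..<d}) = UNIV" and K: "K \<subseteq> {..<d}"
    and fin: "\<exists>B. finite B \<and> span B = (UNIV :: 'v set)"
  shows "card K + card B = dim (UNIV :: 'v set) \<longleftrightarrow> indep_mod X {} K"
proof
  have finK: "finite K" using K finite_subset by blast
  have finB: "finite B" using adapted_finite[OF ad] .
  have disj: "K \<inter> B = {}" using ad unfolding adapted_def by blast
  {
    assume eq: "card K + card B = dim (UNIV :: 'v set)"
    show "indep_mod X {} K"
      unfolding indep_mod_def
    proof (intro allI impI ballI, rule ccontr)
      fix a k assume a: "(\<Sum>b\<in>K. a b *\<^sub>R X b) \<in> span (X ` {})" and k: "k \<in> K" "a k \<noteq> 0"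
      have "a k *\<^sub>R X k + (\<Sum>b\<in>K - {k}. a b *\<^sub>R X b) = 0"
        using a k finK by (simp add: sum.remove)
      then have "a k *\<^sub>R X k = - (\<Sum>b\<in>K - {k}. a b *\<^sub>R X b)"
        by (simp add: eq_neg_iff_add_eq_0)
      then have "(1 / a k) *\<^sub>R (a k *\<^sub>R X k) \<in> span (X ` (K - {k}))"
        by (auto intro!: span_scale span_neg span_sum intro: span_base)
      then have Xk: "X k \<in> span (X ` (K - {k}))" using k by simp
      have "X ` (K \<union> B) \<subseteq> span (X ` ((K \<union> B) - {k}))"
      proof clarify
        fix j assume j: "j \<in> K \<union> B"
        show "X j \<in> span (X ` ((K \<union> B) - {k}))"
        proof (cases "j = k")
          case True
          have "X ` (K - {k}) \<subseteq> X ` ((K \<union> B) - {k})" by blast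
          from span_mono[OF this] Xk True show ?thesis by blast
        next
          case False
          with j show ?thesis by (intro span_base) blast
        qed
      qed
      then have "span (X ` (K \<union> B)) \<subseteq> span (X ` ((K \<union> B) - {k}))"
        by (intro span_minimal) auto
      then have "span (X ` ((K \<union> B) - {k})) = UNIV"
        using adapted_spans[OF ad sp] by blast
      then have "dim (UNIV :: 'v set) \<le> card ((K \<union> B) - {k})"
        using finK finB by (intro dim_le_card_spanning) auto
      also have "\<dots> < card (K \<union> B)"
        using finK finB k by (intro psubset_card_mono) auto
      also have "\<dots> = card K + card B"
        using finK finB disj by (simp add: card_Un_disjoint)
      finally show False using eq by simp
    qed
  next
    assume ind: "indep_mod X {} K"
    have "indep_mod X {} (K \<union> B)"
      unfolding indep_mod_def
    proof (intro allI impI ballI)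
      fix a j assume a: "(\<Sum>b\<in>K \<union> B. a b *\<^sub>R X b) \<in> span (X ` {})" and j: "j \<in> K \<union> B"
      have split: "(\<Sum>b\<in>K. a b *\<^sub>R X b) + (\<Sum>b\<in>B. a b *\<^sub>R X b) = 0"
        using a finK finB disj by (simp add: sum.union_disjoint)
      then have "(\<Sum>b\<in>B. a b *\<^sub>R X b) = - (\<Sum>b\<in>K. a b *\<^sub>R X b)"
        by (metis add.commute eq_neg_iff_add_eq_0)
      also have "\<dots> \<in> span (X ` K)"
        by (auto intro!: span_scale span_neg span_sum intro: span_base)
      finally have B0: "\<And>b. b \<in> B \<Longrightarrow> a b = 0"
        using ad indep_modD[of X K B a] unfolding adapted_def by blast
      then have "(\<Sum>b\<in>K. a b *\<^sub>R X b) = 0" using split by simp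
      then have "\<And>b. b \<in> K \<Longrightarrow> a b = 0"
        using indep_modD[OF ind, of a] by simp
      with B0 j show "a j = 0" by blast
    qed
    from indep_card_le_dim[OF fin this] finK finB
    have "card (K \<union> B) \<le> dim (UNIV :: 'v set)" by simp
    then show "card K + card B = dim (UNIV :: 'v set)"
      using adapted_card_ge[OF ad sp K] finK finB disj by (simp add: card_Un_disjoint)
  }
qed


section \<open>Faces of the polytope\<close>

lemma perturb_positive:
  fixes u v :: "'i \<Rightarrow> real"
  assumes "finite J" "\<And>j. j \<in> J \<Longrightarrow> u j > 0"
  obtains \<epsilon> where "\<epsilon> > 0" "\<And>j. j \<in> J \<Longrightarrow> u j + \<epsilon> * v j > 0"
proof -
  have "\<forall>\<^sub>F e in at_right 0. \<forall>j\<in>J. u j + e * v j > 0"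
  proof (rule eventually_ball_finite[OF assms(1)], rule ballI)
    fix j assume "j \<in> J"
    have "((\<lambda>e. u j + e * v j) \<longlongrightarrow> u j + 0 * v j) (at_right 0)"
      by (intro tendsto_intros)
    from order_tendstoD(1)[OF this, of 0] assms(2)[OF \<open>j \<in> J\<close>]
    show "\<forall>\<^sub>F e in at_right 0. u j + e * v j > 0" by simp
  qed
  moreover have "\<forall>\<^sub>F e in at_right (0::real). e > 0" by (simp add: eventually_at_right_less)
  ultimately have "\<forall>\<^sub>F e in at_right 0. e > 0 \<and> (\<forall>j\<in>J. u j + e * v j > 0)"
    by (rule eventually_conj[rotated])
  from eventually_happens'[OF trivial_limit_at_right_real this]
  obtain e where "e > 0 \<and> (\<forall>j\<in>J. u j + e * v j > 0)" ..
  then show ?thesis by (intro that[of e]) auto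
qed

lemma mem_open_face:
  "\<mu> \<in> open_face_of_index d X lam I \<longleftrightarrow>
     (\<forall>j<d. lam j \<le> blinfun_apply \<mu> (X j)) \<and> (\<forall>j<d. blinfun_apply \<mu> (X j) = lam j \<longleftrightarrow> j \<in> I)"
  unfolding open_face_of_index_def half_space_intersection_def by simp

text \<open>The directions of the face are the functionals vanishing on the normals in
  \<open>K\<close>, and the basis dual to \<open>B\<close> spans them. Each dual vector really
  occurs as a direction, because a small move along it preserves the finitely many strict
  inequalities.\<close>

lemma affine_dim_open_face:
  fixes X :: "nat \<Rightarrow> 'v::real_normed_vector"
  assumes ad: "adapted d X K B g" and sp: "span (X ` {..<d}) = UNIV" and K: "K \<subseteq> {..<d}"
    and fin: "\<exists>B. finite B \<and> span B = (UNIV :: 'v set)"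
    and ne: "open_face_of_index d X lam K \<noteq> {}"
  shows "affine_dim (open_face_of_index d X lam K) = card B"
proof -
  let ?F = "open_face_of_index d X lam K"
  let ?D = "{x - y | x y. x \<in> ?F \<and> y \<in> ?F}"
  have finB: "finite B" using adapted_finite[OF ad] .
  have Bd: "b < d" if "b \<in> B" for b using ad that unfolding adapted_def by blast
  \<comment> \<open>The dual basis vector for \<open>b\<close> is the functional whose values on the
    normals are the \<open>b\<close>-th column of \<open>g\<close>.\<close>
  have "\<exists>\<nu> :: 'v \<Rightarrow>\<^sub>L real. \<forall>j<d. blinfun_apply \<nu> (X j) = g j b" if bB: "b \<in> B" for b
  proof -
    have rel: "(\<Sum>j<d. x j * g j b) = 0" if "(\<Sum>j<d. x j *\<^sub>R X j) = 0" for x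
      using that by (intro adapted_relation[OF ad _ bB]) (simp add: span_zero)
    then show ?thesis by (rule functional_with_values[OF fin sp])
  qed
  then obtain \<nu> :: "nat \<Rightarrow> 'v \<Rightarrow>\<^sub>L real"
    where \<nu>: "\<And>b j. b \<in> B \<Longrightarrow> j < d \<Longrightarrow> blinfun_apply (\<nu> b) (X j) = g j b" by metis
  have \<nu>B: "blinfun_apply (\<nu> b) (X c) = (if b = c then 1 else 0)" if "b \<in> B" "c \<in> B" for b c
    using \<nu>[OF that(1) Bd[OF that(2)]] adapted_coeff_basis[OF ad that(2,1)] by simp
  have inj: "inj_on \<nu> B"
  proof (rule inj_onI)
    fix b c assume bc: "b \<in> B" "c \<in> B" "\<nu> b = \<nu> c"
    have "blinfun_apply (\<nu> c) (X b) = 1" using \<nu>B[OF bc(1,1)] bc(3) by simp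
    then have "(if c = b then 1 else 0 :: real) = 1" using \<nu>B[OF bc(2,1)] by simp
    then show "b = c" by (simp split: if_splits)
  qed
  have "independent (\<nu> ` B)"
  proof (rule independent_if_scalars_zero)
    fix f x assume f: "(\<Sum>x\<in>\<nu> ` B. f x *\<^sub>R x) = 0" and "x \<in> \<nu> ` B"
    then obtain c where c: "c \<in> B" "x = \<nu> c" by blast
    have "(\<Sum>b\<in>B. f (\<nu> b) *\<^sub>R \<nu> b) = 0" using f by (simp add: sum.reindex[OF inj])
    then have "blinfun_apply (\<Sum>b\<in>B. f (\<nu> b) *\<^sub>R \<nu> b) (X c) = 0" by simp
    then have "(\<Sum>b\<in>B. f (\<nu> b) * (if b = c then 1 else 0)) = 0"
      using c(1) by (simp add: blinfun.sum_left blinfun.scaleR_left \<nu>B cong: sum.cong)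
    then show "f x = 0" using c finB by (simp add: if_distrib cong: if_cong)
  qed (use finB in simp)
  moreover have "span (\<nu> ` B) = span ?D"
  proof (rule subset_antisym)
    show "span (\<nu> ` B) \<subseteq> span ?D"
    proof (intro span_minimal subspace_span image_subsetI)
      fix b assume b: "b \<in> B"
      obtain \<mu> where \<mu>: "\<mu> \<in> ?F" using ne by blast
      have pos: "blinfun_apply \<mu> (X j) - lam j > 0" if "j \<in> {..<d} - K" for j
        using \<mu> that unfolding mem_open_face by (metis DiffD1 DiffD2 diff_gt_0_iff_gt lessThan_iff order_less_le)
      obtain e where e: "e > 0"
        "\<And>j. j \<in> {..<d} - K \<Longrightarrow> blinfun_apply \<mu> (X j) - lam j + e * g j b > 0"
        using perturb_positive[of "{..<d} - K" "\<lambda>j. blinfun_apply \<mu> (X j) - lam j" "\<lambda>j. g j b"] pos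
        by blast
      have val: "blinfun_apply (\<mu> + e *\<^sub>R \<nu> b) (X j) = blinfun_apply \<mu> (X j) + e * g j b"
        if "j < d" for j
        using \<nu>[OF b that] by (simp add: blinfun.add_left blinfun.scaleR_left)
      have "\<mu> + e *\<^sub>R \<nu> b \<in> ?F"
        unfolding mem_open_face
      proof (intro conjI allI impI)
        fix j assume j: "j < d"
        show "blinfun_apply (\<mu> + e *\<^sub>R \<nu> b) (X j) = lam j \<longleftrightarrow> j \<in> K"
          using e(2)[of j] adapted_coeff_zero[OF ad j _ b] \<mu> j
          unfolding val[OF j] mem_open_face by force
        show "lam j \<le> blinfun_apply (\<mu> + e *\<^sub>R \<nu> b) (X j)"
          using e(2)[of j] adapted_coeff_zero[OF ad j _ b] \<mu> j
          unfolding val[OF j] mem_open_face by force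
      qed
      then have "e *\<^sub>R \<nu> b \<in> span ?D"
        using \<mu> by (intro span_base) (force intro: exI[where x = "\<mu> + e *\<^sub>R \<nu> b"])
      from span_scale[OF this, of "1 / e"] e(1) show "\<nu> b \<in> span ?D" by simp
    qed
    show "span ?D \<subseteq> span (\<nu> ` B)"
    proof (intro span_minimal subspace_span subsetI)
      fix \<delta> assume "\<delta> \<in> ?D"
      then obtain x y where xy: "x \<in> ?F" "y \<in> ?F" "\<delta> = x - y" by blast
      have zK: "blinfun_apply \<delta> (X k) = 0" if "k \<in> K" for k
      proof -
        have "k < d" using that K by blast
        then have "blinfun_apply x (X k) = lam k" "blinfun_apply y (X k) = lam k"
          using xy that unfolding mem_open_face by auto
        then show ?thesis using xy(3) by (simp add: blinfun.diff_left)
      qed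
      have "\<delta> = (\<Sum>b\<in>B. blinfun_apply \<delta> (X b) *\<^sub>R \<nu> b)"
      proof (rule blinfun_eq_on_span[OF sp], clarify)
        fix j assume j: "j < d"
        have "X j - (\<Sum>b\<in>B. g j b *\<^sub>R X b) \<in> span (X ` K)"
          using ad j unfolding adapted_def by blast
        then have "blinfun_apply \<delta> (X j - (\<Sum>b\<in>B. g j b *\<^sub>R X b)) = 0"
          by (rule blinfun_zero_on_span) (use zK in auto)
        then show "blinfun_apply \<delta> (X j) = blinfun_apply (\<Sum>b\<in>B. blinfun_apply \<delta> (X b) *\<^sub>R \<nu> b) (X j)"
          using \<nu>[OF _ j]
          by (simp add: blinfun.diff_right blinfun.sum_right blinfun.sum_left blinfun.scaleR_left
              blinfun.scaleR_right mult.commute cong: sum.cong)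
      qed
      moreover have "(\<Sum>b\<in>B. blinfun_apply \<delta> (X b) *\<^sub>R \<nu> b) \<in> span (\<nu> ` B)"
        by (intro span_sum span_scale span_base imageI)
      ultimately show "\<delta> \<in> span (\<nu> ` B)" by metis
    qed
  qed
  ultimately have "dim ?D = card (\<nu> ` B)" by (intro dim_eq_card)
  then show ?thesis unfolding affine_dim_def by (simp add: card_image[OF inj])
qed

lemma face_card_dim:
  fixes X :: "nat \<Rightarrow> 'v::real_normed_vector"
  assumes sp: "span (X ` {..<d}) = UNIV" and K: "K \<subseteq> {..<d}"
    and fin: "\<exists>B. finite B \<and> span B = (UNIV :: 'v set)"
    and ne: "open_face_of_index d X lam K \<noteq> {}"
  shows "open_face_of_index d X lam K \<in> nonsingular_faces (dim (UNIV :: 'v set)) d X lam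
      \<longleftrightarrow> indep_mod X {} K"
    and "open_face_of_index d X lam K \<in> singular_faces (dim (UNIV :: 'v set)) d X lam
      \<longleftrightarrow> \<not> indep_mod X {} K"
proof -
  obtain B g where ad: "adapted d X K B g"
    using adapted_exists[OF _ indep_mod_empty, of d X K] by blast
  have F: "open_face_of_index d X lam K \<in> open_faces d X lam"
    unfolding open_faces_def using K ne by blast
  note eq = face_index_open_face_of_index[OF K ne] affine_dim_open_face[OF ad sp K fin ne]
  show "open_face_of_index d X lam K \<in> nonsingular_faces (dim (UNIV :: 'v set)) d X lam
      \<longleftrightarrow> indep_mod X {} K"
    unfolding nonsingular_faces_def using F adapted_card_eq_iff[OF ad sp K fin] by (simp add: eq)
  show "open_face_of_index d X lam K \<in> singular_faces (dim (UNIV :: 'v set)) d X lam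
      \<longleftrightarrow> \<not> indep_mod X {} K"
    unfolding singular_faces_def
    using F adapted_card_eq_iff[OF ad sp K fin] adapted_card_ge[OF ad sp K] by (auto simp: eq)
qed

lemma open_faceE:
  assumes "F \<in> open_faces d X lam"
  obtains K where "K \<subseteq> {..<d}" "F = open_face_of_index d X lam K"
    "open_face_of_index d X lam K \<noteq> {}"
  using assms unfolding open_faces_def by blast

text \<open>Otherwise some nonzero functional kills every normal, and the polytope contains a whole
  line in that direction, although it is bounded.\<close>

lemma polytope_normals_span:
  fixes X :: "nat \<Rightarrow> 'v::real_normed_vector"
  assumes fin: "\<exists>B. finite B \<and> span B = (UNIV :: 'v set)"
    and P: "polytope_with_normals n d X lam \<Delta>"
  shows "span (X ` {..<d}) = UNIV"
proof (rule ccontr)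
  assume "span (X ` {..<d}) \<noteq> UNIV"
  then obtain v where v: "v \<notin> span (X ` {..<d})" by blast
  obtain B where B: "B \<subseteq> X ` {..<d}" "independent B" "X ` {..<d} \<subseteq> span B"
    by (rule maximal_independent_subset)
  have "v \<notin> span B" using v B(1) span_mono by blast
  then have "independent (insert v B)" using B(2) by (simp add: independent_insert)
  from linear_independent_extend[OF this, of "\<lambda>x. if x = v then 1 else (0::real)"]
  obtain f :: "'v \<Rightarrow> real" where f: "linear f" "\<And>x. x \<in> insert v B \<Longrightarrow> f x = (if x = v then 1 else 0)"
    by blast
  have bl: "bounded_linear f" using finite_dim_linear_imp_bounded_linear[OF f(1) fin] .
  define \<nu> where "\<nu> = Blinfun f"
  have \<nu>: "blinfun_apply \<nu> = f" unfolding \<nu>_def using bl by (rule bounded_linear_Blinfun_apply)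
  have "f x = 0" if "x \<in> B" for x
    using f(2)[of x] that \<open>v \<notin> span B\<close> span_base by force
  then have \<nu>0: "blinfun_apply \<nu> (X j) = 0" if "j < d" for j
    using blinfun_zero_on_span[of "X j" B \<nu>] B(3) that \<nu> by auto
  have "\<nu> \<noteq> 0" using f(2)[of v] \<nu> by (metis insertI1 zero_blinfun.rep_eq zero_neq_one)
  have D: "\<Delta> = half_space_intersection d X lam" "polytope \<Delta>" "\<Delta> \<noteq> {}"
    using P unfolding polytope_with_normals_def by auto
  then obtain \<mu> where \<mu>: "\<mu> \<in> \<Delta>" by blast
  have "bounded \<Delta>"
    using D(2) unfolding polytope_def by (auto intro: bounded_convex_hull finite_imp_bounded)
  then obtain M where M: "\<And>x. x \<in> \<Delta> \<Longrightarrow> norm x \<le> M" using bounded_iff by blast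
  \<comment> \<open>Chosen so that the displacement has norm
    \<open>\<bar>M + norm \<mu> + 1\<bar>\<close>, one more than two points of norm at most
    \<open>M\<close> and \<open>norm \<mu>\<close> allow.\<close>
  define t where "t = (M + norm \<mu> + 1) / norm \<nu>"
  have "\<mu> + t *\<^sub>R \<nu> \<in> \<Delta>"
    using \<mu> \<nu>0 unfolding D(1) half_space_intersection_def
    by (simp add: blinfun.add_left blinfun.scaleR_left)
  then have "norm (t *\<^sub>R \<nu>) \<le> M + norm \<mu>"
    using M[of "\<mu> + t *\<^sub>R \<nu>"] norm_triangle_ineq4[of "\<mu> + t *\<^sub>R \<nu>" \<mu>] by simp
  moreover have "norm (t *\<^sub>R \<nu>) = \<bar>M + norm \<mu> + 1\<bar>"
    unfolding t_def using \<open>\<nu> \<noteq> 0\<close> by simp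
  ultimately show False by linarith
qed

text \<open>An inequality that is an equality on all of the polytope would make its facet have
  dimension \<open>n\<close> instead of \<open>n - 1\<close>. So each inequality is strict
  somewhere, and the average of such points is strict in all of them.\<close>

lemma polytope_interior_face:
  fixes X :: "nat \<Rightarrow> 'v::real_normed_vector"
  assumes P: "polytope_with_normals n d X lam \<Delta>"
  shows "open_face_of_index d X lam {} \<noteq> {}"
proof -
  have D: "\<Delta> = half_space_intersection d X lam" "\<Delta> \<noteq> {}" "affine_dim \<Delta> = n"
    using P unfolding polytope_with_normals_def by auto
  have D': "\<mu> \<in> \<Delta> \<longleftrightarrow> (\<forall>j<d. lam j \<le> blinfun_apply \<mu> (X j))" for \<mu>
    unfolding D(1) half_space_intersection_def by simp
  have "\<exists>\<mu>\<in>\<Delta>. lam j < blinfun_apply \<mu> (X j)" if j: "j < d" for j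
  proof (rule ccontr)
    assume "\<not> ?thesis"
    then have "{\<mu> \<in> \<Delta>. blinfun_apply \<mu> (X j) = lam j} = \<Delta>"
      using j D' by (force simp: not_less intro: antisym)
    moreover have "affine_dim {\<mu> \<in> \<Delta>. blinfun_apply \<mu> (X j) = lam j} + 1 = n"
      using P j unfolding polytope_with_normals_def bij_betw_def by blast
    ultimately show False using D(3) by simp
  qed
  then obtain m where m: "\<And>j. j < d \<Longrightarrow> m j \<in> \<Delta>" "\<And>j. j < d \<Longrightarrow> lam j < blinfun_apply (m j) (X j)"
    by metis
  show ?thesis
  proof (cases "d = 0")
    case True
    then show ?thesis using D unfolding open_face_of_index_def by auto
  next
    case False
    \<comment> \<open>The case \<open>d = 0\<close> had to be separated because of this
      division.\<close>
    define \<mu> where "\<mu> = (1 / real d) *\<^sub>R (\<Sum>i<d. m i)"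
    have "lam j < blinfun_apply \<mu> (X j)" if j: "j < d" for j
    proof -
      have "(\<Sum>i<d. lam j) < (\<Sum>i<d. blinfun_apply (m i) (X j))"
        by (rule sum_strict_mono_ex1) (use j m D' in auto)
      then have "real d * lam j < blinfun_apply (\<Sum>i<d. m i) (X j)"
        by (simp add: blinfun.sum_left)
      then show ?thesis
        unfolding \<mu>_def using False by (simp add: blinfun.scaleR_left field_simps)
    qed
    then have "\<mu> \<in> open_face_of_index d X lam {}"
      unfolding mem_open_face by (metis empty_iff less_imp_le less_irrefl)
    then show ?thesis by blast
  qed
qed

section \<open>The orbit space\<close>

text \<open>The action of \<open>exp x\<close> written on a representative in \<open>R^d\<close>; it
  replaces the cosets of the torus from here on.\<close>

definition rot :: "(nat \<Rightarrow> real) \<Rightarrow> (nat \<Rightarrow> complex) \<Rightarrow> nat \<Rightarrow> complex" where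
  "rot x z = (\<lambda>j. cis (2 * pi * x j) * z j)"

lemma image_eq_singleton: "x \<in> T \<Longrightarrow> (\<And>y. y \<in> T \<Longrightarrow> f y = c) \<Longrightarrow> f ` T = {c}"
  by auto

lemma rot_zero [simp]: "rot (\<lambda>_. 0) z = z"
  by (simp add: rot_def)

lemma rot_rot: "rot x (rot y z) = rot (\<lambda>j. x j + y j) z"
  by (simp add: rot_def cis_mult[symmetric] distrib_left mult.assoc)

lemma cmod_rot [simp]: "cmod (rot x z j) = cmod (z j)"
  by (simp add: rot_def norm_mult)

lemma rot_eq_0_iff [simp]: "rot x z j = 0 \<longleftrightarrow> z j = 0"
  by (simp add: rot_def)

lemma continuous_on_rot: "continuous_on S (rot x)"
proof (rule continuous_on_coordinatewise_then_product)
  fix j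
  have "continuous_on S (\<lambda>z :: nat \<Rightarrow> complex. z j)"
    by (rule continuous_on_subset[OF continuous_on_product_coordinates]) simp
  then show "continuous_on S (\<lambda>z. rot x z j)"
    unfolding rot_def by (intro continuous_intros)
qed

lemma cis_2pi_eq_iff: "cis (2 * pi * x) = cis (2 * pi * y) \<longleftrightarrow> x - y \<in> \<int>"
proof -
  have "cis (2 * pi * x) = cis (2 * pi * y) \<longleftrightarrow> cis (2 * pi * (x - y)) = 1"
    by (simp add: right_diff_distrib cis_divide[symmetric])
  also have "\<dots> \<longleftrightarrow> x - y \<in> \<int>"
    unfolding cis_conv_exp exp_eq_1 by (auto elim!: Ints_cases)
  finally show ?thesis .
qed

locale polytope_data =
  fixes d :: nat and X :: "nat \<Rightarrow> 'v::real_normed_vector" and lam :: "nat \<Rightarrow> real" and Q :: "'v set"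
  assumes fin: "\<exists>B. finite B \<and> span B = (UNIV :: 'v set)"
    and sp: "span (X ` {..<d}) = UNIV"
    and quasilattice_Q: "quasilattice Q"
    and XQ: "\<And>j. j < d \<Longrightarrow> X j \<in> Q"
    and interior_face: "open_face_of_index d X lam {} \<noteq> {}"
begin

section \<open>The quasilattice, the group \<open>N\<close> and its orbits\<close>

lemma Q_zero: "0 \<in> Q"
  using quasilattice_Q unfolding quasilattice_def
  by (auto intro!: exI[where x = "\<lambda>_. 0"])

lemma Q_add: "v \<in> Q \<Longrightarrow> w \<in> Q \<Longrightarrow> v + w \<in> Q"
proof -
  assume vw: "v \<in> Q" "w \<in> Q"
  obtain S where Q: "Q = {(\<Sum>v\<in>S. of_int (c v) *\<^sub>R v) | c. True}"
    using quasilattice_Q unfolding quasilattice_def by blast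
  obtain a b where "v = (\<Sum>v\<in>S. of_int (a v) *\<^sub>R v)" "w = (\<Sum>v\<in>S. of_int (b v) *\<^sub>R v)"
    using vw unfolding Q by blast
  then have "v + w = (\<Sum>v\<in>S. of_int (a v + b v) *\<^sub>R v)"
    by (simp add: scaleR_add_left sum.distrib)
  then have "\<exists>c. v + w = (\<Sum>v\<in>S. of_int (c v) *\<^sub>R v)"
    by (rule exI[where x = "\<lambda>v. a v + b v"])
  then show "v + w \<in> Q" unfolding Q by simp
qed

lemma Q_minus: "v \<in> Q \<Longrightarrow> - v \<in> Q"
proof -
  assume v: "v \<in> Q"
  obtain S where Q: "Q = {(\<Sum>v\<in>S. of_int (c v) *\<^sub>R v) | c. True}"
    using quasilattice_Q unfolding quasilattice_def by blast
  obtain a where "v = (\<Sum>v\<in>S. of_int (a v) *\<^sub>R v)"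
    using v unfolding Q by blast
  then have "- v = (\<Sum>v\<in>S. of_int (- a v) *\<^sub>R v)"
    by (simp add: sum_negf)
  then have "\<exists>c. - v = (\<Sum>v\<in>S. of_int (c v) *\<^sub>R v)"
    by (rule exI[where x = "\<lambda>v. - a v"])
  then show "- v \<in> Q" unfolding Q by simp
qed

lemma Q_of_int: "v \<in> Q \<Longrightarrow> of_int k *\<^sub>R v \<in> Q"
proof -
  assume v: "v \<in> Q"
  have "of_nat m *\<^sub>R v \<in> Q" for m
    by (induction m) (auto simp: Q_zero scaleR_add_left intro: Q_add v)
  from this[of "nat k"] this[of "nat (- k)"] show "of_int k *\<^sub>R v \<in> Q"
    by (cases "k \<ge> 0") (auto dest: Q_minus)
qed

text \<open>The preimage of \<open>N\<close> under the quotient map from \<open>R^d\<close> to the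
  torus.\<close>

definition H :: "rvec set" where
  "H = {x \<in> Rspace d. proj d X x \<in> Q}"

lemma Rspace_iff: "x \<in> Rspace k \<longleftrightarrow> (\<forall>i\<ge>k. x i = 0)"
  by (simp add: topspace_Euclidean_space)

lemma torus_act_torus_exp:
  assumes "x \<in> Rspace d"
  shows "torus_act (torus_exp d x) z = rot x z"
proof -
  have e: "exp (2 * complex_of_real pi * \<i> * complex_of_real t) = cis (2 * pi * t)" for t
    unfolding cis_conv_exp by (simp add: mult_ac)
  have "(\<lambda>j. exp (2 * complex_of_real pi * \<i> * complex_of_real (y j)) * z j) = rot x z"
    if "y \<in> torus_exp d x" for y
    using that cis_2pi_eq_iff unfolding rot_def e torus_exp_def by fastforce
  moreover have "x \<in> torus_exp d x" using assms unfolding torus_exp_def by simp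
  ultimately have "(\<lambda>x j. exp (2 * of_real pi * \<i> * of_real (x j)) * z j) ` torus_exp d x = {rot x z}"
    by (intro image_eq_singleton)
  then show ?thesis unfolding torus_act_def by simp
qed

lemma lattice_coset_eq_iff: "lattice_coset Q v = lattice_coset Q w \<longleftrightarrow> v - w \<in> Q"
proof
  assume "lattice_coset Q v = lattice_coset Q w"
  moreover have "v \<in> lattice_coset Q v" unfolding lattice_coset_def using Q_zero by force
  ultimately show "v - w \<in> Q" unfolding lattice_coset_def by auto
next
  have *: "lattice_coset Q v \<subseteq> lattice_coset Q w" if "v - w \<in> Q" for v w
    unfolding lattice_coset_def
  proof clarify
    fix q assume "q \<in> Q"
    then have "(v - w) + q \<in> Q" using that Q_add by blast
    then show "v + q \<in> (+) w ` Q" by (intro image_eqI[where x = "(v - w) + q"]) auto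
  qed
  assume "v - w \<in> Q"
  with *[of v w] *[of w v] Q_minus[of "v - w"] show "lattice_coset Q v = lattice_coset Q w" by auto
qed

lemma torus_hom_torus_exp:
  assumes "x \<in> Rspace d"
  shows "torus_hom d X Q (torus_exp d x) = lattice_coset Q (proj d X x)"
proof -
  have "lattice_coset Q (proj d X y) = lattice_coset Q (proj d X x)" if "y \<in> torus_exp d x" for y
  proof -
    have e1: "proj d X y - proj d X x = (\<Sum>j<d. (y j - x j) *\<^sub>R X j)"
      unfolding proj_def by (simp add: scaleR_diff_left sum_subtractf)
    have e2: "(y j - x j) *\<^sub>R X j \<in> Q" if "j < d" for j
    proof -
      have "y j - x j \<in> \<int>" using \<open>y \<in> torus_exp d x\<close> unfolding torus_exp_def by blast
      then obtain k where "y j - x j = of_int k" by (elim Ints_cases)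
      then show ?thesis using Q_of_int[OF XQ[OF that], of k] by simp
    qed
    have sumQ: "(\<Sum>j\<in>J. f j) \<in> Q" if "\<And>j. j \<in> J \<Longrightarrow> f j \<in> Q" for f and J :: "nat set"
      using that by (induction J rule: infinite_finite_induct) (auto intro: Q_zero Q_add)
    have "proj d X y - proj d X x \<in> Q"
      unfolding e1 by (rule sumQ) (use e2 in simp)
    then show ?thesis by (simp add: lattice_coset_eq_iff)
  qed
  moreover have "x \<in> torus_exp d x" using assms unfolding torus_exp_def by simp
  ultimately have "(\<lambda>x. lattice_coset Q (proj d X x)) ` torus_exp d x = {lattice_coset Q (proj d X x)}"
    by (intro image_eq_singleton)
  then show ?thesis unfolding torus_hom_def by simp
qed

lemma N_group_eq: "N_group d X Q = torus_exp d ` H"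
proof -
  have "torus_hom d X Q (torus_exp d x) = lattice_coset Q 0 \<longleftrightarrow> proj d X x \<in> Q"
    if "x \<in> Rspace d" for x
    by (simp add: torus_hom_torus_exp[OF that] lattice_coset_eq_iff)
  then show ?thesis unfolding N_group_def torus_def H_def by blast
qed

definition orbN :: "(nat \<Rightarrow> complex) \<Rightarrow> (nat \<Rightarrow> complex) set" where
  "orbN z = orb (torus_act ` N_group d X Q) z"

lemma orbN_eq: "orbN z = (\<lambda>x. rot x z) ` H"
  unfolding orbN_def orb_def N_group_eq image_image
  by (intro image_cong) (auto simp: torus_act_torus_exp H_def)

lemma H_zero: "(\<lambda>_. 0) \<in> H"
  unfolding H_def Rspace_iff proj_def by (simp add: Q_zero)

lemma H_add: "x \<in> H \<Longrightarrow> y \<in> H \<Longrightarrow> (\<lambda>j. x j + y j) \<in> H"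
  unfolding H_def Rspace_iff proj_def by (auto simp: scaleR_add_left sum.distrib intro: Q_add)

lemma H_minus: "x \<in> H \<Longrightarrow> (\<lambda>j. - x j) \<in> H"
  unfolding H_def Rspace_iff proj_def by (auto simp: sum_negf intro: Q_minus)

lemma orbN_self: "z \<in> orbN z"
  unfolding orbN_eq using H_zero by (force intro: image_eqI[where x = "\<lambda>_. 0"])

lemma orbN_rot: "x \<in> H \<Longrightarrow> orbN (rot x z) = orbN z"
proof -
  assume x: "x \<in> H"
  have "orbN (rot x z) \<subseteq> orbN z" if "x \<in> H" for x z
    unfolding orbN_eq using H_add that by (auto simp: rot_rot)
  from this[OF x, of z] this[OF H_minus[OF x], of "rot x z"] show "orbN (rot x z) = orbN z"
    by (simp add: rot_rot)
qed

lemma orbN_eq_iff: "orbN z = orbN w \<longleftrightarrow> (\<exists>x\<in>H. w = rot x z)"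
proof
  assume "orbN z = orbN w"
  then have "w \<in> orbN z" using orbN_self by simp
  then show "\<exists>x\<in>H. w = rot x z" unfolding orbN_eq by blast
qed (use orbN_rot in auto)

section \<open>The level set and the moment map\<close>

definition Z :: "(nat \<Rightarrow> complex) set" where "Z = zero_level d X lam"

text \<open>Entries of \<open>x\<close> from \<open>d\<close> on do not enter the sums, so the
  kernel condition can be stated for arbitrary sequences by truncating them. In this form it is the
  hypothesis of \<open>functional_with_values\<close>.\<close>

lemma Z_iff:
  "z \<in> Z \<longleftrightarrow> z \<in> Cspace d \<and>
     (\<forall>x. (\<Sum>j<d. x j *\<^sub>R X j) = 0 \<longrightarrow> (\<Sum>j<d. x j * ((cmod (z j))\<^sup>2 + lam j)) = 0)"
proof -
  have "Psi d X lam z = (\<lambda>x\<in>ker_proj d X. 0) \<longleftrightarrow>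
      (\<forall>x\<in>ker_proj d X. (\<Sum>j<d. x j * ((cmod (z j))\<^sup>2 + lam j)) = 0)"
    unfolding Psi_def Upsilon_def ker_proj_def
    by (auto simp: fun_eq_iff restrict_def mult.commute)
  also have "\<dots> \<longleftrightarrow>
    (\<forall>x. (\<Sum>j<d. x j *\<^sub>R X j) = 0 \<longrightarrow> (\<Sum>j<d. x j * ((cmod (z j))\<^sup>2 + lam j)) = 0)"
  proof (intro iffI allI impI)
    fix x assume *: "\<forall>x\<in>ker_proj d X. (\<Sum>j<d. x j * ((cmod (z j))\<^sup>2 + lam j)) = 0"
      and x: "(\<Sum>j<d. x j *\<^sub>R X j) = 0"
    have "(\<lambda>j. if j < d then x j else 0) \<in> ker_proj d X"
      using x unfolding ker_proj_def Rspace_iff proj_def by (simp cong: sum.cong_simp)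
    from *[rule_format, OF this] show "(\<Sum>j<d. x j * ((cmod (z j))\<^sup>2 + lam j)) = 0"
      by (simp cong: sum.cong_simp)
  qed (auto simp: ker_proj_def proj_def)
  finally show ?thesis unfolding Z_def zero_level_def by simp
qed

lemma rot_in_Z [simp]: "x \<in> H \<Longrightarrow> rot x z \<in> Z \<longleftrightarrow> z \<in> Z"
  unfolding Z_iff Cspace_def by simp

text \<open>The vanishing of \<open>Psi\<close> says exactly that the numbers on the right respect
  all relations among the normals; the functional found is the value of \<open>Phi\<close>.\<close>

lemma moment_exists:
  assumes "z \<in> Z"
  shows "\<exists>\<mu> :: 'v \<Rightarrow>\<^sub>L real. \<forall>j<d. blinfun_apply \<mu> (X j) = (cmod (z j))\<^sup>2 + lam j"
  using assms unfolding Z_iff by (intro functional_with_values[OF fin sp]) simp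

lemma Z_of_moment:
  assumes "z \<in> Cspace d" "\<And>j. j < d \<Longrightarrow> blinfun_apply \<mu> (X j) = (cmod (z j))\<^sup>2 + lam j"
  shows "z \<in> Z"
  unfolding Z_iff
proof (intro conjI allI impI assms(1))
  fix x assume "(\<Sum>j<d. x j *\<^sub>R X j) = 0"
  then have "blinfun_apply \<mu> (\<Sum>j<d. x j *\<^sub>R X j) = 0" by simp
  then show "(\<Sum>j<d. x j * ((cmod (z j))\<^sup>2 + lam j)) = 0"
    by (simp add: blinfun.sum_right blinfun.scaleR_right assms(2) cong: sum.cong_simp)
qed

text \<open>The description in \<open>Phi\<close> has a unique solution: moduli are constant along
  an orbit, and values on the spanning normals determine a functional.\<close>

lemma Phi_orbN:
  assumes "z \<in> Z" and \<mu>: "\<And>j. j < d \<Longrightarrow> blinfun_apply \<mu> (X j) = (cmod (z j))\<^sup>2 + lam j"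
  shows "Phi d X lam (orbN z) = \<mu>"
proof -
  have char: "(\<lambda>x\<in>Rspace d. blinfun_apply \<nu> (proj d X x)) = Upsilon d lam w \<longleftrightarrow>
    (\<forall>j<d. blinfun_apply \<nu> (X j) = (cmod (w j))\<^sup>2 + lam j)" (is "?l \<longleftrightarrow> ?r") for \<nu> w
  proof
    assume l: ?l
    show ?r
    proof (intro allI impI)
      fix j assume j: "j < d"
      let ?e = "\<lambda>i. if i = j then 1 else 0 :: real"
      have e: "?e \<in> Rspace d" using j by (auto simp: Rspace_iff)
      have "blinfun_apply \<nu> (proj d X ?e) = (\<Sum>i<d. ((cmod (w i))\<^sup>2 + lam i) * ?e i)"
        using fun_cong[OF l, of ?e] e unfolding Upsilon_def by simp
      then show "blinfun_apply \<nu> (X j) = (cmod (w j))\<^sup>2 + lam j"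
        using j unfolding proj_def
        by (simp add: if_distrib[of "\<lambda>c. c *\<^sub>R _"] if_distrib[of "\<lambda>c. _ * c"] cong: if_cong)
    qed
  next
    assume r: ?r
    have "blinfun_apply \<nu> (proj d X x) = (\<Sum>j<d. ((cmod (w j))\<^sup>2 + lam j) * x j)" for x
      using r unfolding proj_def
      by (simp add: blinfun.sum_right blinfun.scaleR_right mult.commute cong: sum.cong_simp)
    then show ?l unfolding Upsilon_def by (simp cong: restrict_cong)
  qed
  show ?thesis
    unfolding Phi_def
  proof (rule the_equality)
    show "\<forall>w\<in>orbN z. (\<lambda>x\<in>Rspace d. blinfun_apply \<mu> (proj d X x)) = Upsilon d lam w"
      unfolding char orbN_eq using \<mu> by auto
    fix \<nu> assume "\<forall>w\<in>orbN z. (\<lambda>x\<in>Rspace d. blinfun_apply \<nu> (proj d X x)) = Upsilon d lam w"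
    then have "\<forall>j<d. blinfun_apply \<nu> (X j) = (cmod (z j))\<^sup>2 + lam j"
      unfolding char using orbN_self by blast
    then show "\<nu> = \<mu>" using \<mu> by (intro blinfun_eq_on_span[OF sp]) auto
  qed
qed

section \<open>The quotient topology of the orbit space\<close>

abbreviation M :: "(nat \<Rightarrow> complex) set topology" where "M \<equiv> M_space d X lam Q"

lemma M_eq: "M = quotient_topology (top_of_set Z) orbN"
  unfolding M_space_def Z_def orbN_def[abs_def] by simp

lemma topspace_M: "topspace M = orbN ` Z"
  unfolding M_eq by (simp add: topspace_quotient_topology)

lemma quotient_map_orbN: "quotient_map (top_of_set Z) M orbN"
  unfolding M_eq by (rule quotient_map_quotient_topology)

lemma continuous_map_orbN: "continuous_map (top_of_set Z) M orbN"
  using quotient_map_orbN by (rule quotient_imp_continuous_map)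

lemma openin_M_iff: "openin M W \<longleftrightarrow> W \<subseteq> orbN ` Z \<and> openin (top_of_set Z) {z \<in> Z. orbN z \<in> W}"
  unfolding M_eq openin_quotient_topology by simp

text \<open>The saturation of an open set is the union of its preimages under all rotations by
  elements of \<open>H\<close>; this works for dense orbits as well.\<close>

lemma open_map_orbN: "open_map (top_of_set Z) M orbN"
  unfolding open_map_def
proof (intro allI impI)
  fix U assume U: "openin (top_of_set Z) U"
  then have UZ: "U \<subseteq> Z" using openin_imp_subset by blast
  have "{z \<in> Z. orbN z \<in> orbN ` U} = (\<Union>x\<in>H. Z \<inter> rot x -` U)"
  proof (intro equalityI subsetI)
    fix z assume "z \<in> {z \<in> Z. orbN z \<in> orbN ` U}"
    then obtain u where u: "z \<in> Z" "u \<in> U" "orbN z = orbN u" by blast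
    then obtain x where "x \<in> H" "u = rot x z" using orbN_eq_iff by blast
    with u show "z \<in> (\<Union>x\<in>H. Z \<inter> rot x -` U)" by blast
  next
    fix z assume "z \<in> (\<Union>x\<in>H. Z \<inter> rot x -` U)"
    then obtain x where x: "x \<in> H" "z \<in> Z" "rot x z \<in> U" by blast
    have "orbN z \<in> orbN ` U"
      using x(3) by (intro image_eqI[where x = "rot x z"]) (simp add: orbN_rot[OF x(1)])
    with x(2) show "z \<in> {z \<in> Z. orbN z \<in> orbN ` U}" by simp
  qed
  moreover have "openin (top_of_set Z) (\<Union>x\<in>H. Z \<inter> rot x -` U)"
  proof (intro openin_Union ballI)
    fix S assume "S \<in> (\<lambda>x. Z \<inter> rot x -` U) ` H"
    then obtain x where x: "x \<in> H" "S = Z \<inter> rot x -` U" by blast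
    have "rot x \<in> Z \<rightarrow> Z" using x(1) by simp
    with continuous_on_rot U show "openin (top_of_set Z) S"
      unfolding x(2) using continuous_openin_preimage[of Z "rot x" Z U] by blast
  qed
  ultimately show "openin M (orbN ` U)"
    unfolding openin_M_iff using UZ by auto
qed

lemma saturated_preimage:
  assumes "\<And>x z. x \<in> H \<Longrightarrow> z \<in> S \<Longrightarrow> rot x z \<in> S" "S \<subseteq> Z"
  shows "{z \<in> Z. orbN z \<in> orbN ` S} = S"
proof
  show "{z \<in> Z. orbN z \<in> orbN ` S} \<subseteq> S"
  proof clarify
    fix z s assume "z \<in> Z" "s \<in> S" "orbN z = orbN s"
    from this(3)[symmetric] obtain x where "x \<in> H" "z = rot x s" unfolding orbN_eq_iff by blast
    with assms \<open>s \<in> S\<close> show "z \<in> S" by blast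
  qed
qed (use assms(2) in blast)

lemma closedin_M_image:
  assumes "\<And>x z. x \<in> H \<Longrightarrow> z \<in> S \<Longrightarrow> rot x z \<in> S" "closedin (top_of_set Z) S"
  shows "closedin M (orbN ` S)"
proof -
  have SZ: "S \<subseteq> Z" using assms(2) closedin_imp_subset by blast
  have "closedin M (orbN ` S) \<longleftrightarrow> closedin (top_of_set Z) {z \<in> topspace (top_of_set Z). orbN z \<in> orbN ` S}"
    using quotient_map_orbN SZ unfolding quotient_map_closedin by (simp add: topspace_M image_mono)
  then show ?thesis using saturated_preimage[OF assms(1) SZ] assms(2) by simp
qed

section \<open>Strata of the level set by vanishing coordinates\<close>

definition stratum :: "nat set \<Rightarrow> (nat \<Rightarrow> complex) set" where
  "stratum I = {z \<in> Z. \<forall>j<d. z j = 0 \<longleftrightarrow> j \<in> I}"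

text \<open>The squared modulus of the \<open>j\<close>-th coordinate is the slack of the
  \<open>j\<close>-th inequality at the moment value, so a coordinate vanishes exactly when the
  moment value lies on the corresponding facet.\<close>

lemma Phi_preimage_face:
  "Phi_preimage d X lam Q (open_face_of_index d X lam I) = orbN ` stratum I"
proof -
  have "Phi d X lam (orbN z) \<in> open_face_of_index d X lam I \<longleftrightarrow> z \<in> stratum I" if z: "z \<in> Z" for z
  proof -
    obtain \<mu> :: "'v \<Rightarrow>\<^sub>L real" where \<mu>: "\<And>j. j < d \<Longrightarrow> blinfun_apply \<mu> (X j) = (cmod (z j))\<^sup>2 + lam j"
      using moment_exists[OF z] by auto
    have P: "Phi d X lam (orbN z) = \<mu>" by (rule Phi_orbN[OF z]) (rule \<mu>)
    show ?thesis
      using z unfolding P mem_open_face stratum_def by (auto simp: \<mu>)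
  qed
  moreover have "rot x z \<in> stratum I \<longleftrightarrow> z \<in> stratum I" if "x \<in> H" for x z
    using that unfolding stratum_def by simp
  ultimately show ?thesis
    unfolding Phi_preimage_def topspace_M by (auto simp: stratum_def)
qed

lemma stratum_empty_iff: "stratum I = {} \<longleftrightarrow> open_face_of_index d X lam I = {}"
proof (rule iffI; rule ccontr)
  assume s: "stratum I = {}" and "open_face_of_index d X lam I \<noteq> {}"
  then obtain \<mu> where \<mu>: "\<mu> \<in> open_face_of_index d X lam I" by blast
  \<comment> \<open>Square roots of the slacks of \<open>\<mu>\<close> give the point of the level
    set over \<open>\<mu>\<close> with nonnegative real coordinates.\<close>
  define z where "z j = (if j < d then complex_of_real (sqrt (blinfun_apply \<mu> (X j) - lam j)) else 0)" for j
  have z: "blinfun_apply \<mu> (X j) = (cmod (z j))\<^sup>2 + lam j" "z j = 0 \<longleftrightarrow> j \<in> I" if "j < d" for j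
    using that \<mu> unfolding z_def mem_open_face by (auto simp: norm_of_real)
  have "z \<in> Z" by (rule Z_of_moment[OF _ z(1)]) (auto simp: Cspace_def z_def)
  with z s show False unfolding stratum_def by blast
next
  assume o: "open_face_of_index d X lam I = {}" and "stratum I \<noteq> {}"
  then obtain z where z: "z \<in> stratum I" by blast
  then have "z \<in> Z" unfolding stratum_def by blast
  then obtain \<mu> :: "'v \<Rightarrow>\<^sub>L real" where \<mu>: "\<And>j. j < d \<Longrightarrow> blinfun_apply \<mu> (X j) = (cmod (z j))\<^sup>2 + lam j"
    using moment_exists[OF \<open>z \<in> Z\<close>] by auto
  have "\<mu> \<in> open_face_of_index d X lam I"
    using z unfolding mem_open_face stratum_def by (auto simp: \<mu>)
  with o show False by blast
qed

definition zeros :: "(nat \<Rightarrow> complex) \<Rightarrow> nat set" where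
  "zeros z = {j. j < d \<and> z j = 0}"

lemma zeros_subset: "zeros z \<subseteq> {..<d}"
  unfolding zeros_def by auto

lemma stratum_zeros: "z \<in> Z \<Longrightarrow> z \<in> stratum (zeros z)"
  unfolding stratum_def zeros_def by auto

lemma stratum_iff: "I \<subseteq> {..<d} \<Longrightarrow> z \<in> stratum I \<longleftrightarrow> z \<in> Z \<and> zeros z = I"
  unfolding stratum_def zeros_def by auto

lemma zeros_rot [simp]: "zeros (rot x z) = zeros z"
  unfolding zeros_def by simp

definition regular :: "(nat \<Rightarrow> complex) set" where
  "regular = {z \<in> Z. indep_mod X {} (zeros z)}"

lemma regular_piece_eq:
  "regular_piece (dim (UNIV :: 'v set)) d X lam Q = orbN ` regular"
proof
  show "regular_piece (dim (UNIV :: 'v set)) d X lam Q \<subseteq> orbN ` regular"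
  proof
    fix m assume "m \<in> regular_piece (dim (UNIV :: 'v set)) d X lam Q"
    then obtain F where F: "F \<in> nonsingular_faces (dim (UNIV :: 'v set)) d X lam"
      "m \<in> Phi_preimage d X lam Q F"
      unfolding regular_piece_def by blast
    have "F \<in> open_faces d X lam" using F(1) unfolding nonsingular_faces_def by blast
    then obtain K where K: "K \<subseteq> {..<d}" "F = open_face_of_index d X lam K"
      "open_face_of_index d X lam K \<noteq> {}" by (elim open_faceE)
    have "indep_mod X {} K" using F(1) face_card_dim(1)[OF sp K(1) fin K(3)] K(2) by simp
    then have "stratum K \<subseteq> regular" using K(1) by (auto simp: regular_def stratum_iff)
    with F(2) show "m \<in> orbN ` regular" unfolding K(2) Phi_preimage_face by blast
  qed
  show "orbN ` regular \<subseteq> regular_piece (dim (UNIV :: 'v set)) d X lam Q"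
  proof clarify
    fix z assume z: "z \<in> regular"
    then have zZ: "z \<in> Z" and ind: "indep_mod X {} (zeros z)" unfolding regular_def by auto
    have s: "z \<in> stratum (zeros z)" using stratum_zeros[OF zZ] .
    then have ne: "open_face_of_index d X lam (zeros z) \<noteq> {}"
      using stratum_empty_iff[of "zeros z"] by blast
    have "open_face_of_index d X lam (zeros z) \<in> nonsingular_faces (dim (UNIV :: 'v set)) d X lam"
      using face_card_dim(1)[OF sp zeros_subset fin ne] ind by simp
    moreover have "orbN z \<in> Phi_preimage d X lam Q (open_face_of_index d X lam (zeros z))"
      unfolding Phi_preimage_face using s by blast
    ultimately show "orbN z \<in> regular_piece (dim (UNIV :: 'v set)) d X lam Q"
      unfolding regular_piece_def by blast
  qed
qed

text \<open>The moment values of \<open>z\<close> and \<open>z0\<close> differ by a functional that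
  vanishes on the normals in \<open>K\<close>, hence is determined by its values on the basis
  \<open>B\<close>. Conversely the columns of \<open>g\<close> annihilate every relation, so the
  affine equations bring \<open>z\<close> back into the level set.\<close>

lemma zero_level_adapted:
  assumes ad: "adapted d X K B g" and K: "K \<subseteq> {..<d}"
    and z0: "z0 \<in> Z" "\<And>k. k \<in> K \<Longrightarrow> z0 k = 0"
    and z: "z \<in> Cspace d" "\<And>k. k \<in> K \<Longrightarrow> z k = 0"
  shows "z \<in> Z \<longleftrightarrow> (\<forall>j<d. (cmod (z j))\<^sup>2 =
    ((cmod (z0 j))\<^sup>2 - (\<Sum>b\<in>B. g j b * (cmod (z0 b))\<^sup>2)) + (\<Sum>b\<in>B. g j b * (cmod (z b))\<^sup>2))"
    (is "_ \<longleftrightarrow> ?R")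
proof
  have Bd: "b < d" if "b \<in> B" for b using ad that unfolding adapted_def by blast
  assume "z \<in> Z"
  obtain \<mu> :: "'v \<Rightarrow>\<^sub>L real" where \<mu>: "\<And>j. j < d \<Longrightarrow> blinfun_apply \<mu> (X j) = (cmod (z j))\<^sup>2 + lam j"
    using moment_exists[OF \<open>z \<in> Z\<close>] by auto
  obtain \<nu> :: "'v \<Rightarrow>\<^sub>L real" where \<nu>: "\<And>j. j < d \<Longrightarrow> blinfun_apply \<nu> (X j) = (cmod (z0 j))\<^sup>2 + lam j"
    using moment_exists[OF z0(1)] by auto
  show ?R
  proof (intro allI impI)
    fix j assume j: "j < d"
    have "X j - (\<Sum>b\<in>B. g j b *\<^sub>R X b) \<in> span (X ` K)"
      using ad j unfolding adapted_def by blast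
    then have "blinfun_apply (\<mu> - \<nu>) (X j - (\<Sum>b\<in>B. g j b *\<^sub>R X b)) = 0"
    proof (rule blinfun_zero_on_span)
      fix v assume "v \<in> X ` K"
      then obtain k where "k \<in> K" "v = X k" by blast
      then show "blinfun_apply (\<mu> - \<nu>) v = 0"
        using z0(2) z(2) K \<mu>[of k] \<nu>[of k] by (auto simp: blinfun.diff_left)
    qed
    then show "(cmod (z j))\<^sup>2 =
      ((cmod (z0 j))\<^sup>2 - (\<Sum>b\<in>B. g j b * (cmod (z0 b))\<^sup>2)) + (\<Sum>b\<in>B. g j b * (cmod (z b))\<^sup>2)"
      using \<mu>[OF j] \<nu>[OF j]
      by (simp add: blinfun.diff_left blinfun.diff_right blinfun.sum_right blinfun.scaleR_right
          \<mu>[OF Bd] \<nu>[OF Bd] algebra_simps sum.distrib sum_subtractf cong: sum.cong_simp)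
  qed
next
  assume R: ?R
  show "z \<in> Z"
    unfolding Z_iff
  proof (intro conjI allI impI z(1))
    fix x assume x: "(\<Sum>j<d. x j *\<^sub>R X j) = 0"
    have rel: "(\<Sum>j<d. x j * g j b) = 0" if "b \<in> B" for b
      using adapted_relation[OF ad _ that, of x] x by (simp add: span_zero)
    have "(\<Sum>j<d. x j * ((cmod (z j))\<^sup>2 + lam j)) =
        (\<Sum>j<d. x j * ((cmod (z0 j))\<^sup>2 + lam j)
          + (\<Sum>b\<in>B. x j * g j b * ((cmod (z b))\<^sup>2 - (cmod (z0 b))\<^sup>2)))"
    proof (rule sum.cong[OF refl])
      fix j assume "j \<in> {..<d}"
      then have "(cmod (z j))\<^sup>2 = (cmod (z0 j))\<^sup>2 + (\<Sum>b\<in>B. g j b * ((cmod (z b))\<^sup>2 - (cmod (z0 b))\<^sup>2))"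
        using R by (simp add: right_diff_distrib sum_subtractf)
      then show "x j * ((cmod (z j))\<^sup>2 + lam j) = x j * ((cmod (z0 j))\<^sup>2 + lam j)
          + (\<Sum>b\<in>B. x j * g j b * ((cmod (z b))\<^sup>2 - (cmod (z0 b))\<^sup>2))"
        by (simp add: distrib_left sum_distrib_left mult.assoc)
    qed
    also have "\<dots> = (\<Sum>j<d. x j * ((cmod (z0 j))\<^sup>2 + lam j))
        + (\<Sum>j<d. \<Sum>b\<in>B. x j * g j b * ((cmod (z b))\<^sup>2 - (cmod (z0 b))\<^sup>2))"
      by (rule sum.distrib)
    also have "(\<Sum>j<d. \<Sum>b\<in>B. x j * g j b * ((cmod (z b))\<^sup>2 - (cmod (z0 b))\<^sup>2))
        = (\<Sum>b\<in>B. (\<Sum>j<d. x j * g j b) * ((cmod (z b))\<^sup>2 - (cmod (z0 b))\<^sup>2))"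
      by (subst sum.swap) (simp add: sum_distrib_right)
    also have "\<dots> = 0" by (simp add: rel)
    also have "(\<Sum>j<d. x j * ((cmod (z0 j))\<^sup>2 + lam j)) = 0"
      using z0(1) x unfolding Z_iff by blast
    finally show "(\<Sum>j<d. x j * ((cmod (z j))\<^sup>2 + lam j)) = 0" by simp
  qed
qed

text \<open>The image of \<open>Q\<close> modulo the span of the normals in \<open>K\<close>,
  written in coordinates with respect to \<open>B\<close>. It may be dense. Values of
  \<open>a\<close> outside \<open>B\<close> are arbitrary, which \<open>Gam_cong\<close>
  expresses.\<close>

definition Gam :: "nat set \<Rightarrow> nat set \<Rightarrow> (nat \<Rightarrow> real) set" where
  "Gam K B = {a. \<exists>q\<in>Q. (\<Sum>b\<in>B. a b *\<^sub>R X b) - q \<in> span (X ` K)}"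

text \<open>Rotating the coordinates in \<open>K\<close> does not move a point where they vanish.
  Therefore only the class of the rotation vector modulo the normals in \<open>K\<close> decides
  whether it acts like an element of \<open>N\<close>, and this class is read off in the basis
  \<open>B\<close>.\<close>

lemma orbN_eq_iff_adapted:
  assumes ad: "adapted d X K B g" and K: "K \<subseteq> {..<d}"
    and z: "z \<in> Cspace d" "\<And>k. k \<in> K \<Longrightarrow> z k = 0"
  shows "orbN z = orbN w \<longleftrightarrow> (\<exists>y. w = rot y z \<and> (\<lambda>b. \<Sum>j<d. y j * g j b) \<in> Gam K B)"
proof
  assume "orbN z = orbN w"
  then obtain y where y: "y \<in> H" "w = rot y z" unfolding orbN_eq_iff by blast
  have "(\<Sum>j<d. y j *\<^sub>R X j) \<in> Q" using y(1) unfolding H_def proj_def by blast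
  moreover have "(\<Sum>b\<in>B. (\<Sum>j<d. y j * g j b) *\<^sub>R X b) - (\<Sum>j<d. y j *\<^sub>R X j) \<in> span (X ` K)"
    using span_neg[OF adapted_sum[OF ad order_refl, of y]] by simp
  ultimately have "(\<lambda>b. \<Sum>j<d. y j * g j b) \<in> Gam K B" unfolding Gam_def by blast
  with y(2) show "\<exists>y. w = rot y z \<and> (\<lambda>b. \<Sum>j<d. y j * g j b) \<in> Gam K B" by blast
next
  assume "\<exists>y. w = rot y z \<and> (\<lambda>b. \<Sum>j<d. y j * g j b) \<in> Gam K B"
  then obtain y q where w: "w = rot y z" and q: "q \<in> Q"
    "(\<Sum>b\<in>B. (\<Sum>j<d. y j * g j b) *\<^sub>R X b) - q \<in> span (X ` K)"
    unfolding Gam_def by blast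
  have finK: "finite K" using K finite_subset by blast
  have "(\<Sum>j<d. y j *\<^sub>R X j) - q \<in> span (X ` K)"
    using span_add[OF adapted_sum[OF ad order_refl, of y] q(2)] by simp
  then obtain a where a: "(\<Sum>j<d. y j *\<^sub>R X j) - q = (\<Sum>k\<in>K. a k *\<^sub>R X k)"
    unfolding span_image_eq_range_sum[OF finK] by blast
  \<comment> \<open>The correction in the coordinates of \<open>K\<close> makes the projection equal
    to \<open>q\<close> exactly, and it is invisible on \<open>z\<close>; entries from
    \<open>d\<close> on are cleared to land in \<open>Rspace d\<close>.\<close>
  define y' where "y' j = (if j < d then y j - (if j \<in> K then a j else 0) else 0)" for j
  have "(\<Sum>j<d. (if j \<in> K then a j else 0) *\<^sub>R X j) = (\<Sum>k\<in>K. a k *\<^sub>R X k)"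
    using K by (intro sum.mono_neutral_cong_right) auto
  then have "proj d X y' = q"
    using a unfolding proj_def y'_def by (simp add: scaleR_diff_left sum_subtractf algebra_simps)
  then have "y' \<in> H" using q(1) unfolding H_def Rspace_iff y'_def by auto
  moreover have "w = rot y' z"
    using z unfolding w rot_def y'_def Cspace_def by (auto simp: fun_eq_iff)
  ultimately show "orbN z = orbN w" unfolding orbN_eq_iff by blast
qed

lemma Gam_zero: "(\<lambda>_. 0) \<in> Gam K B"
  unfolding Gam_def using Q_zero by (auto intro!: bexI[where x = 0] span_zero)

lemma Gam_add:
  assumes "a \<in> Gam K B" "a' \<in> Gam K B"
  shows "(\<lambda>b. a b + a' b) \<in> Gam K B"
proof -
  obtain q q' where q: "q \<in> Q" "(\<Sum>b\<in>B. a b *\<^sub>R X b) - q \<in> span (X ` K)"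
    and q': "q' \<in> Q" "(\<Sum>b\<in>B. a' b *\<^sub>R X b) - q' \<in> span (X ` K)"
    using assms unfolding Gam_def by blast
  have "(\<Sum>b\<in>B. (a b + a' b) *\<^sub>R X b) - (q + q') \<in> span (X ` K)"
    using span_add[OF q(2) q'(2)] by (simp add: scaleR_add_left sum.distrib algebra_simps)
  with Q_add[OF q(1) q'(1)] show ?thesis unfolding Gam_def by blast
qed

lemma Gam_minus:
  assumes "a \<in> Gam K B"
  shows "(\<lambda>b. - a b) \<in> Gam K B"
proof -
  obtain q where q: "q \<in> Q" "(\<Sum>b\<in>B. a b *\<^sub>R X b) - q \<in> span (X ` K)"
    using assms unfolding Gam_def by blast
  have "(\<Sum>b\<in>B. (- a b) *\<^sub>R X b) - (- q) \<in> span (X ` K)"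
    using span_neg[OF q(2)] by (simp add: sum_negf algebra_simps)
  with Q_minus[OF q(1)] show ?thesis unfolding Gam_def by blast
qed

text \<open>Since \<open>X j\<close> lies in \<open>Q\<close>, full turns of the \<open>j\<close>-th
  coordinate change the coordinates in \<open>B\<close> by an element of the structure
  group.\<close>

lemma Gam_normal:
  assumes ad: "adapted d X K B g" and "j < d"
  shows "(\<lambda>b. of_int m * g j b) \<in> Gam K B"
proof -
  have "of_int m *\<^sub>R (X j - (\<Sum>b\<in>B. g j b *\<^sub>R X b)) \<in> span (X ` K)"
    using assms unfolding adapted_def by (intro span_scale) blast
  then have "(\<Sum>b\<in>B. (of_int m * g j b) *\<^sub>R X b) - of_int m *\<^sub>R X j \<in> span (X ` K)"
    using span_neg by (fastforce simp: scaleR_diff_right scaleR_sum_right)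
  with Q_of_int[OF XQ[OF assms(2)]] show ?thesis unfolding Gam_def by blast
qed

lemma Gam_cong: "a \<in> Gam K B \<Longrightarrow> (\<And>b. b \<in> B \<Longrightarrow> a b = a' b) \<Longrightarrow> a' \<in> Gam K B"
  unfolding Gam_def by (simp cong: sum.cong_simp)

end

section \<open>Charts\<close>

lemma rotation_norm:
  "(p * cos t - q * sin t)\<^sup>2 + (p * sin t + q * cos t)\<^sup>2 = p\<^sup>2 + q\<^sup>2" for p q t :: real
proof -
  have "(p * cos t - q * sin t)\<^sup>2 + (p * sin t + q * cos t)\<^sup>2
    = (p\<^sup>2 + q\<^sup>2) * ((cos t)\<^sup>2 + (sin t)\<^sup>2)" by algebra
  then show ?thesis by simp
qed

text \<open>The coordinates with indices \<open>2 * ix b\<close> and \<open>2 * ix b + 1\<close> of a point of \<open>\<real>\<^sup>2\<^sup>m\<close>, where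
  \<open>m = card B\<close>, belong to the basis vector \<open>X b\<close>. For \<open>b \<in> I\<close> they are the real and imaginary
  part of the \<open>b\<close>-th complex coordinate of the level set, otherwise the square of its modulus and
  its argument divided by \<open>2\<pi>\<close>. The parameter \<open>A\<close> of \<open>D I A\<close> consists of those
  \<open>b \<in> I\<close> whose complex coordinate is allowed to vanish.\<close>

locale frame = polytope_data d X lam Q
  for d and X :: "nat \<Rightarrow> 'v::real_normed_vector" and lam and Q +
  fixes K B :: "nat set" and g :: "nat \<Rightarrow> nat \<Rightarrow> real" and z0 :: "nat \<Rightarrow> complex"
    and ix :: "nat \<Rightarrow> nat"
  assumes K: "K \<subseteq> {..<d}" and ad: "adapted d X K B g"
    and z0: "z0 \<in> Z" "\<And>k. k \<in> K \<Longrightarrow> z0 k = 0"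
    and ix: "bij_betw ix B {..<card B}"
begin

section \<open>Coordinates, domains and maps of a frame\<close>

abbreviation "m \<equiv> card B"

definition re :: "rvec \<Rightarrow> nat \<Rightarrow> real" where "re x b = x (2 * ix b)"
definition im :: "rvec \<Rightarrow> nat \<Rightarrow> real" where "im x b = x (Suc (2 * ix b))"

definition mk :: "(nat \<Rightarrow> real) \<Rightarrow> (nat \<Rightarrow> real) \<Rightarrow> rvec" where
  "mk u v = (\<lambda>k. if k < 2 * m then if even k then u (inv_into B ix (k div 2))
     else v (inv_into B ix (k div 2)) else 0)"

definition sq :: "nat set \<Rightarrow> rvec \<Rightarrow> nat \<Rightarrow> real" where
  "sq I x b = (if b \<in> I then (re x b)\<^sup>2 + (im x b)\<^sup>2 else re x b)"

text \<open>The constant term of the affine function in \<open>zero_level_adapted\<close>;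
  \<open>z0\<close> serves as the origin on the level set.\<close>

definition c0 :: "nat \<Rightarrow> real" where
  "c0 j = (cmod (z0 j))\<^sup>2 - (\<Sum>b\<in>B. g j b * (cmod (z0 b))\<^sup>2)"

definition slack :: "nat set \<Rightarrow> rvec \<Rightarrow> nat \<Rightarrow> real" where
  "slack I x j = c0 j + (\<Sum>b\<in>B. g j b * sq I x b)"

text \<open>Four cases occur: \<open>D I I\<close> is the domain of a chart, \<open>D I A\<close>
  its part over an overlap, \<open>D A A\<close> the universal cover of that part, and
  \<open>D I {}\<close> the set where no complex coordinate vanishes, which consists of free
  points.\<close>

definition D :: "nat set \<Rightarrow> nat set \<Rightarrow> rvec set" where
  "D I A = {x \<in> Rspace (2 * m). \<forall>j\<in>{..<d} - K - A. slack I x j > 0}"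

definition param :: "nat set \<Rightarrow> rvec \<Rightarrow> nat \<Rightarrow> complex" where
  "param I x j =
     (if j \<in> I then Complex (re x j) (im x j)
      else if j \<in> B then of_real (sqrt (re x j)) * cis (2 * pi * im x j)
      else if j < d then of_real (sqrt (slack I x j)) else 0)"

text \<open>On \<open>D A A\<close> the directions of \<open>I - A\<close> carry squared modulus and
  argument. This map makes them Cartesian and leaves all other directions as they are.\<close>

definition pol :: "nat set \<Rightarrow> nat set \<Rightarrow> rvec \<Rightarrow> rvec" where
  "pol I A x = mk (\<lambda>b. if b \<in> I - A then sqrt (re x b) * cos (2 * pi * im x b) else re x b)
                  (\<lambda>b. if b \<in> I - A then sqrt (re x b) * sin (2 * pi * im x b) else im x b)"

definition act :: "nat set \<Rightarrow> (nat \<Rightarrow> real) \<Rightarrow> rvec \<Rightarrow> rvec" where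
  "act I a x =
     mk (\<lambda>b. if b \<in> I then re x b * cos (2 * pi * a b) - im x b * sin (2 * pi * a b) else re x b)
        (\<lambda>b. if b \<in> I then re x b * sin (2 * pi * a b) + im x b * cos (2 * pi * a b)
             else im x b + a b)"

definition G :: "nat set \<Rightarrow> nat set \<Rightarrow> (rvec \<Rightarrow> rvec) set" where
  "G I A = (\<lambda>a. restrict (act I a) (D I A)) ` Gam K B"

text \<open>The points whose vanishing set lies between \<open>K\<close> and
  \<open>K \<union> A\<close>: a single stratum for \<open>A = {}\<close>, an open part of the level
  set for \<open>K = {}\<close>.\<close>

definition ZS :: "nat set \<Rightarrow> (nat \<Rightarrow> complex) set" where
  "ZS A = {z \<in> Z. (\<forall>k\<in>K. z k = 0) \<and> (\<forall>j\<in>{..<d} - K - A. z j \<noteq> 0)}"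

lemma finB: "finite B" using adapted_finite[OF ad] .

lemma Bd: "b \<in> B \<Longrightarrow> b < d" and BK: "b \<in> B \<Longrightarrow> b \<notin> K"
  using ad unfolding adapted_def by blast+

lemma ix_less: "b \<in> B \<Longrightarrow> ix b < m"
  using ix unfolding bij_betw_def by blast

lemma inv_ix [simp]: "b \<in> B \<Longrightarrow> inv_into B ix (ix b) = b"
  using ix unfolding bij_betw_def by simp

lemma re_mk [simp]: "b \<in> B \<Longrightarrow> re (mk u v) b = u b"
  and im_mk [simp]: "b \<in> B \<Longrightarrow> im (mk u v) b = v b"
  using ix_less[of b] unfolding mk_def re_def im_def by auto

lemma mk_Rspace [simp]: "mk u v \<in> Rspace (2 * m)"
  unfolding Rspace_iff mk_def by simp

lemma coord_cases:
  assumes "k < 2 * m"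
  obtains b where "b \<in> B" "k = 2 * ix b" | b where "b \<in> B" "k = Suc (2 * ix b)"
proof -
  have "k div 2 \<in> ix ` B" using ix assms unfolding bij_betw_def by auto
  then obtain b where b: "b \<in> B" "k div 2 = ix b" by auto
  have "k = 2 * (k div 2) \<or> k = Suc (2 * (k div 2))" by presburger
  with b that show ?thesis by auto
qed

lemma rvec_eqI:
  assumes "x \<in> Rspace (2 * m)" "y \<in> Rspace (2 * m)"
    "\<And>b. b \<in> B \<Longrightarrow> re x b = re y b" "\<And>b. b \<in> B \<Longrightarrow> im x b = im y b"
  shows "x = y"
proof
  fix k show "x k = y k"
  proof (cases "k < 2 * m")
    case True
    then show ?thesis
    proof (cases rule: coord_cases)
      case (1 b)
      then show ?thesis using assms(3)[of b] by (simp add: re_def)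
    next
      case (2 b)
      then show ?thesis using assms(4)[of b] by (simp add: im_def)
    qed
  next
    case False
    then show ?thesis using assms(1,2) unfolding Rspace_iff by simp
  qed
qed

lemma elem_fun_mk:
  assumes "\<And>b. b \<in> B \<Longrightarrow> elem_fun S (\<lambda>x. u x b)" "\<And>b. b \<in> B \<Longrightarrow> elem_fun S (\<lambda>x. v x b)"
  shows "elem_fun S (\<lambda>x. mk (u x) (v x) k)"
proof (cases "k < 2 * m")
  case True
  then show ?thesis
  proof (cases rule: coord_cases)
    case (1 b)
    then have eq: "(\<lambda>x. mk (u x) (v x) k) = (\<lambda>x. u x b)" using re_mk[of b] by (simp add: re_def)
    show ?thesis unfolding eq by (rule assms(1)) fact
  next
    case (2 b)
    then have eq: "(\<lambda>x. mk (u x) (v x) k) = (\<lambda>x. v x b)" using im_mk[of b] by (simp add: im_def)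
    show ?thesis unfolding eq by (rule assms(2)) fact
  qed
next
  case False
  then show ?thesis unfolding mk_def by (simp add: elem_fun.const)
qed

lemma continuous_on_mk:
  assumes "\<And>b. b \<in> B \<Longrightarrow> continuous_on S (\<lambda>x. u x b)" "\<And>b. b \<in> B \<Longrightarrow> continuous_on S (\<lambda>x. v x b)"
  shows "continuous_on S (\<lambda>x. mk (u x) (v x))"
proof (rule continuous_on_coordinatewise_then_product)
  fix k
  show "continuous_on S (\<lambda>x. mk (u x) (v x) k)"
  proof (cases "k < 2 * m")
    case True
    then show ?thesis
    proof (cases rule: coord_cases)
      case (1 b)
      then have eq: "(\<lambda>x. mk (u x) (v x) k) = (\<lambda>x. u x b)" using re_mk[of b] by (simp add: re_def)
      show ?thesis unfolding eq by (rule assms(1)) fact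
    next
      case (2 b)
      then have eq: "(\<lambda>x. mk (u x) (v x) k) = (\<lambda>x. v x b)" using im_mk[of b] by (simp add: im_def)
      show ?thesis unfolding eq by (rule assms(2)) fact
    qed
  next
    case False
    then show ?thesis unfolding mk_def by simp
  qed
qed

lemma continuous_on_re [continuous_intros]: "continuous_on S (\<lambda>x. re x b)"
  and continuous_on_im [continuous_intros]: "continuous_on S (\<lambda>x. im x b)"
  unfolding re_def im_def by (rule continuous_on_coord)+

lemma elem_fun_re: "elem_fun S (\<lambda>x. re x b)" and elem_fun_im: "elem_fun S (\<lambda>x. im x b)"
  unfolding re_def im_def by (rule elem_fun.coord)+

lemma g_basis: "j \<in> B \<Longrightarrow> b \<in> B \<Longrightarrow> g j b = (if b = j then 1 else 0)"
  using adapted_coeff_basis[OF ad] .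

lemma g_K: "k \<in> K \<Longrightarrow> b \<in> B \<Longrightarrow> g k b = 0"
  using adapted_coeff_zero[OF ad] K by blast

lemma sum_g_basis: "j \<in> B \<Longrightarrow> (\<Sum>b\<in>B. g j b * u b) = u j"
proof -
  assume j: "j \<in> B"
  have "(\<Sum>b\<in>B. g j b * u b) = (\<Sum>b\<in>B. if b = j then u b else 0)"
    by (intro sum.cong) (auto simp: g_basis[OF j])
  then show ?thesis using j finB by simp
qed

lemma sum_g_K: "k \<in> K \<Longrightarrow> (\<Sum>b\<in>B. g k b * u b) = 0"
  by (simp add: g_K cong: sum.cong_simp)

lemma slack_basis: "j \<in> B \<Longrightarrow> slack I x j = sq I x j"
  unfolding slack_def c0_def by (simp add: sum_g_basis)

lemma slack_K: "k \<in> K \<Longrightarrow> slack I x k = 0"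
  unfolding slack_def c0_def using z0(2) by (simp add: sum_g_K)

lemma slack_cong: "(\<And>b. b \<in> B \<Longrightarrow> sq I x b = sq J y b) \<Longrightarrow> slack I x = slack J y"
  unfolding slack_def by (simp cong: sum.cong_simp)

lemma Z_iff_slack:
  assumes "z \<in> Cspace d" "\<And>k. k \<in> K \<Longrightarrow> z k = 0"
  shows "z \<in> Z \<longleftrightarrow> (\<forall>j<d. (cmod (z j))\<^sup>2 = c0 j + (\<Sum>b\<in>B. g j b * (cmod (z b))\<^sup>2))"
  unfolding c0_def using zero_level_adapted[OF ad K z0 assms] .

section \<open>The domains and the parametrization of the level set\<close>

lemma D_Rspace: "x \<in> D I A \<Longrightarrow> x \<in> Rspace (2 * m)"
  unfolding D_def by simp

lemma D_pos: "x \<in> D I A \<Longrightarrow> j < d \<Longrightarrow> j \<notin> K \<Longrightarrow> j \<notin> A \<Longrightarrow> slack I x j > 0"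
  unfolding D_def by simp

lemma D_re_pos: "x \<in> D I A \<Longrightarrow> b \<in> B \<Longrightarrow> b \<notin> I \<Longrightarrow> A \<subseteq> I \<Longrightarrow> re x b > 0"
  using D_pos[of x I A b] Bd BK slack_basis[of b I x] unfolding sq_def by auto

lemma D_mono: "A \<subseteq> A' \<Longrightarrow> D I A \<subseteq> D I A'"
  unfolding D_def by auto

lemma D_slack_nonneg: "x \<in> D I A \<Longrightarrow> A \<subseteq> I \<Longrightarrow> I \<subseteq> B \<Longrightarrow> j < d \<Longrightarrow> slack I x j \<ge> 0"
proof -
  assume x: "x \<in> D I A" "A \<subseteq> I" "I \<subseteq> B" "j < d"
  consider "j \<in> K" | "j \<notin> K" "j \<in> A" | "j \<notin> K" "j \<notin> A" by blast
  then show ?thesis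
  proof cases
    case 2
    then have "j \<in> I" "j \<in> B" using x by auto
    then show ?thesis by (simp add: slack_basis sq_def)
  qed (use slack_K D_pos[OF x(1,4)] in \<open>auto simp: less_imp_le\<close>)
qed

lemma cmod_param:
  assumes "x \<in> D I I" "I \<subseteq> B" "j < d"
  shows "(cmod (param I x j))\<^sup>2 = slack I x j"
proof (cases "j \<in> B")
  case True
  show ?thesis
  proof (cases "j \<in> I")
    case True
    with \<open>j \<in> B\<close> show ?thesis by (simp add: param_def cmod_def slack_basis sq_def)
  next
    case False
    with \<open>j \<in> B\<close> D_re_pos[OF assms(1) \<open>j \<in> B\<close> False] show ?thesis
      by (simp add: param_def norm_mult slack_basis sq_def)
  qed
next
  case False
  with assms D_slack_nonneg[OF assms(1) order_refl assms(2,3)] show ?thesis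
    by (auto simp: param_def)
qed

lemma param_Cspace: "I \<subseteq> B \<Longrightarrow> param I x \<in> Cspace d"
  unfolding Cspace_def param_def using Bd by fastforce

lemma param_K: "I \<subseteq> B \<Longrightarrow> k \<in> K \<Longrightarrow> param I x k = 0"
  unfolding param_def using BK K by (auto simp: slack_K)

lemma param_in_Z:
  assumes "x \<in> D I I" "I \<subseteq> B"
  shows "param I x \<in> Z"
proof -
  have "(cmod (param I x j))\<^sup>2 = c0 j + (\<Sum>b\<in>B. g j b * (cmod (param I x b))\<^sup>2)" if "j < d" for j
  proof -
    have "(\<Sum>b\<in>B. g j b * (cmod (param I x b))\<^sup>2) = (\<Sum>b\<in>B. g j b * sq I x b)"
      by (intro sum.cong refl) (simp add: cmod_param[OF assms Bd] slack_basis)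
    then show ?thesis using cmod_param[OF assms that] unfolding slack_def by simp
  qed
  then show ?thesis using Z_iff_slack[OF param_Cspace[OF assms(2)] param_K[OF assms(2)]] by blast
qed

lemma param_eq_0_iff:
  assumes "x \<in> D I I" "I \<subseteq> B" "j < d"
  shows "param I x j = 0 \<longleftrightarrow> \<not> slack I x j > 0"
proof -
  have "param I x j = 0 \<longleftrightarrow> (cmod (param I x j))\<^sup>2 = 0" by simp
  then show ?thesis
    using D_slack_nonneg[OF assms(1) order_refl assms(2,3)] unfolding cmod_param[OF assms] by auto
qed

lemma param_ZS_iff:
  assumes "x \<in> D I I" "I \<subseteq> B"
  shows "param I x \<in> ZS A \<longleftrightarrow> x \<in> D I A"
proof -
  have "(\<forall>j\<in>{..<d} - K - A. param I x j \<noteq> 0) \<longleftrightarrow> (\<forall>j\<in>{..<d} - K - A. slack I x j > 0)"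
    by (intro ball_cong refl) (simp add: param_eq_0_iff[OF assms])
  then show ?thesis
    unfolding ZS_def D_def using param_in_Z[OF assms] param_K[OF assms(2)] D_Rspace[OF assms(1)]
    by simp
qed

lemma ZS_rot: "x \<in> H \<Longrightarrow> z \<in> ZS A \<Longrightarrow> rot x z \<in> ZS A"
  unfolding ZS_def by simp

lemma ZS_subset: "ZS A \<subseteq> Z"
  unfolding ZS_def by blast

section \<open>The structure group and its orbits\<close>

lemma slack_act: "slack I (act I a x) = slack I x"
  by (rule slack_cong) (simp add: sq_def act_def rotation_norm)

lemma param_act:
  assumes "I \<subseteq> B"
  shows "param I (act I a x) = rot (\<lambda>j. if j \<in> B then a j else 0) (param I x)"
proof
  fix j
  have s: "slack I (act I a x) = slack I x" by (rule slack_act)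
  consider "j \<in> I" | "j \<in> B" "j \<notin> I" | "j \<notin> B" by blast
  then show "param I (act I a x) j = rot (\<lambda>j. if j \<in> B then a j else 0) (param I x) j"
  proof cases
    case 1
    then have "j \<in> B" using assms by blast
    then show ?thesis using 1
      by (simp add: param_def rot_def act_def complex_eq_iff algebra_simps)
  next
    case 2
    then show ?thesis
      by (simp add: param_def rot_def act_def distrib_left cis_mult[symmetric] mult_ac)
  next
    case 3
    then have "j \<notin> I" using assms by blast
    with 3 show ?thesis by (simp add: param_def rot_def s)
  qed
qed

lemma act_in_D: "x \<in> D I A \<Longrightarrow> act I a x \<in> D I A"
  unfolding D_def by (simp add: slack_act) (simp add: act_def)

lemma act_Rspace [simp]: "act I a x \<in> Rspace (2 * m)"
  unfolding act_def by simp

lemma act_act: "act I a (act I a' x) = act I (\<lambda>b. a b + a' b) x"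
proof (rule rvec_eqI[OF act_Rspace act_Rspace])
  fix b assume b: "b \<in> B"
  show "re (act I a (act I a' x)) b = re (act I (\<lambda>b. a b + a' b) x) b"
    "im (act I a (act I a' x)) b = im (act I (\<lambda>b. a b + a' b) x) b"
    using b by (auto simp: act_def distrib_left distrib_right right_diff_distrib left_diff_distrib
        cos_add sin_add mult_ac)
qed

lemma act_zero: "x \<in> Rspace (2 * m) \<Longrightarrow> act I (\<lambda>_. 0) x = x"
  by (rule rvec_eqI) (auto simp: act_def)

lemma orb_G: "x \<in> D I A \<Longrightarrow> orb (G I A) x = (\<lambda>a. act I a x) ` Gam K B"
  unfolding orb_def G_def image_image by (intro image_cong) auto

lemma orb_G_eq_iff:
  assumes "x \<in> D I A" "y \<in> D I A"
  shows "orb (G I A) x = orb (G I A) y \<longleftrightarrow> (\<exists>a\<in>Gam K B. y = act I a x)"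
proof
  assume "orb (G I A) x = orb (G I A) y"
  moreover have "y \<in> orb (G I A) y"
    unfolding orb_G[OF assms(2)]
    using Gam_zero act_zero[OF D_Rspace[OF assms(2)], of I] by (intro image_eqI) auto
  ultimately show "\<exists>a\<in>Gam K B. y = act I a x" unfolding orb_G[OF assms(1)] by auto
next
  assume "\<exists>a\<in>Gam K B. y = act I a x"
  then obtain a where a: "a \<in> Gam K B" "y = act I a x" by blast
  have sub: "orb (G I A) (act I a x) \<subseteq> orb (G I A) x" if x: "x \<in> D I A" and a: "a \<in> Gam K B" for a x
    unfolding orb_G[OF x] orb_G[OF act_in_D[OF x]]
  proof (rule image_subsetI)
    fix a' assume "a' \<in> Gam K B"
    from Gam_add[OF this a] show "act I a' (act I a x) \<in> (\<lambda>a. act I a x) ` Gam K B"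
      unfolding act_act by (rule imageI)
  qed
  have x: "act I (\<lambda>b. - a b) y = x"
    unfolding a(2) act_act using act_zero[OF D_Rspace[OF assms(1)]] by simp
  show "orb (G I A) x = orb (G I A) y"
    using sub[OF assms(1) a(1)] sub[OF assms(2) Gam_minus[OF a(1)]]
    unfolding x a(2)[symmetric] by (intro subset_antisym)
qed

text \<open>The rows of \<open>g\<close> in \<open>K\<close> are zero and the rows in
  \<open>B\<close> form an identity matrix, so only the remaining indices contribute a genuine
  sum.\<close>

lemma sum_Gam_split:
  "(\<Sum>j<d. y j * g j b) = y b + (\<Sum>j\<in>{..<d} - K - B. y j * g j b)" if "b \<in> B"
proof -
  have "(\<Sum>j<d. y j * g j b) = (\<Sum>j\<in>({..<d} - K - B) \<union> B. y j * g j b)"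
    using Bd that by (intro sum.mono_neutral_right) (auto simp: g_K)
  also have "\<dots> = (\<Sum>j\<in>{..<d} - K - B. y j * g j b) + (\<Sum>j\<in>B. y j * g j b)"
    using finB by (intro sum.union_disjoint) auto
  also have "(\<Sum>j\<in>B. y j * g j b) = (\<Sum>j\<in>B. if j = b then y j else 0)"
    using that by (intro sum.cong) (auto simp: g_basis)
  also have "\<dots> = y b" using that finB by simp
  finally show ?thesis by simp
qed

lemma orbN_param_act:
  assumes "I \<subseteq> B" "x \<in> D I I" "a \<in> Gam K B"
  shows "orbN (param I (act I a x)) = orbN (param I x)"
proof -
  let ?y = "\<lambda>j. if j \<in> B then a j else 0"
  have "(\<Sum>j<d. ?y j * g j b) = a b" if "b \<in> B" for b
    unfolding sum_Gam_split[OF that] using that by simp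
  then have "(\<lambda>b. \<Sum>j<d. ?y j * g j b) \<in> Gam K B"
    by (intro Gam_cong[OF assms(3)]) simp
  then have "orbN (param I x) = orbN (rot ?y (param I x))"
    using orbN_eq_iff_adapted[OF ad K param_Cspace[OF assms(1)] param_K[OF assms(1)]] by blast
  then show ?thesis by (simp add: param_act[OF assms(1)])
qed

lemma cis_pos_real_Ints:
  assumes "of_real r * cis (2 * pi * s) = of_real r' * cis (2 * pi * t)" "r > 0" "r' > 0"
  shows "s - t \<in> \<int>"
proof -
  have "cmod (of_real r * cis (2 * pi * s)) = cmod (of_real r' * cis (2 * pi * t))"
    using assms(1) by simp
  then have "r = r'" using assms(2,3) by (simp add: norm_mult)
  then show ?thesis using assms by (simp add: cis_2pi_eq_iff)
qed

text \<open>A rotation between two parametrized points must fix the positive real coordinates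
  outside \<open>B\<close>, so its entries there are integers. On \<open>B - I\<close> it is
  determined by the arguments up to integers. All these integers are absorbed by the structure
  group.\<close>

lemma orbN_param_imp_act:
  assumes I: "I \<subseteq> B" and x: "x \<in> D I I" "x' \<in> D I I" and eq: "orbN (param I x) = orbN (param I x')"
  shows "\<exists>a\<in>Gam K B. x' = act I a x"
proof -
  obtain y where y: "param I x' = rot y (param I x)" "(\<lambda>b. \<Sum>j<d. y j * g j b) \<in> Gam K B"
    using eq orbN_eq_iff_adapted[OF ad K param_Cspace[OF I] param_K[OF I]] by blast
  have slack_eq: "slack I x' j = slack I x j" if "j < d" for j
    using cmod_param[OF x(1) I that] cmod_param[OF x(2) I that] y(1) by simp
  have yj: "y j \<in> \<int>" if j: "j \<in> {..<d} - K - B" for j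
  proof -
    have jI: "j \<notin> I" "j \<notin> B" "j < d" "j \<notin> K" using j I by auto
    have p: "slack I x j > 0" using D_pos[OF x(1) jI(3,4,1)] .
    have "of_real (sqrt (slack I x j)) * cis (2 * pi * 0)
        = of_real (sqrt (slack I x j)) * cis (2 * pi * y j)"
      using fun_cong[OF y(1), of j] jI slack_eq[OF jI(3)] by (simp add: param_def rot_def mult.commute)
    from cis_pos_real_Ints[OF this] p show ?thesis by simp
  qed
  have yk: "im x' b - im x b - y b \<in> \<int>" if b: "b \<in> B" "b \<notin> I" for b
  proof -
    have p: "re x b > 0" "re x' b > 0"
      using D_re_pos[OF x(1) b] D_re_pos[OF x(2) b] by auto
    have "of_real (sqrt (re x' b)) * cis (2 * pi * im x' b)
        = of_real (sqrt (re x b)) * cis (2 * pi * (im x b + y b))"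
      using fun_cong[OF y(1), of b] b
      by (simp add: param_def rot_def distrib_left cis_mult[symmetric] mult_ac)
    from cis_pos_real_Ints[OF this] p show ?thesis by (simp add: algebra_simps)
  qed
  \<comment> \<open>On \<open>B - I\<close> the group acts by translation of arguments, so the exact
    difference is required there; \<open>y b\<close> is only correct modulo integers.\<close>
  define a where "a b = (if b \<in> I then y b else im x' b - im x b)" for b
  have ai: "a b - y b \<in> \<int>" if "b \<in> B" for b
    using yk[OF that] unfolding a_def by simp
  \<comment> \<open>The sum \<open>y + ?w\<close> equals \<open>a\<close> on \<open>B\<close> and
    vanishes outside \<open>B\<close>, so its coordinates in \<open>B\<close> are \<open>a\<close>
    itself. As \<open>?w\<close> is integral off \<open>K\<close>, its contribution lies in
    \<open>Gam K B\<close>.\<close>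
  let ?w = "\<lambda>j. if j \<in> B then a j - y j else - y j"
  have wi: "?w j \<in> \<int>" if "j \<in> {..<d} - K" for j
    using ai yj that by auto
  have sumGam: "(\<lambda>b. \<Sum>j\<in>J. f j b) \<in> Gam K B" if "\<And>j. j \<in> J \<Longrightarrow> f j \<in> Gam K B" for f and J :: "nat set"
    using that by (induction J rule: infinite_finite_induct) (auto intro: Gam_zero Gam_add)
  have "(\<lambda>b. \<Sum>j\<in>{..<d} - K. ?w j * g j b) \<in> Gam K B"
  proof (rule sumGam)
    fix j assume j: "j \<in> {..<d} - K"
    obtain k where "?w j = of_int k" using wi[OF j] by (elim Ints_cases)
    then show "(\<lambda>b. ?w j * g j b) \<in> Gam K B" using Gam_normal[OF ad, of j k] j by simp
  qed
  from Gam_add[OF y(2) this] have "a \<in> Gam K B"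
  proof (rule Gam_cong)
    fix b assume b: "b \<in> B"
    have "(\<Sum>j\<in>{..<d} - K. ?w j * g j b) = (\<Sum>j<d. ?w j * g j b)"
      using b by (intro sum.mono_neutral_left) (auto simp: g_K)
    also have "\<dots> = (a b - y b) + (\<Sum>j\<in>{..<d} - K - B. - (y j * g j b))"
      unfolding sum_Gam_split[OF b] using b by simp
    finally show "(\<Sum>j<d. y j * g j b) + (\<Sum>j\<in>{..<d} - K. ?w j * g j b) = a b"
      unfolding sum_Gam_split[OF b] by (simp add: sum_negf)
  qed
  moreover have "x' = act I a x"
  proof (rule rvec_eqI)
    show "x' \<in> Rspace (2 * m)" using D_Rspace[OF x(2)] .
    show "act I a x \<in> Rspace (2 * m)" by (simp add: act_def)
    fix b assume b: "b \<in> B"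
    have "re x' b = re (act I a x) b \<and> im x' b = im (act I a x) b"
    proof (cases "b \<in> I")
      case True
      have "Complex (re x' b) (im x' b) = cis (2 * pi * y b) * Complex (re x b) (im x b)"
        using fun_cong[OF y(1), of b] True by (simp add: param_def rot_def)
      then show ?thesis using b True unfolding act_def a_def
        by (simp add: complex_eq_iff algebra_simps)
    next
      case False
      have "re x' b = re x b"
        using slack_eq[OF Bd[OF b]] False b by (simp add: slack_basis sq_def)
      then show ?thesis using b False unfolding act_def a_def by simp
    qed
    then show "re x' b = re (act I a x) b" "im x' b = im (act I a x) b" by auto
  qed
  ultimately show ?thesis by blast
qed

end

lemma closure_path:
  fixes \<gamma> :: "real \<Rightarrow> 'a::topological_space"
  assumes "continuous_on UNIV \<gamma>" "eventually (\<lambda>e. \<gamma> e \<in> S) (at_right 0)"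
  shows "\<gamma> 0 \<in> closure S"
proof (rule Lim_in_closed_set)
  show "closed (closure S)" by simp
  show "eventually (\<lambda>e. \<gamma> e \<in> closure S) (at_right 0)"
    using assms(2) by (rule eventually_mono) (use closure_subset in blast)
  have "(\<gamma> \<longlongrightarrow> \<gamma> 0) (at 0)"
    using assms(1) unfolding continuous_on_def by simp
  then show "(\<gamma> \<longlongrightarrow> \<gamma> 0) (at_right 0)"
    by (rule tendsto_mono[rotated]) (simp add: at_le)
qed simp

context frame
begin

section \<open>Topology of the domains: polar coordinates, contractions, density\<close>

lemma continuous_on_sq: "continuous_on S (\<lambda>x. sq I x b)"
  unfolding sq_def by (cases "b \<in> I") (auto intro!: continuous_intros)

lemma continuous_on_slack [continuous_intros]: "continuous_on S (\<lambda>x. slack I x j)"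
  unfolding slack_def by (intro continuous_intros continuous_on_sq)

lemma elem_fun_sq: "elem_fun S (\<lambda>x. sq I x b)"
  unfolding sq_def by (cases "b \<in> I") (auto intro!: elem_fun_intros elem_fun_re elem_fun_im)

lemma elem_fun_slack: "elem_fun S (\<lambda>x. slack I x j)"
  unfolding slack_def by (intro elem_fun_intros elem_fun_sq)

lemma openin_D: "openin (Euclidean_space (2 * m)) (D I A)"
proof -
  have "open (\<Inter>j\<in>{..<d} - K - A. {x. 0 < slack I x j})"
    by (intro open_INT ballI open_Collect_less continuous_intros) simp
  moreover have "D I A = Rspace (2 * m) \<inter> (\<Inter>j\<in>{..<d} - K - A. {x. 0 < slack I x j})"
    unfolding D_def by auto
  ultimately show ?thesis unfolding openin_Euclidean_iff by blast
qed

lemma re_pol [simp]: "b \<in> B \<Longrightarrow> re (pol I A x) b =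
    (if b \<in> I - A then sqrt (re x b) * cos (2 * pi * im x b) else re x b)"
  and im_pol [simp]: "b \<in> B \<Longrightarrow> im (pol I A x) b =
    (if b \<in> I - A then sqrt (re x b) * sin (2 * pi * im x b) else im x b)"
  and pol_Rspace [simp]: "pol I A x \<in> Rspace (2 * m)"
  unfolding pol_def by auto

lemma slack_pol:
  assumes "x \<in> D A A" "A \<subseteq> I"
  shows "slack I (pol I A x) = slack A x"
proof (rule slack_cong)
  fix b assume b: "b \<in> B"
  show "sq I (pol I A x) b = sq A x b"
  proof (cases "b \<in> I - A")
    case True
    then have "re x b > 0" using D_re_pos[OF assms(1) b] by blast
    then have "(sqrt (re x b) * cos t)\<^sup>2 + (sqrt (re x b) * sin t)\<^sup>2 = re x b" for t
      by (simp add: power_mult_distrib flip: distrib_left)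
    then show ?thesis using True b unfolding sq_def by simp
  next
    case False
    then show ?thesis using b assms(2) unfolding sq_def by auto
  qed
qed

lemma pol_in_D: "x \<in> D A A \<Longrightarrow> A \<subseteq> I \<Longrightarrow> pol I A x \<in> D I A"
  unfolding D_def using slack_pol[of x A I] unfolding D_def by simp

lemma param_pol:
  assumes "x \<in> D A A" "A \<subseteq> I" "I \<subseteq> B"
  shows "param I (pol I A x) = param A x"
proof
  fix j
  consider "j \<in> A" | "j \<in> I - A" | "j \<in> B" "j \<notin> I" | "j \<notin> B" by blast
  then show "param I (pol I A x) j = param A x j"
  proof cases
    case 1
    then have "j \<in> I" "j \<in> B" using assms by auto
    with 1 show ?thesis by (simp add: param_def)
  next
    case 2
    then have "j \<in> B" using assms by auto
    with 2 show ?thesis by (simp add: param_def complex_eq_iff)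
  next
    case 3
    then have "j \<notin> A" using assms by auto
    with 3 show ?thesis by (simp add: param_def)
  next
    case 4
    then have "j \<notin> I" "j \<notin> A" using assms by auto
    with 4 show ?thesis by (simp add: param_def slack_pol[OF assms(1,2)])
  qed
qed

lemma pol_image:
  assumes "A \<subseteq> I" "I \<subseteq> B"
  shows "pol I A ` D A A = D I A"
proof
  show "pol I A ` D A A \<subseteq> D I A" using pol_in_D assms(1) by blast
  show "D I A \<subseteq> pol I A ` D A A"
  proof
    fix y assume y: "y \<in> D I A"
    define x where "x = mk (\<lambda>b. if b \<in> I - A then (re y b)\<^sup>2 + (im y b)\<^sup>2 else re y b)
      (\<lambda>b. if b \<in> I - A then Arg (Complex (re y b) (im y b)) / (2 * pi) else im y b)"
    have sl: "slack A x = slack I y"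
      by (rule slack_cong) (use assms in \<open>auto simp: sq_def x_def\<close>)
    have "x \<in> Rspace (2 * m)" unfolding x_def by simp
    then have xD: "x \<in> D A A"
      using y unfolding D_def by (simp add: sl)
    have "pol I A x = y"
    proof (rule rvec_eqI[OF pol_Rspace D_Rspace[OF y]])
      fix b assume b: "b \<in> B"
      have "Complex p q = rcis (sqrt (p\<^sup>2 + q\<^sup>2)) (Arg (Complex p q))" for p q
        using rcis_cmod_Arg[of "Complex p q"] by (simp add: complex_norm)
      then have "Re (Complex p q) = sqrt (p\<^sup>2 + q\<^sup>2) * cos (Arg (Complex p q))"
        "Im (Complex p q) = sqrt (p\<^sup>2 + q\<^sup>2) * sin (Arg (Complex p q))" for p q
        by (metis Re_rcis, metis Im_rcis)
      then show "re (pol I A x) b = re y b" "im (pol I A x) b = im y b"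
        using b by (auto simp: x_def)
    qed
    with xD show "y \<in> pol I A ` D A A" by blast
  qed
qed

lemma continuous_on_pol: "continuous_on S (pol I A)"
  unfolding pol_def[abs_def]
proof (rule continuous_on_mk)
  fix b
  show "continuous_on S (\<lambda>x. if b \<in> I - A then sqrt (re x b) * cos (2 * pi * im x b) else re x b)"
    by (cases "b \<in> I - A") (auto intro!: continuous_intros)
  show "continuous_on S (\<lambda>x. if b \<in> I - A then sqrt (re x b) * sin (2 * pi * im x b) else im x b)"
    by (cases "b \<in> I - A") (auto intro!: continuous_intros)
qed

text \<open>Along the segment towards the squared moduli of \<open>z\<close> every slack is a convex
  combination of its values at both ends, so it stays positive where required. The coordinates in
  \<open>A\<close> can be shrunk to 0 because those of \<open>z\<close> vanish.\<close>

lemma contractible_D: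
  assumes z: "z \<in> stratum (K \<union> A)" and A: "A \<subseteq> B"
  shows "contractible (D A A)"
proof (rule contractibleI)
  \<comment> \<open>The factor \<open>sqrt (1 - t)\<close> on complex coordinates makes their
    squared moduli move affinely; the arguments of the other coordinates shrink linearly to
    0.\<close>
  define h where "h p = mk
     (\<lambda>b. if b \<in> A then sqrt (1 - fst p) * re (snd p) b
          else (1 - fst p) * re (snd p) b + fst p * (cmod (z b))\<^sup>2)
     (\<lambda>b. if b \<in> A then sqrt (1 - fst p) * im (snd p) b else (1 - fst p) * im (snd p) b)"
    for p :: "real \<times> rvec"
  let ?a = "mk (\<lambda>b. if b \<in> A then 0 else (cmod (z b))\<^sup>2) (\<lambda>_. 0)"
  have zZ: "z \<in> Z" "\<And>j. j < d \<Longrightarrow> z j = 0 \<longleftrightarrow> j \<in> K \<union> A"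
    using z unfolding stratum_def by auto
  have zC: "z \<in> Cspace d" using zZ(1) unfolding Z_iff by blast
  have zK: "z k = 0" if "k \<in> K" for k using zZ(2)[of k] that K by blast
  have zsl: "(cmod (z j))\<^sup>2 = c0 j + (\<Sum>b\<in>B. g j b * (cmod (z b))\<^sup>2)" if "j < d" for j
    using Z_iff_slack[OF zC zK] zZ(1) that by blast
  show "h (0, x) = x" if "x \<in> D A A" for x
    by (rule rvec_eqI[OF _ D_Rspace[OF that]]) (auto simp: h_def)
  show "h (1, x) = ?a" if "x \<in> D A A" for x
    by (rule rvec_eqI) (auto simp: h_def)
  show "h (t, x) \<in> D A A" if t: "t \<in> {0..1}" and x: "x \<in> D A A" for t x
  proof -
    have sqh: "sq A (h (t, x)) b = (1 - t) * sq A x b + t * (cmod (z b))\<^sup>2" if b: "b \<in> B" for b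
    proof (cases "b \<in> A")
      case True
      have "z b = 0" using zZ(2)[OF Bd[OF b]] True by blast
      then show ?thesis
        using True b t unfolding sq_def h_def by (simp add: power_mult_distrib distrib_left)
    qed (use b in \<open>simp add: sq_def h_def\<close>)
    have sl: "slack A (h (t, x)) j = (1 - t) * slack A x j + t * (cmod (z j))\<^sup>2" if j: "j < d" for j
    proof -
      have "(\<Sum>b\<in>B. g j b * sq A (h (t, x)) b)
        = (\<Sum>b\<in>B. (1 - t) * (g j b * sq A x b) + t * (g j b * (cmod (z b))\<^sup>2))"
        by (intro sum.cong refl) (simp add: sqh algebra_simps)
      also have "\<dots> = (1 - t) * (\<Sum>b\<in>B. g j b * sq A x b) + t * (\<Sum>b\<in>B. g j b * (cmod (z b))\<^sup>2)"
        by (simp add: sum.distrib sum_distrib_left)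
      finally show ?thesis
        unfolding zsl[OF j] slack_def by (simp add: algebra_simps)
    qed
    have "slack A (h (t, x)) j > 0" if j: "j \<in> {..<d} - K - A" for j
    proof -
      have jd: "j < d" "j \<notin> K" "j \<notin> A" using j by auto
      have p: "slack A x j > 0" using D_pos[OF x jd] .
      have q: "(cmod (z j))\<^sup>2 > 0" using zZ(2)[OF jd(1)] jd by simp
      show ?thesis
      proof (cases "t = 0")
        case True
        then show ?thesis using p sl[OF jd(1)] by simp
      next
        case False
        then have "t * (cmod (z j))\<^sup>2 > 0" using t q by simp
        moreover have "(1 - t) * slack A x j \<ge> 0" using t p by simp
        ultimately show ?thesis unfolding sl[OF jd(1)] by linarith
      qed
    qed
    then show ?thesis unfolding D_def by (simp add: h_def)
  qed
  show "continuous_on ({0..1} \<times> D A A) h"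
    unfolding h_def[abs_def]
  proof (rule continuous_on_mk)
    have r: "continuous_on S (\<lambda>p. re (snd p) b)" and i: "continuous_on S (\<lambda>p. im (snd p) b)"
      for S :: "(real \<times> rvec) set" and b
      by (rule continuous_on_compose2[OF continuous_on_re[of UNIV] continuous_on_snd[OF continuous_on_id]]; simp)
         (rule continuous_on_compose2[OF continuous_on_im[of UNIV] continuous_on_snd[OF continuous_on_id]]; simp)
    fix b
    show "continuous_on ({0..1} \<times> D A A) (\<lambda>p. if b \<in> A then sqrt (1 - fst p) * re (snd p) b
          else (1 - fst p) * re (snd p) b + fst p * (cmod (z b))\<^sup>2)"
      by (cases "b \<in> A") (auto intro!: continuous_intros r)
    show "continuous_on ({0..1} \<times> D A A)
        (\<lambda>p. if b \<in> A then sqrt (1 - fst p) * im (snd p) b else (1 - fst p) * im (snd p) b)"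
      by (cases "b \<in> A") (auto intro!: continuous_intros i)
  qed
qed

text \<open>Since the \<open>X b\<close>, \<open>b \<in> I\<close>, are independent modulo the \<open>X k\<close>, \<open>k \<in> K\<close>, the polytope is
  simple in the directions of \<open>I\<close> near a point of the face: all smaller index sets occur.\<close>

lemma stratum_nonempty_smaller:
  assumes z: "z \<in> stratum (K \<union> I)" and I: "I \<subseteq> B" and A: "A \<subseteq> I"
  shows "stratum (K \<union> A) \<noteq> {}"
proof -
  have zZ: "z \<in> Z" "\<And>j. j < d \<Longrightarrow> z j = 0 \<longleftrightarrow> j \<in> K \<union> I"
    using z unfolding stratum_def by auto
  have zC: "z \<in> Cspace d" using zZ(1) unfolding Z_iff by blast
  have zK: "z k = 0" if "k \<in> K" for k using zZ(2)[of k] that K by blast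
  have zsl: "(cmod (z j))\<^sup>2 = c0 j + (\<Sum>b\<in>B. g j b * (cmod (z b))\<^sup>2)" if "j < d" for j
    using Z_iff_slack[OF zC zK] zZ(1) that by blast
  let ?J = "{..<d} - K - I"
  have "(cmod (z j))\<^sup>2 > 0" if "j \<in> ?J" for j using zZ(2)[of j] that by simp
  then obtain e where e: "e > 0"
    "\<And>j. j \<in> ?J \<Longrightarrow> (cmod (z j))\<^sup>2 + e * (\<Sum>b\<in>I - A. g j b) > 0"
    using perturb_positive[of ?J "\<lambda>j. (cmod (z j))\<^sup>2" "\<lambda>j. \<Sum>b\<in>I - A. g j b"] by auto
  \<comment> \<open>These are the squared moduli after moving the moment value by \<open>e\<close>
    along the dual basis vectors of \<open>I - A\<close>: within \<open>B\<close> exactly the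
    entries in \<open>I - A\<close> grow, and outside \<open>K \<union> I\<close> a small
    \<open>e\<close> preserves positivity.\<close>
  define u where "u j = (cmod (z j))\<^sup>2 + e * (\<Sum>b\<in>I - A. g j b)" for j
  have IA: "(\<Sum>b\<in>I - A. g j b) = (\<Sum>b\<in>B. g j b * (if b \<in> I - A then 1 else 0))" for j
    using I finB by (intro sum.mono_neutral_cong_left) auto
  have uB: "u b = (cmod (z b))\<^sup>2 + (if b \<in> I - A then e else 0)" if "b \<in> B" for b
    unfolding u_def IA sum_g_basis[OF that] by simp
  have uK: "u k = 0" if "k \<in> K" for k
    unfolding u_def IA using zK[OF that] by (simp add: sum_g_K[OF that])
  have unn: "u j \<ge> 0" if j: "j < d" for j
  proof -
    consider "j \<in> K" | "j \<in> I" | "j \<in> ?J" using j by blast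
    then show ?thesis
      by cases (use uK uB e I in \<open>auto simp: u_def less_imp_le\<close>)
  qed
  define w where "w j = (if j < d then complex_of_real (sqrt (u j)) else 0)" for j
  have cw: "(cmod (w j))\<^sup>2 = u j" if "j < d" for j
    using unn[OF that] that unfolding w_def by simp
  have "w \<in> Cspace d" unfolding Cspace_def w_def by simp
  moreover have "w k = 0" if "k \<in> K" for k using uK[OF that] unfolding w_def by simp
  moreover have "(cmod (w j))\<^sup>2 = c0 j + (\<Sum>b\<in>B. g j b * (cmod (w b))\<^sup>2)" if j: "j < d" for j
  proof -
    have "(\<Sum>b\<in>B. g j b * (cmod (w b))\<^sup>2)
      = (\<Sum>b\<in>B. g j b * (cmod (z b))\<^sup>2 + e * (g j b * (if b \<in> I - A then 1 else 0)))"
      by (intro sum.cong refl) (simp add: cw Bd uB algebra_simps)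
    also have "\<dots> = (\<Sum>b\<in>B. g j b * (cmod (z b))\<^sup>2) + e * (\<Sum>b\<in>I - A. g j b)"
      unfolding IA by (simp only: sum.distrib sum_distrib_left)
    finally show ?thesis unfolding cw[OF j] u_def zsl[OF j] by simp
  qed
  ultimately have "w \<in> Z" using Z_iff_slack by blast
  moreover have "w j = 0 \<longleftrightarrow> j \<in> K \<union> A" if j: "j < d" for j
  proof -
    have w0: "w j = 0 \<longleftrightarrow> u j = 0" using j unfolding w_def by simp
    consider "j \<in> K" | "j \<in> I" "j \<notin> K" | "j \<in> ?J" using j by blast
    then show ?thesis
    proof cases
      case 1
      then show ?thesis using uK w0 by blast
    next
      case 2
      then have "z j = 0" "j \<in> B" using zZ(2)[OF j] I by auto
      then show ?thesis using uB[of j] 2 e(1) w0 by (auto split: if_splits)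
    next
      case 3
      then show ?thesis using e(2)[of j] A w0 unfolding u_def by auto
    qed
  qed
  ultimately have "w \<in> stratum (K \<union> A)" unfolding stratum_def by blast
  then show ?thesis by blast
qed

lemma contractible_D_smaller:
  assumes "stratum (K \<union> I) \<noteq> {}" "I \<subseteq> B" "A \<subseteq> I"
  shows "contractible (D A A)"
proof -
  obtain z where "z \<in> stratum (K \<union> I)" using assms(1) by blast
  from stratum_nonempty_smaller[OF this assms(2,3)] obtain w where "w \<in> stratum (K \<union> A)" by blast
  from contractible_D[OF this] show ?thesis using assms(2,3) by blast
qed

lemma connected_D:
  assumes "stratum (K \<union> I) \<noteq> {}" "I \<subseteq> B" "A \<subseteq> I"
  shows "connected (D I A)"
  unfolding pol_image[OF assms(3,2), symmetric]
  by (intro connected_continuous_image continuous_on_pol contractible_imp_connected'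
      contractible_D_smaller[OF assms])

text \<open>Each vanishing complex coordinate can be made a small positive real at once, while the
  strict inequalities already valid at \<open>x\<close> persist. This supplies density of the free
  points.\<close>

lemma D_dense:
  assumes I: "I \<subseteq> B" "A \<subseteq> I" and x: "x \<in> D I A"
  shows "x \<in> closure (D I {})"
proof -
  \<comment> \<open>Coordinates that are already nonzero are left alone, so the path starts at
    \<open>x\<close> and leaves the zero sets immediately.\<close>
  define \<gamma> where "\<gamma> e = mk (\<lambda>b. if b \<in> I \<and> re x b = 0 \<and> im x b = 0 then e else re x b) (im x)"
    for e :: real
  have cont: "continuous_on UNIV \<gamma>"
    unfolding \<gamma>_def[abs_def]
  proof (rule continuous_on_mk)
    fix b
    show "continuous_on UNIV (\<lambda>e. if b \<in> I \<and> re x b = 0 \<and> im x b = 0 then e else re x b)"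
      by (cases "b \<in> I \<and> re x b = 0 \<and> im x b = 0") auto
  qed simp
  have \<gamma>0: "\<gamma> 0 = x"
    by (rule rvec_eqI[OF _ D_Rspace[OF x]]) (auto simp: \<gamma>_def)
  have ev: "eventually (\<lambda>e. \<forall>j\<in>{..<d} - K - A. slack I (\<gamma> e) j > 0) (at_right 0)"
  proof (rule eventually_ball_finite, simp, rule ballI)
    fix j assume j: "j \<in> {..<d} - K - A"
    have "continuous_on UNIV (\<lambda>e. slack I (\<gamma> e) j)"
      by (rule continuous_on_compose2[OF continuous_on_slack[of UNIV] cont]) simp
    then have "((\<lambda>e. slack I (\<gamma> e) j) \<longlongrightarrow> slack I (\<gamma> 0) j) (at 0)"
      unfolding continuous_on_def by simp
    then have "((\<lambda>e. slack I (\<gamma> e) j) \<longlongrightarrow> slack I (\<gamma> 0) j) (at_right 0)"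
      by (rule tendsto_mono[rotated]) (simp add: at_le)
    moreover have "slack I (\<gamma> 0) j > 0" using D_pos[OF x] j unfolding \<gamma>0 by blast
    ultimately show "eventually (\<lambda>e. slack I (\<gamma> e) j > 0) (at_right 0)"
      by (rule order_tendstoD(1))
  qed
  have "eventually (\<lambda>e. \<gamma> e \<in> D I {}) (at_right 0)"
    using ev eventually_at_right_less[of 0]
  proof eventually_elim
    case (elim e)
    have "slack I (\<gamma> e) j > 0" if j: "j \<in> {..<d} - K" for j
    proof (cases "j \<in> I")
      case True
      then have jB: "j \<in> B" using I(1) by blast
      have "sq I (\<gamma> e) j > 0"
        using True jB elim(2) unfolding sq_def \<gamma>_def
        by (auto simp: sum_power2_gt_zero_iff)
      then show ?thesis by (simp add: slack_basis[OF jB])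
    next
      case False
      then show ?thesis using elim(1) j I(2) by blast
    qed
    then show ?case unfolding D_def by (simp add: \<gamma>_def)
  qed
  from closure_path[OF cont this] show ?thesis unfolding \<gamma>0 .
qed

text \<open>A section of the orbit map up to the action of the torus: the argument of \<open>z j\<close>, divided by
  \<open>2\<pi>\<close>, is measured by the branch \<open>eta \<theta> z j\<close> that is continuous near \<open>\<theta> j\<close>. The vector
  \<open>shift \<theta> z\<close> of the Lie algebra of \<open>N\<close> rotates all the coordinates outside \<open>B\<close> to positive reals.\<close>

definition eta :: "(nat \<Rightarrow> real) \<Rightarrow> (nat \<Rightarrow> complex) \<Rightarrow> nat \<Rightarrow> real" where
  "eta \<theta> z j = \<theta> j + Arg (z j * cis (- (2 * pi * \<theta> j))) / (2 * pi)"

definition shift :: "(nat \<Rightarrow> real) \<Rightarrow> (nat \<Rightarrow> complex) \<Rightarrow> nat \<Rightarrow> real" where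
  "shift \<theta> z j = (if j \<in> B then (\<Sum>i\<in>{..<d} - K - B. eta \<theta> z i * g i j)
     else if j \<in> {..<d} - K then - eta \<theta> z j else 0)"

definition sec :: "nat set \<Rightarrow> (nat \<Rightarrow> real) \<Rightarrow> (nat \<Rightarrow> complex) \<Rightarrow> rvec" where
  "sec I \<theta> z =
     mk (\<lambda>b. if b \<in> I then Re (z b * cis (2 * pi * shift \<theta> z b)) else (cmod (z b))\<^sup>2)
        (\<lambda>b. if b \<in> I then Im (z b * cis (2 * pi * shift \<theta> z b)) else eta \<theta> z b + shift \<theta> z b)"

section \<open>Local sections of the orbit map\<close>

lemma cis_eta: "of_real (cmod (z j)) * cis (2 * pi * eta \<theta> z j) = z j"
proof -
  let ?w = "z j * cis (- (2 * pi * \<theta> j))"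
  have "cmod ?w = cmod (z j)" by (simp add: norm_mult)
  then have w: "of_real (cmod (z j)) * cis (Arg ?w) = ?w"
    using rcis_cmod_Arg[of ?w] by (simp add: rcis_def)
  have "cis (2 * pi * eta \<theta> z j) = cis (Arg ?w) * cis (2 * pi * \<theta> j)"
    by (simp add: eta_def cis_mult distrib_left add.commute)
  then have "of_real (cmod (z j)) * cis (2 * pi * eta \<theta> z j) = ?w * cis (2 * pi * \<theta> j)"
    using w by (simp add: mult.assoc[symmetric])
  also have "\<dots> = z j" by (simp add: mult.assoc cis_mult)
  finally show ?thesis .
qed

text \<open>The entries of \<open>shift\<close> on \<open>B\<close> were chosen to cancel the
  contribution of all the others. Hence rotation by \<open>shift\<close> does not leave the orbit of
  a point that vanishes on \<open>K\<close>.\<close>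

lemma shift_relation: "b \<in> B \<Longrightarrow> (\<Sum>j<d. shift \<theta> z j * g j b) = 0"
  unfolding sum_Gam_split by (simp add: shift_def sum_negf cong: sum.cong_simp)

lemma sec_Rspace [simp]: "sec I \<theta> z \<in> Rspace (2 * m)"
  unfolding sec_def by simp

lemma sq_sec: "b \<in> B \<Longrightarrow> sq I (sec I \<theta> z) b = (cmod (z b))\<^sup>2"
proof -
  assume b: "b \<in> B"
  have "(Re (z b * cis t))\<^sup>2 + (Im (z b * cis t))\<^sup>2 = (cmod (z b))\<^sup>2" for t
    by (simp only: cmod_power2[symmetric]) (simp add: norm_mult)
  then show ?thesis using b unfolding sq_def sec_def by simp
qed

lemma ZS_Cspace: "z \<in> ZS I \<Longrightarrow> z \<in> Cspace d"
  unfolding ZS_def Z_iff by blast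

lemma slack_sec:
  assumes "z \<in> ZS I" "j < d"
  shows "slack I (sec I \<theta> z) j = (cmod (z j))\<^sup>2"
proof -
  have "z k = 0" if "k \<in> K" for k using assms(1) that unfolding ZS_def by blast
  then have "(cmod (z j))\<^sup>2 = c0 j + (\<Sum>b\<in>B. g j b * (cmod (z b))\<^sup>2)"
    using Z_iff_slack[OF ZS_Cspace[OF assms(1)]] assms ZS_subset by blast
  then show ?thesis unfolding slack_def by (simp add: sq_sec cong: sum.cong_simp)
qed

lemma sec_in_D: "z \<in> ZS I \<Longrightarrow> sec I \<theta> z \<in> D I I"
proof -
  assume z: "z \<in> ZS I"
  have "slack I (sec I \<theta> z) j > 0" if j: "j \<in> {..<d} - K - I" for j
  proof -
    have "z j \<noteq> 0" using z j unfolding ZS_def by blast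
    then show ?thesis using slack_sec[OF z, of j] j by simp
  qed
  then show ?thesis unfolding D_def by simp
qed

lemma param_sec:
  assumes z: "z \<in> ZS I" and I: "I \<subseteq> B"
  shows "param I (sec I \<theta> z) = rot (shift \<theta> z) z"
proof
  fix j
  consider "j \<in> I" | "j \<in> B" "j \<notin> I" | "j \<in> {..<d} - K - B" | "j \<in> K" | "j \<ge> d"
    by (metis Diff_iff lessThan_iff not_less)
  then show "param I (sec I \<theta> z) j = rot (shift \<theta> z) z j"
  proof cases
    case 1
    then have "j \<in> B" using I by blast
    with 1 show ?thesis by (simp add: param_def rot_def sec_def complex_eq_iff algebra_simps)
  next
    case 2
    have "param I (sec I \<theta> z) j
        = of_real (cmod (z j)) * cis (2 * pi * eta \<theta> z j) * cis (2 * pi * shift \<theta> z j)"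
      using 2 by (simp add: param_def sec_def cis_mult distrib_left mult.assoc)
    also have "\<dots> = rot (shift \<theta> z) z j" unfolding cis_eta by (simp add: rot_def mult.commute)
    finally show ?thesis .
  next
    case 3
    then have j: "j \<notin> I" "j \<notin> B" "j < d" using I by auto
    have "rot (shift \<theta> z) z j = cis (- (2 * pi * eta \<theta> z j)) * (of_real (cmod (z j)) * cis (2 * pi * eta \<theta> z j))"
      unfolding cis_eta using 3 by (simp add: rot_def shift_def)
    also have "\<dots> = of_real (cmod (z j))" by (simp add: cis_mult mult.left_commute)
    finally show ?thesis using j by (simp add: param_def slack_sec[OF z])
  next
    case 4
    then have "z j = 0" using z unfolding ZS_def by blast
    then show ?thesis using param_K[OF I 4] by simp
  next
    case 5
    then have "z j = 0" using ZS_Cspace[OF z] unfolding Cspace_def by blast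
    moreover have "param I (sec I \<theta> z) j = 0" using param_Cspace[OF I] 5 unfolding Cspace_def by blast
    ultimately show ?thesis by simp
  qed
qed

lemma orbN_param_sec:
  assumes z: "z \<in> ZS I" and I: "I \<subseteq> B"
  shows "orbN (param I (sec I \<theta> z)) = orbN z"
proof -
  have zK: "z k = 0" if "k \<in> K" for k using z that unfolding ZS_def by blast
  have "(\<lambda>b. \<Sum>j<d. shift \<theta> z j * g j b) \<in> Gam K B"
    by (rule Gam_cong[OF Gam_zero]) (simp add: shift_relation)
  then have "orbN z = orbN (rot (shift \<theta> z) z)"
    using orbN_eq_iff_adapted[OF ad K ZS_Cspace[OF z] zK] by blast
  then show ?thesis unfolding param_sec[OF z I] by simp
qed

text \<open>With branches centred at the arguments of \<open>a\<close> itself, every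
  \<open>Arg\<close> that enters is that of a positive real and is 0. So the section returns
  \<open>a\<close>, not merely a point of its orbit.\<close>

lemma sec_param:
  assumes a: "a \<in> D I I" and I: "I \<subseteq> B"
  shows "sec I (\<lambda>j. if j \<in> B - I then im a j else 0) (param I a) = a"
proof -
  let ?\<theta> = "\<lambda>j. if j \<in> B - I then im a j else 0"
  have pos: "slack I a j > 0" if "j \<in> {..<d} - K - I" for j
    using D_pos[OF a] that by blast
  have e0: "eta ?\<theta> (param I a) j = 0" if "j \<in> {..<d} - K - B" for j
  proof -
    have "j \<notin> I" "j \<notin> B" "j < d" "slack I a j > 0" using that I pos[of j] by auto
    then show ?thesis by (simp add: eta_def param_def Arg_of_real)
  qed
  have s0: "shift ?\<theta> (param I a) b = 0" if "b \<in> B" for b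
    using that e0 by (simp add: shift_def cong: sum.cong_simp)
  have eb: "eta ?\<theta> (param I a) b = im a b" if b: "b \<in> B" "b \<notin> I" for b
  proof -
    have "param I a b * cis (- (2 * pi * im a b)) = of_real (sqrt (re a b))"
      using b by (simp add: param_def mult.assoc cis_mult)
    then show ?thesis
      using b D_re_pos[OF a b order_refl] by (simp add: eta_def Arg_of_real)
  qed
  show ?thesis
  proof (rule rvec_eqI[OF sec_Rspace D_Rspace[OF a]])
    fix b assume b: "b \<in> B"
    have "(cmod (param I a b))\<^sup>2 = re a b" if "b \<notin> I"
      using cmod_param[OF a I Bd[OF b]] that by (simp add: slack_basis[OF b] sq_def)
    then show "re (sec I ?\<theta> (param I a)) b = re a b"
      using b s0[OF b] unfolding sec_def by (simp add: param_def)
    show "im (sec I ?\<theta> (param I a)) b = im a b"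
      using b s0[OF b] eb[OF b] unfolding sec_def by (simp add: param_def)
  qed
qed

text \<open>Open half-planes around the chosen directions keep \<open>Arg\<close> away from its
  cut.\<close>

definition branch_domain :: "nat set \<Rightarrow> (nat \<Rightarrow> real) \<Rightarrow> (nat \<Rightarrow> complex) set" where
  "branch_domain I \<theta> = {z \<in> ZS I. \<forall>j\<in>{..<d} - K - I. Re (z j * cis (- (2 * pi * \<theta> j))) > 0}"

lemma openin_branch_domain: "openin (top_of_set (ZS I)) (branch_domain I \<theta>)"
proof -
  have o: "open (\<Inter>j\<in>{..<d} - K - I. {z. 0 < Re (z j * cis (- (2 * pi * \<theta> j)))})"
    by (intro open_INT ballI open_Collect_less continuous_intros) simp
  have eq: "branch_domain I \<theta> =
      ZS I \<inter> (\<Inter>j\<in>{..<d} - K - I. {z. 0 < Re (z j * cis (- (2 * pi * \<theta> j)))})"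
    unfolding branch_domain_def by auto
  show ?thesis unfolding eq using o by (rule openin_open_Int)
qed

lemma continuous_on_sec:
  assumes I: "I \<subseteq> B"
  shows "continuous_on (branch_domain I \<theta>) (sec I \<theta>)"
proof -
  have e: "continuous_on (branch_domain I \<theta>) (\<lambda>z. eta \<theta> z j)" if j: "j \<in> {..<d} - K - I" for j
  proof -
    have "z j * cis (- (2 * pi * \<theta> j)) \<notin> \<real>\<^sub>\<le>\<^sub>0" if "z \<in> branch_domain I \<theta>" for z
    proof
      assume "z j * cis (- (2 * pi * \<theta> j)) \<in> \<real>\<^sub>\<le>\<^sub>0"
      then have "Re (z j * cis (- (2 * pi * \<theta> j))) \<le> 0"
        by (simp add: complex_nonpos_Reals_iff)
      with that j show False unfolding branch_domain_def by force
    qed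
    then show ?thesis unfolding eta_def by (intro continuous_intros) auto
  qed
  have s: "continuous_on (branch_domain I \<theta>) (\<lambda>z. shift \<theta> z b)" if b: "b \<in> B" for b
    unfolding shift_def using b I by (auto intro!: continuous_intros e)
  show ?thesis
    unfolding sec_def[abs_def]
  proof (rule continuous_on_mk)
    fix b assume b: "b \<in> B"
    have b': "b \<in> {..<d} - K - I" if "b \<notin> I" using b that Bd BK by auto
    show "continuous_on (branch_domain I \<theta>)
        (\<lambda>z. if b \<in> I then Re (z b * cis (2 * pi * shift \<theta> z b)) else (cmod (z b))\<^sup>2)"
      by (cases "b \<in> I") (auto intro!: continuous_intros s b)
    show "continuous_on (branch_domain I \<theta>)
        (\<lambda>z. if b \<in> I then Im (z b * cis (2 * pi * shift \<theta> z b)) else eta \<theta> z b + shift \<theta> z b)"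
    proof (cases "b \<in> I")
      case True
      then show ?thesis by (auto intro!: continuous_intros s b)
    next
      case False
      then show ?thesis by (simp, intro continuous_intros s b e b')
    qed
  qed
qed

lemma continuous_on_param: "continuous_on S (param I)"
proof (rule continuous_on_coordinatewise_then_product)
  fix j
  have c: "continuous_on S (\<lambda>x. Complex (re x j) (im x j))"
    unfolding complex_eq by (intro continuous_intros)
  show "continuous_on S (\<lambda>x. param I x j)"
    unfolding param_def
    by (cases "j \<in> I"; cases "j \<in> B"; cases "j < d") (auto intro!: continuous_intros c)
qed

lemma param_in_branch_domain:
  assumes a: "a \<in> D I I" and I: "I \<subseteq> B"
  shows "param I a \<in> branch_domain I (\<lambda>j. if j \<in> B - I then im a j else 0)"
proof -
  have "Re (param I a j * cis (- (2 * pi * (if j \<in> B - I then im a j else 0)))) > 0"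
    if j: "j \<in> {..<d} - K - I" for j
  proof (cases "j \<in> B")
    case True
    then have "j \<notin> I" using j by blast
    moreover have "param I a j * cis (- (2 * pi * im a j)) = of_real (sqrt (re a j))"
      using True \<open>j \<notin> I\<close> by (simp add: param_def mult.assoc cis_mult)
    ultimately show ?thesis using True D_re_pos[OF a True _ order_refl] by simp
  next
    case False
    then show ?thesis using j I D_pos[OF a, of j] by (simp add: param_def)
  qed
  then show ?thesis
    unfolding branch_domain_def using param_ZS_iff[OF a I] a by blast
qed

lemma open_map_ZS:
  "open_map (top_of_set (ZS I)) (subtopology M (orbN ` ZS I)) orbN"
proof -
  have "{z \<in> topspace (top_of_set Z). orbN z \<in> orbN ` ZS I} = ZS I"
    using saturated_preimage[OF ZS_rot ZS_subset] by simp
  from open_map_restriction[OF open_map_orbN this] ZS_subset[of I]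
  show ?thesis by (simp add: subtopology_subtopology inf_absorb2)
qed

text \<open>It suffices that the saturation \<open>T\<close> of the image of \<open>U\<close> is
  open in the level set. A point of \<open>T\<close> is rotated onto some \<open>param I a\<close>
  with \<open>a \<in> U\<close>; nearby points are carried by a continuous branch of the section
  into \<open>U\<close> without leaving their orbits.\<close>

lemma open_map_chart:
  assumes I: "I \<subseteq> B"
  shows "open_map (top_of_set (D I I)) (subtopology M (orbN ` ZS I)) (orbN \<circ> param I)"
  unfolding open_map_def
proof (intro allI impI)
  fix U assume U: "openin (top_of_set (D I I)) U"
  then have UD: "U \<subseteq> D I I" using openin_imp_subset by blast
  define T where "T = {z \<in> ZS I. orbN z \<in> orbN ` param I ` U}"
  have "openin (top_of_set (ZS I)) T"
  proof (subst openin_subopen, rule ballI)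
    fix z assume z: "z \<in> T"
    then obtain a where a: "a \<in> U" "orbN z = orbN (param I a)" unfolding T_def by blast
    then obtain y where y: "y \<in> H" "param I a = rot y z" unfolding orbN_eq_iff by blast
    have aD: "a \<in> D I I" using a(1) UD by blast
    define \<theta> where "\<theta> = (\<lambda>j. if j \<in> B - I then im a j else 0)"
    have pW: "param I a \<in> branch_domain I \<theta>"
      unfolding \<theta>_def by (rule param_in_branch_domain[OF aD I])
    have sa: "sec I \<theta> (param I a) = a" unfolding \<theta>_def by (rule sec_param[OF aD I])
    let ?W = "branch_domain I \<theta> \<inter> sec I \<theta> -` U"
    have "sec I \<theta> \<in> branch_domain I \<theta> \<rightarrow> D I I"
      using sec_in_D unfolding branch_domain_def by blast
    then have "openin (top_of_set (branch_domain I \<theta>)) ?W"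
      using continuous_openin_preimage[OF continuous_on_sec[OF I] _ U] by blast
    then have W: "openin (top_of_set (ZS I)) ?W"
      using openin_branch_domain openin_trans by blast
    have "rot y \<in> ZS I \<rightarrow> ZS I" using ZS_rot[OF y(1)] by blast
    from continuous_openin_preimage[OF continuous_on_rot this W]
    have "openin (top_of_set (ZS I)) (ZS I \<inter> rot y -` ?W)" .
    moreover have "z \<in> ZS I \<inter> rot y -` ?W"
      using z pW sa a(1) unfolding T_def y(2) by auto
    moreover have "ZS I \<inter> rot y -` ?W \<subseteq> T"
    proof
      fix w assume w: "w \<in> ZS I \<inter> rot y -` ?W"
      have "orbN (param I (sec I \<theta> (rot y w))) = orbN (rot y w)"
        using orbN_param_sec[OF ZS_rot[OF y(1)] I] w by blast
      also have "\<dots> = orbN w" by (rule orbN_rot[OF y(1)])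
      finally have "orbN w = orbN (param I (sec I \<theta> (rot y w)))" ..
      then show "w \<in> T" using w unfolding T_def by blast
    qed
    ultimately show "\<exists>T'. openin (top_of_set (ZS I)) T' \<and> z \<in> T' \<and> T' \<subseteq> T" by blast
  qed
  then have "openin (subtopology M (orbN ` ZS I)) (orbN ` T)"
    using open_map_ZS unfolding open_map_def by blast
  moreover have "orbN ` T = (orbN \<circ> param I) ` U"
  proof
    show "(orbN \<circ> param I) ` U \<subseteq> orbN ` T"
    proof
      fix w assume "w \<in> (orbN \<circ> param I) ` U"
      then obtain u where u: "u \<in> U" "w = orbN (param I u)" by auto
      then have "param I u \<in> ZS I" using param_ZS_iff[OF _ I] UD by blast
      then show "w \<in> orbN ` T" using u unfolding T_def by blast
    qed
  qed (auto simp: T_def)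
  ultimately show "openin (subtopology M (orbN ` ZS I)) ((orbN \<circ> param I) ` U)" by simp
qed

lemma param_image:
  assumes I: "I \<subseteq> B" and A: "A \<subseteq> I"
  shows "(orbN \<circ> param I) ` D I A = orbN ` ZS A"
proof
  have DA: "D I A \<subseteq> D I I" using D_mono[OF A] .
  show "(orbN \<circ> param I) ` D I A \<subseteq> orbN ` ZS A"
  proof
    fix w assume "w \<in> (orbN \<circ> param I) ` D I A"
    then obtain u where u: "u \<in> D I A" "w = orbN (param I u)" by auto
    then show "w \<in> orbN ` ZS A" using param_ZS_iff[OF _ I] DA by blast
  qed
  show "orbN ` ZS A \<subseteq> (orbN \<circ> param I) ` D I A"
  proof
    fix w assume "w \<in> orbN ` ZS A"
    then obtain z where z: "z \<in> ZS A" "w = orbN z" by blast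
    have zI: "z \<in> ZS I" using z(1) A unfolding ZS_def by blast
    let ?x = "sec I (\<lambda>_. 0) z"
    have x: "?x \<in> D I I" using sec_in_D[OF zI] .
    have o: "orbN (param I ?x) = orbN z" by (rule orbN_param_sec[OF zI I])
    from o[symmetric] obtain y where "y \<in> H" "param I ?x = rot y z" unfolding orbN_eq_iff by blast
    then have "param I ?x \<in> ZS A" using ZS_rot z(1) by simp
    then have "?x \<in> D I A" using param_ZS_iff[OF x I] by blast
    then show "w \<in> (orbN \<circ> param I) ` D I A"
      unfolding z(2) by (intro image_eqI[where x = ?x]) (simp_all add: o)
  qed
qed

text \<open>Meaningful on orbits only: there the image under \<open>orbN \<circ> param I\<close> is
  a singleton.\<close>

definition chart_map :: "nat set \<Rightarrow> rvec set \<Rightarrow> (nat \<Rightarrow> complex) set" where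
  "chart_map I w = the_elem ((orbN \<circ> param I) ` w)"

lemma chart_map_orb:
  assumes I: "I \<subseteq> B" and x: "x \<in> D I I"
  shows "chart_map I (orb (G I I) x) = orbN (param I x)"
proof -
  have "(orbN \<circ> param I) ` orb (G I I) x = {orbN (param I x)}"
  proof (rule image_eq_singleton)
    show "act I (\<lambda>_. 0) x \<in> orb (G I I) x"
      unfolding orb_G[OF x] using Gam_zero by (rule imageI)
    fix y assume "y \<in> orb (G I I) x"
    then show "(orbN \<circ> param I) y = orbN (param I x)"
      unfolding orb_G[OF x] using orbN_param_act[OF I x] by auto
  qed
  then show ?thesis unfolding chart_map_def by simp
qed

lemma continuous_map_chart:
  assumes I: "I \<subseteq> B"
  shows "continuous_map (top_of_set (D I I)) M (orbN \<circ> param I)"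
proof -
  have "continuous_map (top_of_set (D I I)) (top_of_set Z) (param I)"
    using continuous_on_param param_in_Z[OF _ I] by (auto simp: continuous_map_in_subtopology)
  then show ?thesis using continuous_map_orbN by (rule continuous_map_compose)
qed

lemma homeomorphic_map_chart:
  assumes I: "I \<subseteq> B"
  shows "homeomorphic_map (orbit_space (D I I) (G I I)) (subtopology M (orbN ` ZS I)) (chart_map I)"
proof (rule homeomorphic_map_from_quotient_maps)
  show "quotient_map (top_of_set (D I I)) (orbit_space (D I I) (G I I)) (orb (G I I))"
    unfolding orbit_space_def by (rule quotient_map_quotient_topology)
  show "quotient_map (top_of_set (D I I)) (subtopology M (orbN ` ZS I)) (orbN \<circ> param I)"
  proof (rule continuous_open_imp_quotient_map)
    have "(orbN \<circ> param I) ` D I I \<subseteq> orbN ` ZS I" using param_image[OF I order_refl] by simp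
    then show "continuous_map (top_of_set (D I I)) (subtopology M (orbN ` ZS I)) (orbN \<circ> param I)"
      using continuous_map_chart[OF I] by (auto simp: continuous_map_in_subtopology)
    show "open_map (top_of_set (D I I)) (subtopology M (orbN ` ZS I)) (orbN \<circ> param I)"
      by (rule open_map_chart[OF I])
    have "orbN ` Z \<inter> orbN ` ZS I = orbN ` ZS I" using ZS_subset[of I] by blast
    then show "(orbN \<circ> param I) ` topspace (top_of_set (D I I)) = topspace (subtopology M (orbN ` ZS I))"
      using param_image[OF I order_refl] by (simp add: topspace_M)
  qed
  fix x y assume xy: "x \<in> topspace (top_of_set (D I I))" "y \<in> topspace (top_of_set (D I I))"
  show "orb (G I I) x = orb (G I I) y" if "(orbN \<circ> param I) x = (orbN \<circ> param I) y"
    using orbN_param_imp_act[OF I, of x y] orb_G_eq_iff[of x I I y] xy that by simp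
  show "chart_map I (orb (G I I) x) = (orbN \<circ> param I) x"
    using chart_map_orb[OF I] xy by simp
qed

end

text \<open>\<open>R\<close> and \<open>J\<close> are the components of the point
  \<open>(p, q)\<close> in the frame turned by \<open>\<theta>\<close>. If \<open>R\<close> is
  positive, its angle from the first axis of that frame is \<open>arctan (J / R)\<close>, which,
  unlike \<open>Arg\<close>, is an elementary expression.\<close>

lemma arctan_branch:
  fixes p q \<theta> :: real
  defines "R \<equiv> p * cos \<theta> + q * sin \<theta>" and "J \<equiv> q * cos \<theta> - p * sin \<theta>"
  assumes "R > 0"
  shows "sqrt (p\<^sup>2 + q\<^sup>2) * cos (\<theta> + arctan (J / R)) = p"
    and "sqrt (p\<^sup>2 + q\<^sup>2) * sin (\<theta> + arctan (J / R)) = q"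
proof -
  have cs: "(cos \<theta>)\<^sup>2 + (sin \<theta>)\<^sup>2 = 1" by simp
  have RJ: "R\<^sup>2 + J\<^sup>2 = p\<^sup>2 + q\<^sup>2"
  proof -
    have "R\<^sup>2 + J\<^sup>2 = (p\<^sup>2 + q\<^sup>2) * ((cos \<theta>)\<^sup>2 + (sin \<theta>)\<^sup>2)" unfolding R_def J_def by algebra
    then show ?thesis unfolding cs by simp
  qed
  have "1 + (J / R)\<^sup>2 = (p\<^sup>2 + q\<^sup>2) / R\<^sup>2"
    using assms(3) by (simp add: RJ[symmetric] field_simps)
  define S where "S = sqrt (p\<^sup>2 + q\<^sup>2)"
  have s: "sqrt (1 + (J / R)\<^sup>2) = S / R"
    using \<open>1 + (J / R)\<^sup>2 = (p\<^sup>2 + q\<^sup>2) / R\<^sup>2\<close> assms(3) by (simp add: real_sqrt_divide S_def)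
  have "S > 0"
    unfolding S_def RJ[symmetric] using assms(3) by (simp add: add_pos_nonneg)
  then have "S \<noteq> 0" "R \<noteq> 0" using assms(3) by simp_all
  then have c: "S * cos (arctan (J / R)) = R" and d: "S * sin (arctan (J / R)) = J"
    unfolding cos_arctan sin_arctan s by (simp_all add: divide_simps)
  have "S * cos (\<theta> + u) = (S * cos u) * cos \<theta> - (S * sin u) * sin \<theta>" for u
    by (simp add: cos_add algebra_simps)
  from this[of "arctan (J / R)"]
  have "S * cos (\<theta> + arctan (J / R)) = R * cos \<theta> - J * sin \<theta>" by (simp only: c d)
  also have "\<dots> = p * ((cos \<theta>)\<^sup>2 + (sin \<theta>)\<^sup>2)" unfolding R_def J_def by algebra
  finally show "sqrt (p\<^sup>2 + q\<^sup>2) * cos (\<theta> + arctan (J / R)) = p" unfolding S_def by simp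
  have "S * sin (\<theta> + u) = (S * cos u) * sin \<theta> + (S * sin u) * cos \<theta>" for u
    by (simp add: sin_add algebra_simps)
  from this[of "arctan (J / R)"]
  have "S * sin (\<theta> + arctan (J / R)) = R * sin \<theta> + J * cos \<theta>" by (simp only: c d)
  also have "\<dots> = q * ((cos \<theta>)\<^sup>2 + (sin \<theta>)\<^sup>2)" unfolding R_def J_def by algebra
  finally show "sqrt (p\<^sup>2 + q\<^sup>2) * sin (\<theta> + arctan (J / R)) = q" unfolding S_def by simp
qed

lemma cos_2pi_pos_iff:
  assumes "\<bar>w\<bar> \<le> 1 / 2"
  shows "cos (2 * pi * w) > 0 \<longleftrightarrow> \<bar>w\<bar> < 1 / 4"
proof -
  have c: "cos (2 * pi * w) = cos (2 * pi * \<bar>w\<bar>)" by (cases "w \<ge> 0") auto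
  show ?thesis
  proof
    assume "\<bar>w\<bar> < 1 / 4"
    then have "2 * pi * \<bar>w\<bar> < pi / 2" by (simp add: field_simps)
    then show "cos (2 * pi * w) > 0"
      unfolding c by (intro cos_gt_zero_pi) (auto intro: less_le_trans[of _ 0])
  next
    assume p: "cos (2 * pi * w) > 0"
    show "\<bar>w\<bar> < 1 / 4"
    proof (rule ccontr)
      assume "\<not> \<bar>w\<bar> < 1 / 4"
      then have "cos (pi - 2 * pi * \<bar>w\<bar>) \<ge> 0"
        using assms by (intro cos_ge_zero) (auto simp: field_simps)
      then show False using p unfolding c by simp
    qed
  qed
qed

context frame
begin

section \<open>Charts and overlaps as models and submodels\<close>

lemma elem_fun_act: "elem_fun S (\<lambda>x. act I a x k)"
  unfolding act_def
proof (rule elem_fun_mk)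
  fix b
  show "elem_fun S (\<lambda>x. if b \<in> I then re x b * cos (2 * pi * a b) - im x b * sin (2 * pi * a b) else re x b)"
    by (cases "b \<in> I") (simp_all add: elem_fun_intros elem_fun_re elem_fun_im)
  show "elem_fun S (\<lambda>x. if b \<in> I then re x b * sin (2 * pi * a b) + im x b * cos (2 * pi * a b) else im x b + a b)"
    by (cases "b \<in> I") (simp_all add: elem_fun_intros elem_fun_re elem_fun_im)
qed

lemma act_inverse: "x \<in> Rspace (2 * m) \<Longrightarrow> act I a (act I (\<lambda>b. - a b) x) = x"
  and act_inverse': "x \<in> Rspace (2 * m) \<Longrightarrow> act I (\<lambda>b. - a b) (act I a x) = x"
  unfolding act_act by (simp_all add: act_zero)

lemma act_Bij: "restrict (act I a) (D I A) \<in> Bij (D I A)"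
proof -
  have "bij_betw (act I a) (D I A) (D I A)"
    by (rule bij_betwI[where g = "act I (\<lambda>b. - a b)"])
      (auto simp: act_in_D act_inverse act_inverse' D_Rspace)
  then have "bij_betw (restrict (act I a) (D I A)) (D I A) (D I A)"
    by (subst bij_betw_cong[where g = "act I a"]) auto
  then show ?thesis unfolding Bij_def by simp
qed

lemma subgroup_G: "subgroup (G I A) (BijGroup (D I A))"
proof -
  let ?r = "\<lambda>a. restrict (act I a) (D I A)"
  have mult: "?r a \<otimes>\<^bsub>BijGroup (D I A)\<^esub> ?r a' = ?r (\<lambda>b. a b + a' b)" for a a'
    unfolding BijGroup_def
    using act_Bij[of I a A] act_Bij[of I a' A]
    by (auto simp: compose_def act_act act_in_D restrict_def fun_eq_iff)
  have one: "\<one>\<^bsub>BijGroup (D I A)\<^esub> = ?r (\<lambda>_. 0)"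
    unfolding BijGroup_def by (auto simp: act_zero D_Rspace restrict_def fun_eq_iff)
  have carr: "?r a \<in> carrier (BijGroup (D I A))" for a
    unfolding BijGroup_def using act_Bij by simp
  show ?thesis
  proof (rule group.subgroupI[OF group_BijGroup])
    show "G I A \<subseteq> carrier (BijGroup (D I A))" unfolding G_def using carr by blast
    show "G I A \<noteq> {}" unfolding G_def using Gam_zero by blast
    fix u assume "u \<in> G I A"
    then obtain a where a: "a \<in> Gam K B" "u = ?r a" unfolding G_def by blast
    have "inv\<^bsub>BijGroup (D I A)\<^esub> u = ?r (\<lambda>b. - a b)"
      unfolding a(2)
      by (rule group.inv_equality[OF group_BijGroup _ carr carr]) (simp add: mult one)
    then show "inv\<^bsub>BijGroup (D I A)\<^esub> u \<in> G I A"
      unfolding G_def using Gam_minus[OF a(1)] by blast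
    fix v assume "v \<in> G I A"
    then obtain a' where a': "a' \<in> Gam K B" "v = ?r a'" unfolding G_def by blast
    show "u \<otimes>\<^bsub>BijGroup (D I A)\<^esub> v \<in> G I A"
      unfolding a(2) a'(2) mult G_def using Gam_add[OF a(1) a'(1)] by (rule imageI)
  qed
qed

text \<open>A fixed point with nonvanishing complex coordinates forces their rotations to be
  trivial, and a translation with a fixed point is zero. So the group element is the identity
  everywhere and such points are free.\<close>

lemma act_fixed_point:
  assumes x: "x \<in> D I {}" and I: "I \<subseteq> B" and fp: "act I a x = x" and y: "y \<in> Rspace (2 * m)"
  shows "act I a y = y"
proof (rule rvec_eqI[OF act_Rspace y])
  fix b assume b: "b \<in> B"
  have e: "re (act I a x) b = re x b" "im (act I a x) b = im x b" using fp by simp_all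
  have "re (act I a y) b = re y b \<and> im (act I a y) b = im y b"
  proof (cases "b \<in> I")
    case True
    have "cis (2 * pi * a b) * Complex (re x b) (im x b) = Complex (re x b) (im x b)"
      using e b True unfolding act_def by (simp add: complex_eq_iff algebra_simps)
    moreover have "Complex (re x b) (im x b) \<noteq> 0"
    proof
      assume "Complex (re x b) (im x b) = 0"
      then have "sq I x b = 0" using True unfolding sq_def by (simp add: complex_eq_iff)
      then show False using D_pos[OF x Bd[OF b] BK[OF b]] slack_basis[OF b, of I x] by simp
    qed
    ultimately have "cis (2 * pi * a b) = 1" by simp
    then have "cos (2 * pi * a b) = 1" "sin (2 * pi * a b) = 0"
      by (simp_all add: complex_eq_iff)
    then show ?thesis using b True unfolding act_def by simp
  next
    case False
    then show ?thesis using e b unfolding act_def by simp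
  qed
  then show "re (act I a y) b = re y b" "im (act I a y) b = im y b" by auto
qed

text \<open>The set of free points lies between the connected set \<open>D I {}\<close> and its
  closure, so it is connected and dense, although its exact extent is not computed.\<close>

lemma premodel_D:
  assumes ne: "stratum (K \<union> I) \<noteq> {}" and I: "I \<subseteq> B" and A: "A \<subseteq> I"
  shows "premodel (2 * m) (D I A) (G I A)"
proof -
  let ?F = "free_points (D I A) (G I A)"
  have F1: "D I {} \<subseteq> ?F"
  proof
    fix x assume x: "x \<in> D I {}"
    have xA: "x \<in> D I A" using x D_mono[of "{}" A I] by blast
    have "h = (\<lambda>v\<in>D I A. v)" if h: "h \<in> G I A" "h x = x" for h
    proof -
      obtain a where a: "h = restrict (act I a) (D I A)" using h(1) unfolding G_def by blast
      then have "act I a x = x" using h(2) xA by simp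
      from act_fixed_point[OF x I this] show ?thesis
        unfolding a by (auto simp: restrict_def fun_eq_iff D_Rspace)
    qed
    then show "x \<in> ?F" unfolding free_points_def using xA by blast
  qed
  have F2: "?F \<subseteq> D I A" unfolding free_points_def by blast
  have dense: "D I A \<subseteq> closure (D I {})" using D_dense[OF I A] by blast
  show ?thesis
    unfolding premodel_def
  proof (intro conjI ballI)
    show "openin (Euclidean_space (2 * m)) (D I A)" by (rule openin_D)
    show "connected (D I A)" by (rule connected_D[OF ne I A])
    show "subgroup (G I A) (BijGroup (D I A))" by (rule subgroup_G)
    show "connected ?F"
      by (rule connected_intermediate_closure[OF connected_D[OF ne I empty_subsetI] F1])
        (use F2 dense in blast)
    show "D I A \<subseteq> closure ?F" using dense closure_mono[OF F1] by blast
    fix h assume "h \<in> G I A"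
    then obtain a where a: "h = restrict (act I a) (D I A)" unfolding G_def by blast
    show "smooth_on (2 * m) (D I A) h"
      by (rule smooth_onI[OF openin_D], rule elem_fun.cong[OF elem_fun_act[of _ I a]]) (simp add: a)
  qed
qed

lemma model_D:
  assumes ne: "stratum (K \<union> I) \<noteq> {}" and I: "I \<subseteq> B"
  shows "model (2 * m) (D I I) (G I I)"
  unfolding model_def
  using premodel_D[OF ne I order_refl] contractible_D_smaller[OF ne I order_refl]
    contractible_imp_simply_connected' by blast

lemma restrict_group_G:
  assumes "A \<subseteq> I"
  shows "restrict_group (G I I) (D I A) = G I A"
proof -
  have "restrict (restrict (act I a) (D I I)) (D I A) = restrict (act I a) (D I A)" for a
    using D_mono[OF assms, of I] by (auto simp: restrict_def fun_eq_iff)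
  then show ?thesis unfolding restrict_group_def G_def image_image by simp
qed

definition overlap :: "nat set \<Rightarrow> nat set \<Rightarrow> rvec set set" where
  "overlap I A = {w \<in> orb (G I I) ` D I I. chart_map I w \<in> orbN ` ZS A}"

lemma preimg_overlap:
  assumes I: "I \<subseteq> B" and A: "A \<subseteq> I"
  shows "preimg (D I I) (G I I) (overlap I A) = D I A"
proof -
  have "orbN (param I x) \<in> orbN ` ZS A \<longleftrightarrow> x \<in> D I A" if x: "x \<in> D I I" for x
  proof -
    have "param I x \<in> {z \<in> Z. orbN z \<in> orbN ` ZS A} \<longleftrightarrow> param I x \<in> ZS A"
      using saturated_preimage[OF ZS_rot ZS_subset] by simp
    then show ?thesis using param_in_Z[OF x I] param_ZS_iff[OF x I] by simp
  qed
  then have "orb (G I I) x \<in> overlap I A \<longleftrightarrow> x \<in> D I A" if x: "x \<in> D I I" for x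
    using x imageI[OF x, of "orb (G I I)"]
    unfolding overlap_def mem_Collect_eq chart_map_orb[OF I x] by blast
  then show ?thesis
    unfolding preimg_def using D_mono[OF A, of I] by blast
qed

lemma submodel_overlap:
  assumes ne: "stratum (K \<union> I) \<noteq> {}" and I: "I \<subseteq> B" and A: "A \<subseteq> I"
  shows "submodel (2 * m) (D I I) (G I I) (overlap I A)"
  unfolding submodel_def preimg_overlap[OF I A] restrict_group_G[OF A]
proof
  have "{x \<in> topspace (top_of_set (D I I)). orb (G I I) x \<in> overlap I A} = D I A"
    using preimg_overlap[OF I A] unfolding preimg_def by simp
  moreover have "openin (top_of_set (D I I)) (D I A)"
  proof (rule openin_subset_trans)
    show "openin (top_of_set (Rspace (2 * m))) (D I A)"
      using openin_D unfolding openin_Euclidean_iff' .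
  qed (use D_mono[OF A] D_Rspace in blast)+
  ultimately show "openin (orbit_space (D I I) (G I I)) (overlap I A)"
    unfolding orbit_space_def openin_quotient_topology overlap_def by simp
qed (rule premodel_D[OF assms])

section \<open>Polar coordinates as a covering map\<close>

definition sheet :: "nat set \<Rightarrow> nat set \<Rightarrow> (nat \<Rightarrow> real) \<Rightarrow> rvec set" where
  "sheet I A \<tau> = {x \<in> D A A. \<forall>b\<in>I - A. \<bar>im x b - \<tau> b\<bar> < 1 / 4}"

text \<open>A product of open half-planes. The bound \<open>1 / 4\<close> in \<open>sheet\<close> is
  the matching quarter turn, since arguments are measured in full turns.\<close>

definition sheet_base :: "nat set \<Rightarrow> nat set \<Rightarrow> (nat \<Rightarrow> real) \<Rightarrow> rvec set" where
  "sheet_base I A \<tau> =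
     {y \<in> D I A. \<forall>b\<in>I - A. re y b * cos (2 * pi * \<tau> b) + im y b * sin (2 * pi * \<tau> b) > 0}"

text \<open>The argument is measured from \<open>\<tau> b\<close> by \<open>arctan\<close>, so that
  the local inverse is elementary on the whole half-plane; compare
  \<open>arctan_branch\<close>.\<close>

definition sheet_inv :: "nat set \<Rightarrow> nat set \<Rightarrow> (nat \<Rightarrow> real) \<Rightarrow> rvec \<Rightarrow> rvec" where
  "sheet_inv I A \<tau> y =
     mk (\<lambda>b. if b \<in> I - A then (re y b)\<^sup>2 + (im y b)\<^sup>2 else re y b)
        (\<lambda>b. if b \<in> I - A then
             \<tau> b + arctan ((im y b * cos (2 * pi * \<tau> b) - re y b * sin (2 * pi * \<tau> b))
               / (re y b * cos (2 * pi * \<tau> b) + im y b * sin (2 * pi * \<tau> b))) / (2 * pi)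
           else im y b)"

lemma elem_fun_sheet_inv: "elem_fun (sheet_base I A \<tau>) (\<lambda>y. sheet_inv I A \<tau> y k)"
  unfolding sheet_inv_def
proof (rule elem_fun_mk)
  fix b
  have "elem_fun (sheet_base I A \<tau>) (\<lambda>y. (re y b)\<^sup>2 + (im y b)\<^sup>2)"
    by (intro elem_fun_intros elem_fun_re elem_fun_im)
  then show "elem_fun (sheet_base I A \<tau>) (\<lambda>y. if b \<in> I - A then (re y b)\<^sup>2 + (im y b)\<^sup>2 else re y b)"
    by (cases "b \<in> I - A") (simp_all only: if_True if_False elem_fun_re)
  have ne: "re y b * cos (2 * pi * \<tau> b) + im y b * sin (2 * pi * \<tau> b) \<noteq> 0"
    if "b \<in> I - A" "y \<in> sheet_base I A \<tau>" for y
    using that unfolding sheet_base_def by force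
  have "elem_fun (sheet_base I A \<tau>) (\<lambda>y. \<tau> b +
      arctan ((im y b * cos (2 * pi * \<tau> b) - re y b * sin (2 * pi * \<tau> b))
        / (re y b * cos (2 * pi * \<tau> b) + im y b * sin (2 * pi * \<tau> b))) / (2 * pi))" if "b \<in> I - A"
    by (intro elem_fun.add elem_fun.const elem_fun_divide elem_fun.arctan elem_fun_diff elem_fun.mult
        elem_fun_re elem_fun_im) (use ne that in auto)
  then show "elem_fun (sheet_base I A \<tau>) (\<lambda>y. if b \<in> I - A then \<tau> b +
      arctan ((im y b * cos (2 * pi * \<tau> b) - re y b * sin (2 * pi * \<tau> b))
        / (re y b * cos (2 * pi * \<tau> b) + im y b * sin (2 * pi * \<tau> b))) / (2 * pi) else im y b)"
    by (cases "b \<in> I - A") (simp_all only: if_True if_False elem_fun_im)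
qed

lemma pol_cos_sin:
  assumes "b \<in> B" "b \<in> I - A"
  shows "re (pol I A x) b * cos (2 * pi * t) + im (pol I A x) b * sin (2 * pi * t)
      = sqrt (re x b) * cos (2 * pi * (im x b - t))"
    and "im (pol I A x) b * cos (2 * pi * t) - re (pol I A x) b * sin (2 * pi * t)
      = sqrt (re x b) * sin (2 * pi * (im x b - t))"
  using assms by (simp_all add: right_diff_distrib cos_diff sin_diff algebra_simps)

lemma sheet_inv_pol:
  assumes x: "x \<in> sheet I A \<tau>" and I: "I \<subseteq> B"
  shows "sheet_inv I A \<tau> (pol I A x) = x"
proof -
  have xD: "x \<in> D A A" using x unfolding sheet_def by blast
  show ?thesis
  proof (rule rvec_eqI[OF _ D_Rspace[OF xD]])
    show "sheet_inv I A \<tau> (pol I A x) \<in> Rspace (2 * m)" unfolding sheet_inv_def by simp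
    fix b assume b: "b \<in> B"
    have pos: "re x b > 0" if "b \<in> I - A" using D_re_pos[OF xD b] that by blast
    have "(sqrt (re x b) * cos t)\<^sup>2 + (sqrt (re x b) * sin t)\<^sup>2 = re x b" if "b \<in> I - A" for t
      using pos[OF that] by (simp add: power_mult_distrib flip: distrib_left)
    then show "re (sheet_inv I A \<tau> (pol I A x)) b = re x b"
      using b unfolding sheet_inv_def by simp
    show "im (sheet_inv I A \<tau> (pol I A x)) b = im x b"
    proof (cases "b \<in> I - A")
      case True
      let ?u = "2 * pi * (im x b - \<tau> b)"
      have "\<bar>im x b - \<tau> b\<bar> < 1 / 4" using x True unfolding sheet_def by blast
      then have "2 * pi * \<bar>im x b - \<tau> b\<bar> < pi / 2" by (simp add: field_simps)
      then have "\<bar>?u\<bar> < pi / 2" by (simp add: abs_mult)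
      then have "- (pi / 2) < ?u \<and> ?u < pi / 2" unfolding abs_less_iff by linarith
      then have "arctan (tan ?u) = ?u" using arctan_tan[of ?u] by blast
      moreover have "sqrt (re x b) * sin ?u / (sqrt (re x b) * cos ?u) = tan ?u"
        using pos[OF True] by (simp add: tan_def)
      ultimately have "arctan (sqrt (re x b) * sin ?u / (sqrt (re x b) * cos ?u)) = ?u" by simp
      moreover have "im (sheet_inv I A \<tau> (pol I A x)) b
          = \<tau> b + arctan (sqrt (re x b) * sin ?u / (sqrt (re x b) * cos ?u)) / (2 * pi)"
        unfolding sheet_inv_def im_mk[OF b] pol_cos_sin[OF b True] using True by simp
      ultimately show ?thesis by simp
    next
      case False
      then have "im (sheet_inv I A \<tau> (pol I A x)) b = im (pol I A x) b"
        unfolding sheet_inv_def im_mk[OF b] by (simp only: if_False)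
      also have "\<dots> = im x b" unfolding im_pol[OF b] using False by (simp only: if_False)
      finally show ?thesis .
    qed
  qed
qed

lemma pol_sheet_inv:
  assumes y: "y \<in> sheet_base I A \<tau>" and I: "I \<subseteq> B" and A: "A \<subseteq> I"
  shows "pol I A (sheet_inv I A \<tau> y) = y" and "sheet_inv I A \<tau> y \<in> sheet I A \<tau>"
proof -
  have yD: "y \<in> D I A" using y unfolding sheet_base_def by blast
  show "pol I A (sheet_inv I A \<tau> y) = y"
  proof (rule rvec_eqI[OF pol_Rspace D_Rspace[OF yD]])
    fix b assume b: "b \<in> B"
    have R: "re y b * cos (2 * pi * \<tau> b) + im y b * sin (2 * pi * \<tau> b) > 0" if "b \<in> I - A"
      using y that unfolding sheet_base_def by blast
    have "re (pol I A (sheet_inv I A \<tau> y)) b = re y b \<and> im (pol I A (sheet_inv I A \<tau> y)) b = im y b"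
    proof (cases "b \<in> I - A")
      case True
      then show ?thesis
        using arctan_branch[OF R[OF True]] b unfolding sheet_inv_def by (simp add: distrib_left)
    next
      case False
      then show ?thesis using b unfolding sheet_inv_def by auto
    qed
    then show "re (pol I A (sheet_inv I A \<tau> y)) b = re y b"
      "im (pol I A (sheet_inv I A \<tau> y)) b = im y b" by auto
  qed
  have sl: "slack A (sheet_inv I A \<tau> y) = slack I y"
    by (rule slack_cong) (use A in \<open>auto simp: sq_def sheet_inv_def\<close>)
  have "sheet_inv I A \<tau> y \<in> Rspace (2 * m)" unfolding sheet_inv_def by simp
  then have "sheet_inv I A \<tau> y \<in> D A A" using yD unfolding D_def by (simp add: sl)
  moreover have "\<bar>im (sheet_inv I A \<tau> y) b - \<tau> b\<bar> < 1 / 4" if b: "b \<in> I - A" for b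
  proof -
    have "\<bar>arctan w\<bar> < pi / 2" for w using arctan_bounded[of w] by linarith
    then have "\<bar>arctan w / (2 * pi)\<bar> < 1 / 4" for w by (simp add: field_simps)
    then show ?thesis using b I unfolding sheet_inv_def by (subst im_mk) auto
  qed
  ultimately show "sheet_inv I A \<tau> y \<in> sheet I A \<tau>" unfolding sheet_def by blast
qed

lemma pol_in_sheet_base_iff:
  assumes x: "x \<in> D A A" and I: "I \<subseteq> B" and A: "A \<subseteq> I"
  shows "pol I A x \<in> sheet_base I A \<tau> \<longleftrightarrow> (\<forall>b\<in>I - A. cos (2 * pi * (im x b - \<tau> b)) > 0)"
proof -
  have "re (pol I A x) b * cos (2 * pi * \<tau> b) + im (pol I A x) b * sin (2 * pi * \<tau> b) > 0
      \<longleftrightarrow> cos (2 * pi * (im x b - \<tau> b)) > 0" if b: "b \<in> I - A" for b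
  proof -
    have bB: "b \<in> B" using b I by blast
    have "re x b > 0" using D_re_pos[OF x bB] b by blast
    then show ?thesis unfolding pol_cos_sin[OF bB b] by (simp add: zero_less_mult_iff)
  qed
  then show ?thesis unfolding sheet_base_def using pol_in_D[OF x A] by blast
qed

lemma pol_sheet: "x \<in> sheet I A \<tau> \<Longrightarrow> I \<subseteq> B \<Longrightarrow> A \<subseteq> I \<Longrightarrow> pol I A x \<in> sheet_base I A \<tau>"
proof -
  assume x: "x \<in> sheet I A \<tau>" and I: "I \<subseteq> B" and A: "A \<subseteq> I"
  have "cos (2 * pi * (im x b - \<tau> b)) > 0" if "b \<in> I - A" for b
  proof -
    have "\<bar>im x b - \<tau> b\<bar> < 1 / 4" using x that unfolding sheet_def by blast
    then show ?thesis by (subst cos_2pi_pos_iff) auto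
  qed
  then show ?thesis using x pol_in_sheet_base_iff[OF _ I A] unfolding sheet_def by blast
qed

lemma homeomorphism_sheet:
  assumes I: "I \<subseteq> B" and A: "A \<subseteq> I"
  shows "homeomorphism (sheet I A \<tau>) (sheet_base I A \<tau>) (pol I A) (sheet_inv I A \<tau>)"
proof (rule homeomorphismI)
  show "continuous_on (sheet I A \<tau>) (pol I A)" by (rule continuous_on_pol)
  show "continuous_on (sheet_base I A \<tau>) (sheet_inv I A \<tau>)"
    by (intro continuous_on_coordinatewise_then_product elem_fun_continuous elem_fun_sheet_inv)
qed (use pol_sheet[OF _ I A] pol_sheet_inv[OF _ I A] sheet_inv_pol[OF _ I] in auto)

lemma openin_sheet:
  assumes "I \<subseteq> B"
  shows "openin (top_of_set (D A A)) (sheet I A \<tau>)"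
proof -
  have "finite (I - A)" using assms finB finite_subset by blast
  then have o: "open (\<Inter>b\<in>I - A. {x. \<bar>im x b - \<tau> b\<bar> < 1 / 4})"
    by (intro open_INT ballI open_Collect_less continuous_intros)
  have eq: "sheet I A \<tau> = D A A \<inter> (\<Inter>b\<in>I - A. {x. \<bar>im x b - \<tau> b\<bar> < 1 / 4})"
    unfolding sheet_def by auto
  show ?thesis unfolding eq using o by (rule openin_open_Int)
qed

lemma openin_sheet_base:
  assumes "I \<subseteq> B"
  shows "openin (Euclidean_space (2 * m)) (sheet_base I A \<tau>)"
proof -
  let ?C = "\<Inter>b\<in>I - A. {y. 0 < re y b * cos (2 * pi * \<tau> b) + im y b * sin (2 * pi * \<tau> b)}"
  have "finite (I - A)" using assms finB finite_subset by blast
  then have o: "open ?C"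
    by (intro open_INT ballI open_Collect_less continuous_intros)
  obtain W where W: "open W" "D I A = Rspace (2 * m) \<inter> W"
    using openin_D unfolding openin_Euclidean_iff by blast
  have "sheet_base I A \<tau> = D I A \<inter> ?C" unfolding sheet_base_def by auto
  then have "sheet_base I A \<tau> = Rspace (2 * m) \<inter> (W \<inter> ?C)" unfolding W(2) by (simp only: Int_assoc)
  then show ?thesis unfolding openin_Euclidean_iff using open_Int[OF W(1) o] by blast
qed

lemma sheet_base_periodic:
  assumes "\<And>b. b \<in> I - A \<Longrightarrow> \<tau>' b - \<tau> b \<in> \<int>"
  shows "sheet_base I A \<tau>' = sheet_base I A \<tau>"
proof -
  have "cos (2 * pi * \<tau>' b) = cos (2 * pi * \<tau> b) \<and> sin (2 * pi * \<tau>' b) = sin (2 * pi * \<tau> b)"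
    if "b \<in> I - A" for b
    using cis_2pi_eq_iff[of "\<tau>' b" "\<tau> b"] assms[OF that] by (simp add: complex_eq_iff)
  then show ?thesis unfolding sheet_base_def by (intro Collect_cong) simp
qed

text \<open>A half-plane around the given direction is evenly covered: the sheets above it are the
  slabs centred at the integer translates of the argument, and their width of half a turn keeps them
  apart.\<close>

lemma covering_space_pol:
  assumes I: "I \<subseteq> B" and A: "A \<subseteq> I"
  shows "covering_space (D A A) (pol I A) (D I A)"
proof (rule covering_spaceI)
  show "continuous_on (D A A) (pol I A)" by (rule continuous_on_pol)
  show "pol I A ` D A A = D I A" by (rule pol_image[OF A I])
  fix y assume "y \<in> D I A"
  then obtain x where x: "x \<in> D A A" "y = pol I A x" using pol_image[OF A I] by blast
  let ?T = "sheet_base I A (im x)"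
  \<comment> \<open>Only the values of \<open>\<tau>\<close> on \<open>I - A\<close> matter for a
    sheet. As a set of sheets, \<open>v\<close> identifies all \<open>\<tau>\<close> that agree
    there, which is what disjointness needs.\<close>
  define v where "v = {sheet I A \<tau> | \<tau>. \<forall>b\<in>I - A. \<tau> b - im x b \<in> \<int>}"
  have "x \<in> sheet I A (im x)" using x(1) unfolding sheet_def by simp
  then have y: "y \<in> ?T" unfolding x(2) using pol_sheet I A by blast
  have T: "openin (top_of_set (D I A)) ?T"
  proof (rule openin_subset_trans)
    show "openin (top_of_set (Rspace (2 * m))) ?T"
      using openin_sheet_base[OF I] unfolding openin_Euclidean_iff' .
  qed (use D_Rspace in \<open>auto simp: sheet_base_def\<close>)
  have hom: "homeomorphism (sheet I A \<tau>) ?T (pol I A) (sheet_inv I A \<tau>)"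
    if "\<forall>b\<in>I - A. \<tau> b - im x b \<in> \<int>" for \<tau>
    using homeomorphism_sheet[OF I A, of \<tau>] sheet_base_periodic[of I A \<tau> "im x"] that by simp
  have "\<Union>v = D A A \<inter> pol I A -` ?T"
  proof
    show "\<Union>v \<subseteq> D A A \<inter> pol I A -` ?T"
    proof
      fix w assume "w \<in> \<Union>v"
      then obtain \<tau> where \<tau>: "\<forall>b\<in>I - A. \<tau> b - im x b \<in> \<int>" "w \<in> sheet I A \<tau>"
        unfolding v_def by blast
      then show "w \<in> D A A \<inter> pol I A -` ?T"
        using hom[OF \<tau>(1)] unfolding homeomorphism_def sheet_def by blast
    qed
    show "D A A \<inter> pol I A -` ?T \<subseteq> \<Union>v"
    proof
      fix w assume w: "w \<in> D A A \<inter> pol I A -` ?T"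
      \<comment> \<open>Rounding picks the translate within half a turn of the argument of
        \<open>w\<close>; positivity of the cosine then improves this to a quarter turn.\<close>
      define \<tau> where "\<tau> b = im x b + of_int (round (im w b - im x b))" for b
      have "\<bar>im w b - \<tau> b\<bar> < 1 / 4" if b: "b \<in> I - A" for b
      proof -
        let ?k = "of_int (round (im w b - im x b)) :: real"
        have c: "cos (2 * pi * (im w b - im x b)) > 0"
          using w pol_in_sheet_base_iff[OF _ I A, of w "im x"] b by blast
        have "cis (2 * pi * (im w b - \<tau> b)) = cis (2 * pi * (im w b - im x b))"
          unfolding cis_2pi_eq_iff \<tau>_def by simp
        then have "cos (2 * pi * (im w b - \<tau> b)) > 0" using c by (simp add: complex_eq_iff)
        moreover have "\<bar>im w b - \<tau> b\<bar> \<le> 1 / 2"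
          using of_int_round_abs_le[of "im w b - im x b"] unfolding \<tau>_def by (simp add: abs_minus_commute algebra_simps)
        ultimately show ?thesis using cos_2pi_pos_iff by blast
      qed
      then have "w \<in> sheet I A \<tau>" using w unfolding sheet_def by blast
      moreover have "\<forall>b\<in>I - A. \<tau> b - im x b \<in> \<int>" unfolding \<tau>_def by simp
      ultimately show "w \<in> \<Union>v" unfolding v_def by blast
    qed
  qed
  moreover have "openin (top_of_set (D A A)) u" if "u \<in> v" for u
    using that openin_sheet[OF I] unfolding v_def by blast
  moreover have "pairwise disjnt v"
  proof (rule pairwiseI)
    fix u u' assume "u \<in> v" "u' \<in> v" "u \<noteq> u'"
    then obtain \<tau> \<tau>' where \<tau>: "u = sheet I A \<tau>" "\<forall>b\<in>I - A. \<tau> b - im x b \<in> \<int>"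
      and \<tau>': "u' = sheet I A \<tau>'" "\<forall>b\<in>I - A. \<tau>' b - im x b \<in> \<int>" unfolding v_def by blast
    show "disjnt u u'"
    proof (rule ccontr)
      assume "\<not> disjnt u u'"
      then obtain w where w: "w \<in> sheet I A \<tau>" "w \<in> sheet I A \<tau>'"
        unfolding disjnt_def \<tau>(1) \<tau>'(1) by blast
      have "\<tau> b = \<tau>' b" if b: "b \<in> I - A" for b
      proof -
        have "\<bar>im w b - \<tau> b\<bar> < 1 / 4" "\<bar>im w b - \<tau>' b\<bar> < 1 / 4"
          using w b unfolding sheet_def by blast+
        then have "\<bar>(\<tau> b - im x b) - (\<tau>' b - im x b)\<bar> < 1" by linarith
        with Ints_eq_abs_less1[of "\<tau> b - im x b" "\<tau>' b - im x b"] \<tau>(2) \<tau>'(2) b show ?thesis by auto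
      qed
      then have "u = u'" unfolding \<tau>(1) \<tau>'(1) sheet_def by auto
      with \<open>u \<noteq> u'\<close> show False by simp
    qed
  qed
  moreover have "\<exists>q. homeomorphism u ?T (pol I A) q" if "u \<in> v" for u
    using that hom unfolding v_def by blast
  ultimately show "\<exists>T. y \<in> T \<and> openin (top_of_set (D I A)) T \<and>
      (\<exists>v. \<Union>v = D A A \<inter> pol I A -` T \<and> (\<forall>u\<in>v. openin (top_of_set (D A A)) u) \<and>
        pairwise disjnt v \<and> (\<forall>u\<in>v. \<exists>q. homeomorphism u T (pol I A) q))"
    using y T by (intro exI[where x = ?T] conjI exI[where x = v]) auto
qed

lemma universal_cover_pol:
  assumes "stratum (K \<union> I) \<noteq> {}" "I \<subseteq> B" "A \<subseteq> I"
  shows "universal_cover (D A A) (pol I A) (D I A)"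
  unfolding universal_cover_def
  using covering_space_pol[OF assms(2,3)] contractible_D_smaller[OF assms]
    contractible_imp_simply_connected' by blast

text \<open>Smoothness between covers reduces to an elementary formula upstairs, because the local
  inverses of the covering are elementary as well and the class is closed under composition.\<close>

lemma smooth_cover_map_pol:
  assumes I: "I \<subseteq> B" and A: "A \<subseteq> I"
    and h: "continuous_on (D A A) h" "h ` D A A \<subseteq> C'"
    and q': "\<And>k. elem_fun (D A A) (\<lambda>x. q' (h x) k)"
  shows "smooth_cover_map (2 * m) (D A A) (pol I A) C' q' h"
  unfolding smooth_cover_map_def
proof (intro conjI h ballI)
  fix c assume c: "c \<in> D A A"
  have im: "pol I A ` sheet I A (im c) = sheet_base I A (im c)"
    using homeomorphism_sheet[OF I A] unfolding homeomorphism_def by blast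
  show "\<exists>U s. c \<in> U \<and> openin (top_of_set (D A A)) U \<and> openin (Euclidean_space (2 * m)) (pol I A ` U) \<and>
        homeomorphism U (pol I A ` U) (pol I A) s \<and> smooth_on (2 * m) (pol I A ` U) (\<lambda>y. q' (h (s y)))"
  proof (intro exI conjI)
    show "c \<in> sheet I A (im c)" using c unfolding sheet_def by simp
    show "openin (top_of_set (D A A)) (sheet I A (im c))" by (rule openin_sheet[OF I])
    show "openin (Euclidean_space (2 * m)) (pol I A ` sheet I A (im c))"
      unfolding im by (rule openin_sheet_base[OF I])
    show "homeomorphism (sheet I A (im c)) (pol I A ` sheet I A (im c)) (pol I A) (sheet_inv I A (im c))"
      unfolding im by (rule homeomorphism_sheet[OF I A])
    show "smooth_on (2 * m) (pol I A ` sheet I A (im c)) (\<lambda>y. q' (h (sheet_inv I A (im c) y)))"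
      unfolding im
    proof (rule smooth_onI[OF openin_sheet_base[OF I]])
      fix k
      show "elem_fun (sheet_base I A (im c)) (\<lambda>y. q' (h (sheet_inv I A (im c) y)) k)"
        by (rule elem_fun_compose[OF q' elem_fun_sheet_inv])
          (use pol_sheet_inv(2)[OF _ I A] in \<open>auto simp: sheet_def\<close>)
    qed
  qed
qed

end

section \<open>Change of charts\<close>

context frame
begin

lemma orb_G_restrict: "A \<subseteq> I \<Longrightarrow> x \<in> D I A \<Longrightarrow> orb (G I A) x = orb (G I I) x"
  using D_mono[of A I I] by (simp add: orb_G subset_iff)

lemma overlap_eq:
  assumes I: "I \<subseteq> B" and A: "A \<subseteq> I"
  shows "overlap I A = orb (G I A) ` D I A"
proof -
  have "overlap I A = orb (G I I) ` preimg (D I I) (G I I) (overlap I A)"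
    unfolding preimg_def overlap_def by blast
  also have "\<dots> = orb (G I A) ` D I A"
    unfolding preimg_overlap[OF I A] using orb_G_restrict[OF A] by (intro image_cong) auto
  finally show ?thesis .
qed

lemma inj_on_chart_map: "I \<subseteq> B \<Longrightarrow> inj_on (chart_map I) (orb (G I I) ` D I I)"
  using homeomorphic_map_chart[of I]
  unfolding homeomorphic_map_def orbit_space_def by (simp add: topspace_quotient_topology)

lemma bij_betw_chart_map:
  assumes I: "I \<subseteq> B" and A: "A \<subseteq> I"
  shows "bij_betw (chart_map I) (overlap I A) (orbN ` ZS A)"
proof -
  have "inj_on (chart_map I) (overlap I A)"
    using inj_on_chart_map[OF I] by (rule inj_on_subset) (auto simp: overlap_def)
  moreover have "chart_map I ` overlap I A = orbN ` ZS A"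
  proof -
    have "chart_map I ` overlap I A = (\<lambda>x. chart_map I (orb (G I A) x)) ` D I A"
      unfolding overlap_eq[OF I A] image_image ..
    also have "\<dots> = (\<lambda>x. orbN (param I x)) ` D I A"
      using D_mono[OF A, of I]
      by (intro image_cong) (auto simp: orb_G_restrict[OF A] chart_map_orb[OF I])
    also have "\<dots> = orbN ` ZS A" using param_image[OF I A] by (simp add: comp_def)
    finally show ?thesis .
  qed
  ultimately show ?thesis unfolding bij_betw_def by blast
qed

text \<open>One polar formula for the coordinates inside and outside the basis, with argument 0
  outside; it lets two different bases be compared without further cases.\<close>

lemma param_off:
  assumes x: "x \<in> D A A" and A: "A \<subseteq> B" and j: "j < d" "j \<notin> A"
  shows "param A x j = of_real (sqrt (slack A x j)) * cis (2 * pi * (if j \<in> B then im x j else 0))"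
  using assms by (auto simp: param_def slack_basis sq_def)

lemma elem_fun_pol: "elem_fun (D A A) (\<lambda>x. pol I A x k)"
  unfolding pol_def
proof (rule elem_fun_mk)
  fix b assume b: "b \<in> B"
  have s: "elem_fun (D A A) (\<lambda>x. sqrt (re x b))" if "b \<in> I - A"
    by (rule elem_fun.sqrt[OF elem_fun_re]) (use D_re_pos[OF _ b] that in blast)
  have c: "elem_fun (D A A) (\<lambda>x. sqrt (re x b) * cos (2 * pi * im x b))"
    "elem_fun (D A A) (\<lambda>x. sqrt (re x b) * sin (2 * pi * im x b))" if "b \<in> I - A"
    by (intro elem_fun.mult elem_fun.cos elem_fun.sin elem_fun.const elem_fun_im s that)+
  show "elem_fun (D A A) (\<lambda>x. if b \<in> I - A then sqrt (re x b) * cos (2 * pi * im x b) else re x b)"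
    by (cases "b \<in> I - A") (simp_all only: c if_True if_False elem_fun_re)
  show "elem_fun (D A A) (\<lambda>x. if b \<in> I - A then sqrt (re x b) * sin (2 * pi * im x b) else im x b)"
    by (cases "b \<in> I - A") (simp_all only: c if_True if_False elem_fun_im)
qed

lemma ZS_Int: "ZS I \<inter> ZS J = ZS (I \<inter> J)"
  unfolding ZS_def by auto

lemma orbN_ZS_Int: "orbN ` ZS I \<inter> orbN ` ZS J = orbN ` ZS (I \<inter> J)"
proof
  show "orbN ` ZS I \<inter> orbN ` ZS J \<subseteq> orbN ` ZS (I \<inter> J)"
  proof
    fix w assume w: "w \<in> orbN ` ZS I \<inter> orbN ` ZS J"
    then obtain z where z: "z \<in> ZS I" "w = orbN z" by blast
    then have "z \<in> {z \<in> Z. orbN z \<in> orbN ` ZS J}" using w ZS_subset by blast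
    then have "z \<in> ZS J" using saturated_preimage[OF ZS_rot ZS_subset] by blast
    with z ZS_Int show "w \<in> orbN ` ZS (I \<inter> J)" by blast
  qed
  show "orbN ` ZS (I \<inter> J) \<subseteq> orbN ` ZS I \<inter> orbN ` ZS J"
    using ZS_Int[of I J] by blast
qed

definition chart :: "nat set \<Rightarrow> (nat \<Rightarrow> complex) set qchart" where
  "chart I = (orbN ` ZS I, chart_map I, D I I, G I I)"

lemma is_qchart_chart:
  assumes "stratum (K \<union> I) \<noteq> {}" "I \<subseteq> B" "orbN ` ZS I \<subseteq> S"
    "openin (subtopology M S) (orbN ` ZS I)"
  shows "is_qchart (2 * m) (subtopology M S) (chart I)"
  using assms model_D[OF assms(1,2)] homeomorphic_map_chart[OF assms(2)]
  unfolding is_qchart_def chart_def by (simp add: subtopology_subtopology inf_absorb2)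

end

locale frame_pair =
  F1: frame d X lam Q K B g z0 ix + F2: frame d X lam Q K B' g' z0 ix'
  for d :: nat and X :: "nat \<Rightarrow> 'v::real_normed_vector" and lam Q K B g z0 ix B' g' ix' +
  assumes card_eq: "card B' = card B"
begin

lemma swap: "frame_pair d X lam Q K B' g' z0 ix' B g ix"
  using F1.frame_axioms F2.frame_axioms card_eq
  by (simp add: frame_pair_def frame_pair_axioms_def)

text \<open>The vector \<open>\<Sum>b\<in>B - A. im x b *\<^sub>R X b\<close> has the coordinates \<open>new_arg A x c\<close>, \<open>c \<in> B'\<close>, with respect to
  the new basis; those with \<open>c \<in> A\<close> act on the complex coordinates as rotations.\<close>

definition new_arg :: "nat set \<Rightarrow> rvec \<Rightarrow> nat \<Rightarrow> real" where
  "new_arg A x c = (\<Sum>b\<in>B - A. g' b c * F1.im x b)"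

text \<open>In use \<open>A\<close> lies in both bases, so its complex coordinates are merely
  rotated. For the rest of the new basis the squared modulus is the old slack.\<close>

definition transition :: "nat set \<Rightarrow> rvec \<Rightarrow> rvec" where
  "transition A x = F2.mk
     (\<lambda>c. if c \<in> A then F1.re x c * cos (2 * pi * new_arg A x c) - F1.im x c * sin (2 * pi * new_arg A x c)
          else F1.slack A x c)
     (\<lambda>c. if c \<in> A then F1.re x c * sin (2 * pi * new_arg A x c) + F1.im x c * cos (2 * pi * new_arg A x c)
          else new_arg A x c)"

lemma elem_fun_trans: "elem_fun S (\<lambda>x. transition A x k)"
  unfolding transition_def
proof (rule F2.elem_fun_mk)
  have e: "elem_fun S (\<lambda>x. new_arg A x c)" for c
    unfolding new_arg_def by (intro elem_fun_intros F1.elem_fun_im)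
  fix c
  have "elem_fun S (\<lambda>x. F1.re x c * cos (2 * pi * new_arg A x c) - F1.im x c * sin (2 * pi * new_arg A x c))"
    "elem_fun S (\<lambda>x. F1.re x c * sin (2 * pi * new_arg A x c) + F1.im x c * cos (2 * pi * new_arg A x c))"
    by (intro elem_fun_diff elem_fun.add elem_fun.mult elem_fun.sin elem_fun.cos elem_fun.const
        F1.elem_fun_re F1.elem_fun_im e)+
  then show
    "elem_fun S (\<lambda>x. if c \<in> A then F1.re x c * cos (2 * pi * new_arg A x c) - F1.im x c * sin (2 * pi * new_arg A x c)
          else F1.slack A x c)"
    "elem_fun S (\<lambda>x. if c \<in> A then F1.re x c * sin (2 * pi * new_arg A x c) + F1.im x c * cos (2 * pi * new_arg A x c)
          else new_arg A x c)"
    by (cases "c \<in> A"; simp only: if_True if_False F1.elem_fun_slack e)+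
qed

text \<open>Both sides are the squared modulus of the \<open>j\<close>-th coordinate of
  \<open>param A x\<close>: this point lies on the level set and so satisfies the affine equations
  of the second frame too.\<close>

lemma slack_trans:
  assumes x: "x \<in> F1.D A A" and A: "A \<subseteq> B" and j: "j < d"
  shows "F2.slack A (transition A x) j = F1.slack A x j"
proof -
  have sq: "F2.sq A (transition A x) c = F1.slack A x c" if c: "c \<in> B'" for c
  proof (cases "c \<in> A")
    case True
    then have "c \<in> B" using A by blast
    then show ?thesis
      using True c by (simp add: F2.sq_def transition_def F1.slack_basis F1.sq_def rotation_norm)
  next
    case False
    then show ?thesis using c by (simp add: F2.sq_def transition_def)
  qed
  let ?z = "F1.param A x"
  have "?z \<in> F1.Z" by (rule F1.param_in_Z[OF x A])
  then have "(cmod (?z j))\<^sup>2 = F2.c0 j + (\<Sum>b\<in>B'. g' j b * (cmod (?z b))\<^sup>2)"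
    using F2.Z_iff_slack[OF F1.param_Cspace[OF A] F1.param_K[OF A]] j by blast
  moreover have "(cmod (?z i))\<^sup>2 = F1.slack A x i" if "i < d" for i
    by (rule F1.cmod_param[OF x A that])
  ultimately show ?thesis
    using j unfolding F2.slack_def by (simp add: sq F2.Bd cong: sum.cong_simp)
qed

lemma trans_in_D: "x \<in> F1.D A A \<Longrightarrow> A \<subseteq> B \<Longrightarrow> transition A x \<in> F2.D A A"
proof -
  assume x: "x \<in> F1.D A A" and A: "A \<subseteq> B"
  have "transition A x \<in> Rspace (2 * card B')" unfolding transition_def by simp
  then show ?thesis
    unfolding F2.D_def using F1.D_pos[OF x] slack_trans[OF x A] by auto
qed

lemma new_arg_sum: "b \<in> B \<Longrightarrow> (\<Sum>c\<in>B'. new_arg A x c * g c b) = (\<Sum>l\<in>B - A. F1.im x l * g l b)"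
proof -
  assume b: "b \<in> B"
  have "(\<Sum>c\<in>B'. new_arg A x c * g c b) = (\<Sum>c\<in>B'. \<Sum>l\<in>B - A. g' l c * F1.im x l * g c b)"
    unfolding new_arg_def by (simp add: sum_distrib_right)
  also have "\<dots> = (\<Sum>l\<in>B - A. \<Sum>c\<in>B'. g' l c * F1.im x l * g c b)"
    by (rule sum.swap)
  also have "\<dots> = (\<Sum>l\<in>B - A. F1.im x l * g l b)"
  proof (rule sum.cong[OF refl])
    fix l assume "l \<in> B - A"
    then have "l < d" using F1.Bd by blast
    from adapted_change[OF F1.ad F2.ad this b]
    have "g l b = (\<Sum>c\<in>B'. g' l c * g c b)" .
    then show "(\<Sum>c\<in>B'. g' l c * F1.im x l * g c b) = F1.im x l * g l b"
      by (simp add: sum_distrib_left mult_ac)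
  qed
  finally show ?thesis .
qed

text \<open>The two points differ by the rotation \<open>y\<close>, new arguments minus old ones.
  Both sets of arguments describe one vector modulo the normals in \<open>K\<close>, so
  \<open>y\<close> has zero coordinates in the basis and the orbits coincide.\<close>

lemma orbN_param_trans:
  assumes x: "x \<in> F1.D A A" and A: "A \<subseteq> B" "A \<subseteq> B'"
  shows "F1.orbN (F2.param A (transition A x)) = F1.orbN (F1.param A x)"
proof -
  define y where "y j = (if j \<in> B' then new_arg A x j else 0) - (if j \<in> B - A then F1.im x j else 0)" for j
  have "F2.param A (transition A x) j = rot y (F1.param A x) j" for j
  proof -
    consider "j \<in> A" | "j < d" "j \<notin> A" | "j \<ge> d" by linarith
    then show ?thesis
    proof cases
      case 1
      then have "j \<in> B" "j \<in> B'" using A by auto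
      with 1 show ?thesis
        by (simp add: F2.param_def F1.param_def rot_def y_def transition_def complex_eq_iff algebra_simps)
    next
      case 2
      have im: "F2.im (transition A x) j = new_arg A x j" if "j \<in> B'"
        using that 2 by (simp add: transition_def)
      have "F2.param A (transition A x) j
          = of_real (sqrt (F1.slack A x j)) * cis (2 * pi * (if j \<in> B' then new_arg A x j else 0))"
        using F2.param_off[OF trans_in_D[OF x A(1)] A(2) 2] slack_trans[OF x A(1) 2(1)] im by simp
      also have "cis (2 * pi * (if j \<in> B' then new_arg A x j else 0))
          = cis (2 * pi * (if j \<in> B then F1.im x j else 0)) * cis (2 * pi * y j)"
        using 2(2) by (simp add: y_def cis_mult right_diff_distrib)
      finally show ?thesis
        unfolding rot_def F1.param_off[OF x A(1) 2] by (simp add: mult_ac)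
    next
      case 3
      then have "F2.param A (transition A x) j = 0" "F1.param A x j = 0"
        using F1.param_Cspace[OF A(1)] F2.param_Cspace[OF A(2)] unfolding Cspace_def by blast+
      then show ?thesis by (simp add: rot_def)
    qed
  qed
  then have eq: "F2.param A (transition A x) = rot y (F1.param A x)" by blast
  have "(\<Sum>j<d. y j * g j b) = 0" if b: "b \<in> B" for b
  proof -
    have "(\<Sum>j<d. y j * g j b) = (\<Sum>j<d. (if j \<in> B' then new_arg A x j * g j b else 0))
        - (\<Sum>j<d. (if j \<in> B - A then F1.im x j * g j b else 0))"
      unfolding y_def sum_subtractf[symmetric] by (intro sum.cong) (auto simp: left_diff_distrib)
    also have "(\<Sum>j<d. (if j \<in> B' then new_arg A x j * g j b else 0)) = (\<Sum>j\<in>B'. new_arg A x j * g j b)"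
      using F2.Bd by (intro sum.mono_neutral_cong_right) auto
    also have "(\<Sum>j<d. (if j \<in> B - A then F1.im x j * g j b else 0)) = (\<Sum>j\<in>B - A. F1.im x j * g j b)"
      using F1.Bd by (intro sum.mono_neutral_cong_right) auto
    finally show ?thesis unfolding new_arg_sum[OF b] by simp
  qed
  then have "(\<lambda>b. \<Sum>j<d. y j * g j b) \<in> F1.Gam K B"
    by (intro F1.Gam_cong[OF F1.Gam_zero]) simp
  then have "F1.orbN (F1.param A x) = F1.orbN (rot y (F1.param A x))"
    using F1.orbN_eq_iff_adapted[OF F1.ad F1.K F1.param_Cspace[OF A(1)] F1.param_K[OF A(1)]] by blast
  then show ?thesis unfolding eq ..
qed

end

context frame_pair
begin

interpretation S: frame_pair d X lam Q K B' g' z0 ix' B g ix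
  by (rule swap)

text \<open>The way back omits the terms of the new expansion with index in \<open>A\<close>.
  Re-expanding the rest in the old basis gives the old arguments off \<open>A\<close> and the
  negative angle on \<open>A\<close>, which undoes the rotation there.\<close>

lemma trans_trans:
  assumes x: "x \<in> F1.D A A" and A: "A \<subseteq> B" "A \<subseteq> B'"
  shows "S.transition A (transition A x) = x"
proof (rule F1.rvec_eqI[OF _ F1.D_Rspace[OF x]])
  show "S.transition A (transition A x) \<in> Rspace (2 * card B)" unfolding S.transition_def by simp
  have finA: "finite A" using A(1) F1.finB finite_subset by blast
  have arg: "S.new_arg A (transition A x) b = (if b \<in> A then - new_arg A x b else F1.im x b)"
    if b: "b \<in> B" for b
  proof -
    have "S.new_arg A (transition A x) b = (\<Sum>c\<in>B' - A. new_arg A x c * g c b)"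
      unfolding S.new_arg_def by (intro sum.cong) (auto simp: transition_def)
    also have "\<dots> = (\<Sum>c\<in>B'. new_arg A x c * g c b) - (\<Sum>c\<in>A. new_arg A x c * g c b)"
      using F2.finB A(2) by (rule sum_diff)
    also have "(\<Sum>c\<in>A. new_arg A x c * g c b) = (\<Sum>c\<in>A. if c = b then new_arg A x c else 0)"
      using A(1) b by (intro sum.cong) (auto simp: F1.g_basis)
    also have "\<dots> = (if b \<in> A then new_arg A x b else 0)" using finA by simp
    also have "(\<Sum>c\<in>B'. new_arg A x c * g c b) = (\<Sum>l\<in>B - A. F1.im x l * g l b)"
      by (rule new_arg_sum[OF b])
    also have "\<dots> = (\<Sum>l\<in>B - A. if l = b then F1.im x l else 0)"
      using b by (intro sum.cong) (auto simp: F1.g_basis)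
    also have "\<dots> = (if b \<in> A then 0 else F1.im x b)" using b F1.finB by simp
    finally show ?thesis by simp
  qed
  fix b assume b: "b \<in> B"
  have "F1.re (S.transition A (transition A x)) b = F1.re x b \<and> F1.im (S.transition A (transition A x)) b = F1.im x b"
  proof (cases "b \<in> A")
    case True
    then have bB': "b \<in> B'" using A by blast
    have "(p * cos t - q * sin t) * cos t + (p * sin t + q * cos t) * sin t = p"
      "(p * sin t + q * cos t) * cos t - (p * cos t - q * sin t) * sin t = q" for p q t :: real
    proof -
      have "(p * cos t - q * sin t) * cos t + (p * sin t + q * cos t) * sin t = p * ((cos t)\<^sup>2 + (sin t)\<^sup>2)"
        "(p * sin t + q * cos t) * cos t - (p * cos t - q * sin t) * sin t = q * ((cos t)\<^sup>2 + (sin t)\<^sup>2)"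
        by algebra+
      then show "(p * cos t - q * sin t) * cos t + (p * sin t + q * cos t) * sin t = p"
        "(p * sin t + q * cos t) * cos t - (p * cos t - q * sin t) * sin t = q" by simp_all
    qed
    note rot_back = this[of "F1.re x b" "2 * pi * new_arg A x b" "F1.im x b"]
    show ?thesis
      using rot_back True b bB' arg[OF b] unfolding S.transition_def
      by (simp add: transition_def)
  next
    case False
    have "F2.slack A (transition A x) b = F1.re x b"
      using slack_trans[OF x A(1) F1.Bd[OF b]] False b by (simp add: F1.slack_basis F1.sq_def)
    then show ?thesis using False b arg[OF b] unfolding S.transition_def by simp
  qed
  then show "F1.re (S.transition A (transition A x)) b = F1.re x b" "F1.im (S.transition A (transition A x)) b = F1.im x b"
    by auto
qed

end

context frame_pair
begin

interpretation S: frame_pair d X lam Q K B' g' z0 ix' B g ix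
  by (rule swap)

lemma bij_betw_transition:
  assumes A: "A \<subseteq> B" "A \<subseteq> B'"
  shows "bij_betw (transition A) (F1.D A A) (F2.D A A)"
proof (rule bij_betwI[where g = "S.transition A"])
  show "transition A \<in> F1.D A A \<rightarrow> F2.D A A" using trans_in_D[OF _ A(1)] by blast
  show "S.transition A \<in> F2.D A A \<rightarrow> F1.D A A" using S.trans_in_D[OF _ A(2)] by blast
  show "S.transition A (transition A x) = x" if "x \<in> F1.D A A" for x using trans_trans[OF that A] .
  show "transition A (S.transition A y) = y" if "y \<in> F2.D A A" for y using S.trans_trans[OF that A(2,1)] .
qed

lemma cover_diffeo_trans:
  assumes I: "I \<subseteq> B" "A \<subseteq> I" and I': "I' \<subseteq> B'" "A \<subseteq> I'"
  shows "cover_diffeo (2 * card B) (F1.D A A) (F1.pol I A) (F2.D A A) (F2.pol I' A) (transition A)"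
proof -
  have A: "A \<subseteq> B" "A \<subseteq> B'" using I I' by auto
  have bij: "bij_betw (transition A) (F1.D A A) (F2.D A A)" by (rule bij_betw_transition[OF A])
  have inv: "inv_into (F1.D A A) (transition A) y = S.transition A y" if "y \<in> F2.D A A" for y
    by (rule inv_into_f_eq)
      (use bij S.trans_in_D[OF that A(2)] S.trans_trans[OF that A(2,1)] in
        \<open>auto simp: bij_betw_def\<close>)
  have "smooth_cover_map (2 * card B) (F1.D A A) (F1.pol I A) (F2.D A A) (F2.pol I' A) (transition A)"
  proof (rule F1.smooth_cover_map_pol[OF I])
    show "continuous_on (F1.D A A) (transition A)"
      by (intro continuous_on_coordinatewise_then_product elem_fun_continuous elem_fun_trans)
    show "transition A ` F1.D A A \<subseteq> F2.D A A" using bij unfolding bij_betw_def by blast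
    then show "elem_fun (F1.D A A) (\<lambda>x. F2.pol I' A (transition A x) k)" for k
      by (intro elem_fun_compose[OF F2.elem_fun_pol elem_fun_trans])
  qed
  moreover have "smooth_cover_map (2 * card B') (F2.D A A) (F2.pol I' A) (F1.D A A) (F1.pol I A)
      (inv_into (F1.D A A) (transition A))"
  proof (rule F2.smooth_cover_map_pol[OF I'])
    have "continuous_on (F2.D A A) (S.transition A)"
      by (intro continuous_on_coordinatewise_then_product elem_fun_continuous S.elem_fun_trans)
    then show "continuous_on (F2.D A A) (inv_into (F1.D A A) (transition A))"
      by (subst continuous_on_cong[OF refl inv])
    have im: "S.transition A ` F2.D A A \<subseteq> F1.D A A" using S.trans_in_D[OF _ A(2)] by blast
    then show "inv_into (F1.D A A) (transition A) ` F2.D A A \<subseteq> F1.D A A"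
      using inv by auto
    show "elem_fun (F2.D A A) (\<lambda>y. F1.pol I A (inv_into (F1.D A A) (transition A) y) k)" for k
      by (rule elem_fun.cong[OF elem_fun_compose[OF F1.elem_fun_pol S.elem_fun_trans im]])
        (simp add: inv)
  qed
  ultimately show ?thesis
    unfolding cover_diffeo_def using bij by (simp add: card_eq)
qed

text \<open>Over the overlap both charts have \<open>D A A\<close> of their own frame as universal
  cover, where \<open>A = I \<inter> I'\<close>, and \<open>transition A\<close> is the lift.
  Injectivity of the second chart map reduces commutation with the projections to the equality of
  orbits in \<open>orbN_param_trans\<close>.\<close>

lemma qcompatible_chart:
  assumes ne: "F1.stratum (K \<union> I) \<noteq> {}" "F1.stratum (K \<union> I') \<noteq> {}" and I: "I \<subseteq> B" and I': "I' \<subseteq> B'"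
  shows "qcompatible (2 * card B) (F1.chart I) (F2.chart I')"
proof -
  let ?A = "I \<inter> I'"
  have A: "?A \<subseteq> I" "?A \<subseteq> I'" "?A \<subseteq> B" "?A \<subseteq> B'" using I I' by auto
  have Int: "F1.orbN ` F1.ZS I \<inter> F1.orbN ` F2.ZS I' = F1.orbN ` F1.ZS ?A"
    using F1.orbN_ZS_Int[of I I'] by simp
  have W: "{w \<in> orb (F1.G I I) ` F1.D I I. F1.chart_map I w \<in> F1.orbN ` F1.ZS I \<inter> F1.orbN ` F2.ZS I'}
      = F1.overlap I ?A"
    unfolding Int F1.overlap_def ..
  have W': "{w \<in> orb (F2.G I' I') ` F2.D I' I'. F2.chart_map I' w \<in> F1.orbN ` F1.ZS I \<inter> F1.orbN ` F2.ZS I'}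
      = F2.overlap I' ?A"
    unfolding Int F2.overlap_def ..
  let ?f = "\<lambda>w. inv_into (orb (F2.G I' I') ` F2.D I' I') (F2.chart_map I') (F1.chart_map I w)"
  have inj': "inj_on (F2.chart_map I') (orb (F2.G I' I') ` F2.D I' I')"
    by (rule F2.inj_on_chart_map[OF I'])
  have "model_diffeo (2 * card B) (F1.D I ?A) (F1.G I ?A) (F2.D I' ?A) (F2.G I' ?A) ?f"
    unfolding model_diffeo_def
  proof (intro conjI exI)
    have "bij_betw (inv_into (orb (F2.G I' I') ` F2.D I' I') (F2.chart_map I'))
        (F1.orbN ` F1.ZS ?A) (F2.overlap I' ?A)"
    proof (rule bij_betw_inv_into_subset)
      show "bij_betw (F2.chart_map I') (orb (F2.G I' I') ` F2.D I' I')
          (F2.chart_map I' ` orb (F2.G I' I') ` F2.D I' I')"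
        using inj' by (rule inj_on_imp_bij_betw)
      show "F2.overlap I' ?A \<subseteq> orb (F2.G I' I') ` F2.D I' I'" unfolding F2.overlap_def by blast
      show "F2.chart_map I' ` F2.overlap I' ?A = F1.orbN ` F1.ZS ?A"
        using F2.bij_betw_chart_map[OF I' A(2)] unfolding bij_betw_def by blast
    qed
    from bij_betw_trans[OF F1.bij_betw_chart_map[OF I A(1)] this]
    show "bij_betw ?f (orb (F1.G I ?A) ` F1.D I ?A) (orb (F2.G I' ?A) ` F2.D I' ?A)"
      unfolding F1.overlap_eq[OF I A(1)] F2.overlap_eq[OF I' A(2)] by (simp add: comp_def)
    show "universal_cover (F1.D ?A ?A) (F1.pol I ?A) (F1.D I ?A)"
      by (rule F1.universal_cover_pol[OF ne(1) I A(1)])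
    show "universal_cover (F2.D ?A ?A) (F2.pol I' ?A) (F2.D I' ?A)"
      by (rule F2.universal_cover_pol[OF ne(2) I' A(2)])
    show "cover_diffeo (2 * card B) (F1.D ?A ?A) (F1.pol I ?A) (F2.D ?A ?A) (F2.pol I' ?A) (transition ?A)"
      by (rule cover_diffeo_trans[OF I A(1) I' A(2)])
    show "\<forall>c\<in>F1.D ?A ?A. ?f (orb (F1.G I ?A) (F1.pol I ?A c)) = orb (F2.G I' ?A) (F2.pol I' ?A (transition ?A c))"
    proof
      fix c assume c: "c \<in> F1.D ?A ?A"
      have c': "transition ?A c \<in> F2.D ?A ?A" by (rule trans_in_D[OF c A(3)])
      have p: "F1.pol I ?A c \<in> F1.D I ?A" by (rule F1.pol_in_D[OF c A(1)])
      have p': "F2.pol I' ?A (transition ?A c) \<in> F2.D I' ?A" by (rule F2.pol_in_D[OF c' A(2)])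
      have pI: "F1.pol I ?A c \<in> F1.D I I" using p F1.D_mono[OF A(1)] by blast
      have pI': "F2.pol I' ?A (transition ?A c) \<in> F2.D I' I'" using p' F2.D_mono[OF A(2)] by blast
      have "F1.chart_map I (orb (F1.G I ?A) (F1.pol I ?A c)) = F1.orbN (F1.param ?A c)"
        unfolding F1.orb_G_restrict[OF A(1) p] F1.chart_map_orb[OF I pI] F1.param_pol[OF c A(1) I] ..
      also have "\<dots> = F1.orbN (F2.param ?A (transition ?A c))"
        by (rule orbN_param_trans[OF c A(3,4), symmetric])
      also have "\<dots> = F2.chart_map I' (orb (F2.G I' ?A) (F2.pol I' ?A (transition ?A c)))"
        unfolding F2.orb_G_restrict[OF A(2) p'] F2.chart_map_orb[OF I' pI'] F2.param_pol[OF c' A(2) I'] ..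
      finally have eq: "F1.chart_map I (orb (F1.G I ?A) (F1.pol I ?A c))
        = F2.chart_map I' (orb (F2.G I' ?A) (F2.pol I' ?A (transition ?A c)))" .
      show "?f (orb (F1.G I ?A) (F1.pol I ?A c)) = orb (F2.G I' ?A) (F2.pol I' ?A (transition ?A c))"
        unfolding eq
        by (rule inv_into_f_f[OF inj']) (unfold F2.orb_G_restrict[OF A(2) p'], rule imageI, rule pI')
    qed
  qed
  moreover have "submodel (2 * card B) (F1.D I I) (F1.G I I) (F1.overlap I ?A)"
    by (rule F1.submodel_overlap[OF ne(1) I A(1)])
  moreover have "submodel (2 * card B) (F2.D I' I') (F2.G I' I') (F2.overlap I' ?A)"
    using F2.submodel_overlap[OF ne(2) I' A(2)] by (simp add: card_eq)
  ultimately show ?thesis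
    unfolding qcompatible_def F1.chart_def F2.chart_def split W W' Let_def
      F1.preimg_overlap[OF I A(1)] F2.preimg_overlap[OF I' A(2)]
      F1.restrict_group_G[OF A(1)] F2.restrict_group_G[OF A(2)]
    by blast
qed

end

section \<open>The pieces\<close>

context frame
begin

lemma connectedin_ZS:
  assumes "stratum (K \<union> I) \<noteq> {}" "I \<subseteq> B"
  shows "connectedin M (orbN ` ZS I)"
proof -
  have "connectedin (top_of_set (D I I)) (D I I)"
    using connected_D[OF assms order_refl] by simp
  from connectedin_continuous_map_image[OF continuous_map_chart[OF assms(2)] this]
  show ?thesis unfolding param_image[OF assms(2) order_refl] .
qed

end

context polytope_data
begin

lemma frame_exists:
  assumes "K \<subseteq> {..<d}" "I \<subseteq> {..<d}" "indep_mod X K I" "z0 \<in> Z" "\<And>k. k \<in> K \<Longrightarrow> z0 k = 0"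
  shows "\<exists>B g ix. I \<subseteq> B \<and> frame d X lam Q K B g z0 ix"
proof -
  obtain B g where B: "I \<subseteq> B" "adapted d X K B g"
    using adapted_exists[OF assms(2,3)] by blast
  obtain ix where "bij_betw ix B {..<card B}"
    using ex_bij_betw_finite_nat[OF adapted_finite[OF B(2)]] unfolding atLeast0LessThan by blast
  then have "frame d X lam Q K B g z0 ix"
    using assms B(2) by (intro frame.intro[OF polytope_data_axioms] frame_axioms.intro) auto
  with B(1) show ?thesis by blast
qed

lemma ZS_empty_eq: "frame.ZS d X lam K {} = stratum K" if "frame d X lam Q K B g z0 ix"
proof -
  interpret F: frame d X lam Q K B g z0 ix by (rule that)
  show ?thesis unfolding F.ZS_def stratum_def using F.K by auto
qed

lemma quasifold_stratum:
  assumes K: "K \<subseteq> {..<d}" and ne: "stratum K \<noteq> {}"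
  shows "quasifold (2 * affine_dim (open_face_of_index d X lam K)) (subtopology M (orbN ` stratum K))"
    and "connectedin M (orbN ` stratum K)"
proof -
  obtain z0 where z0: "z0 \<in> stratum K" using ne by blast
  have "z0 \<in> Z" "\<And>k. k \<in> K \<Longrightarrow> z0 k = 0" using z0 K unfolding stratum_def by auto
  from frame_exists[OF K empty_subsetI indep_mod_empty this]
  obtain B g ix where fr: "frame d X lam Q K B g z0 ix" by blast
  interpret F: frame d X lam Q K B g z0 ix by (rule fr)
  \<comment> \<open>An atlas requires each chart to be compatible with itself; this is the case of
    two equal frames.\<close>
  interpret P: frame_pair d X lam Q K B g z0 ix B g ix
    by (intro frame_pair.intro fr frame_pair_axioms.intro refl)
  have ZS: "F.ZS {} = stratum K" by (rule ZS_empty_eq[OF fr])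
  have ne': "stratum (K \<union> {}) \<noteq> {}" using ne by simp
  have sub: "orbN ` stratum K \<subseteq> orbN ` Z" unfolding stratum_def by blast
  have top: "topspace (subtopology M (orbN ` stratum K)) = orbN ` stratum K"
    using sub by (simp add: topspace_M inf_absorb2)
  have "is_qchart (2 * card B) (subtopology M (orbN ` stratum K)) (F.chart {})"
  proof (rule F.is_qchart_chart[OF ne' empty_subsetI])
    show "orbN ` F.ZS {} \<subseteq> orbN ` stratum K" unfolding ZS by simp
    show "openin (subtopology M (orbN ` stratum K)) (orbN ` F.ZS {})"
      unfolding ZS using openin_topspace[of "subtopology M (orbN ` stratum K)"] unfolding top .
  qed
  moreover have "qcompatible (2 * card B) (F.chart {}) (F.chart {})"
    by (rule P.qcompatible_chart[OF ne' ne' empty_subsetI empty_subsetI])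
  moreover have "fst (F.chart {}) = orbN ` stratum K" unfolding F.chart_def ZS by simp
  ultimately have "qatlas (2 * card B) (subtopology M (orbN ` stratum K)) {F.chart {}}"
    unfolding qatlas_def top by simp
  then have "quasifold (2 * card B) (subtopology M (orbN ` stratum K))"
    by (rule quasifold_if_qatlas)
  moreover have "affine_dim (open_face_of_index d X lam K) = card B"
    using affine_dim_open_face[OF F.ad sp K fin] ne stratum_empty_iff by blast
  ultimately show "quasifold (2 * affine_dim (open_face_of_index d X lam K)) (subtopology M (orbN ` stratum K))"
    by simp
  show "connectedin M (orbN ` stratum K)"
    using F.connectedin_ZS[OF ne' empty_subsetI] unfolding ZS .
qed

section \<open>The atlas and the connectedness of the regular piece\<close>

definition nonvanishing :: "nat set \<Rightarrow> (nat \<Rightarrow> complex) set" where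
  "nonvanishing I = {z \<in> Z. zeros z \<subseteq> I}"

definition independent_indices :: "nat set set" where
  "independent_indices = {I. I \<subseteq> {..<d} \<and> indep_mod X {} I \<and> stratum I \<noteq> {}}"

lemma openin_nonvanishing: "openin (top_of_set Z) (nonvanishing I)"
proof -
  have o: "open (\<Inter>j\<in>{..<d} - I. {z :: nat \<Rightarrow> complex. z j \<noteq> 0})"
  proof (intro open_INT ballI)
    fix j
    have "closed {z :: nat \<Rightarrow> complex. z j = 0}"
      by (intro closed_Collect_eq continuous_intros)
    then show "open {z :: nat \<Rightarrow> complex. z j \<noteq> 0}" unfolding closed_def by (simp add: Compl_eq)
  qed simp
  have eq: "nonvanishing I = Z \<inter> (\<Inter>j\<in>{..<d} - I. {z. z j \<noteq> 0})"
    unfolding nonvanishing_def zeros_def by auto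
  show ?thesis unfolding eq using o by (rule openin_open_Int)
qed

lemma openin_M_nonvanishing: "openin M (orbN ` nonvanishing I)"
  using open_map_orbN openin_nonvanishing unfolding open_map_def by blast

text \<open>Subsets of independent index sets are independent, so allowing fewer zeros never leaves
  the regular part. This exhibits it as a union of open sets, one for each chart.\<close>

lemma regular_eq_Union: "regular = (\<Union>I\<in>independent_indices. nonvanishing I)"
proof
  show "regular \<subseteq> (\<Union>I\<in>independent_indices. nonvanishing I)"
  proof
    fix z assume z: "z \<in> regular"
    then have "zeros z \<in> independent_indices"
      unfolding regular_def independent_indices_def using zeros_subset stratum_zeros[of z] by auto
    moreover have "z \<in> nonvanishing (zeros z)" using z unfolding regular_def nonvanishing_def by blast
    ultimately show "z \<in> (\<Union>I\<in>independent_indices. nonvanishing I)" by blast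
  qed
  show "(\<Union>I\<in>independent_indices. nonvanishing I) \<subseteq> regular"
  proof (intro UN_least subsetI)
    fix I z assume I: "I \<in> independent_indices" and z: "z \<in> nonvanishing I"
    have "I \<subseteq> {..<d}" "indep_mod X {} I" using I unfolding independent_indices_def by simp_all
    moreover have "zeros z \<subseteq> I" using z unfolding nonvanishing_def by simp
    ultimately have "indep_mod X {} (zeros z)"
      using indep_mod_subset finite_subset[OF \<open>I \<subseteq> {..<d}\<close> finite_lessThan] by blast
    then show "z \<in> regular" using z unfolding regular_def nonvanishing_def by blast
  qed
qed

lemma stratum_interior: "stratum {} \<noteq> {}"
  using interior_face stratum_empty_iff by blast

lemma empty_independent: "{} \<in> independent_indices"
  unfolding independent_indices_def using stratum_interior indep_mod_empty by blast

lemma nonvanishing_empty: "nonvanishing {} = stratum {}"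
  unfolding nonvanishing_def by (auto simp: stratum_iff)

lemma openin_M_regular: "openin M (orbN ` regular)"
  unfolding regular_eq_Union image_UN by (intro openin_Union) (use openin_M_nonvanishing in auto)

lemma quasifold_regular:
  shows "quasifold (2 * dim (UNIV :: 'v set)) (subtopology M (orbN ` regular))"
    and "connectedin M (orbN ` regular)"
proof -
  let ?n = "dim (UNIV :: 'v set)"
  \<comment> \<open>For \<open>K = {}\<close> one base point serves all frames, and a
    \<open>frame_pair\<close> demands that it be shared.\<close>
  obtain z0 where "z0 \<in> stratum {}" using stratum_interior by blast
  then have z0: "z0 \<in> Z" unfolding stratum_def by blast
  have "\<exists>B g ix. I \<subseteq> B \<and> frame d X lam Q {} B g z0 ix" if "I \<in> independent_indices" for I
    using that frame_exists[OF empty_subsetI, of I z0] z0 unfolding independent_indices_def by simp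
  then obtain B g ix where fr: "\<And>I. I \<in> independent_indices \<Longrightarrow> I \<subseteq> B I"
    "\<And>I. I \<in> independent_indices \<Longrightarrow> frame d X lam Q {} (B I) (g I) z0 (ix I)" by metis
  have ne: "stratum ({} \<union> I) \<noteq> {}" if "I \<in> independent_indices" for I
    using that unfolding independent_indices_def by simp
  have card: "card (B I) = ?n" if "I \<in> independent_indices" for I
  proof -
    interpret F: frame d X lam Q "{}" "B I" "g I" z0 "ix I" by (rule fr(2)[OF that])
    show ?thesis
      using adapted_card_eq_iff[OF F.ad sp empty_subsetI fin] indep_mod_empty by simp
  qed
  define ch where "ch I = frame.chart d X lam Q {} (B I) (g I) z0 (ix I) I" for I
  let ?T = "subtopology M (orbN ` regular)"
  have top: "topspace ?T = orbN ` regular"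
    using openin_subset[OF openin_M_regular] by auto
  have ZS: "frame.ZS d X lam {} I = nonvanishing I" if "I \<in> independent_indices" for I
  proof -
    interpret F: frame d X lam Q "{}" "B I" "g I" z0 "ix I" by (rule fr(2)[OF that])
    show ?thesis unfolding F.ZS_def nonvanishing_def zeros_def by auto
  qed
  have chart: "is_qchart (2 * ?n) ?T (ch I) \<and> fst (ch I) = orbN ` nonvanishing I
      \<and> connectedin M (orbN ` nonvanishing I)"
    if I: "I \<in> independent_indices" for I
  proof -
    interpret F: frame d X lam Q "{}" "B I" "g I" z0 "ix I" by (rule fr(2)[OF I])
    have Z: "F.ZS I = nonvanishing I" by (rule ZS[OF I])
    have sub: "orbN ` F.ZS I \<subseteq> orbN ` regular"
      unfolding Z regular_eq_Union using I by blast
    have "openin ?T (orbN ` F.ZS I)"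
      unfolding openin_subtopology
      using openin_M_nonvanishing[of I] sub unfolding Z
      by (intro exI[where x = "orbN ` nonvanishing I"]) auto
    from F.is_qchart_chart[OF ne[OF I] fr(1)[OF I] sub this]
      F.connectedin_ZS[OF ne[OF I] fr(1)[OF I]]
    show ?thesis unfolding ch_def card[OF I] Z by (simp add: F.chart_def Z)
  qed
  have comp: "qcompatible (2 * ?n) (ch I) (ch J)"
    if I: "I \<in> independent_indices" and J: "J \<in> independent_indices" for I J
  proof -
    interpret P: frame_pair d X lam Q "{}" "B I" "g I" z0 "ix I" "B J" "g J" "ix J"
      by (intro frame_pair.intro fr(2) I J frame_pair_axioms.intro) (simp add: card I J)
    show ?thesis
      using P.qcompatible_chart[OF ne[OF I] ne[OF J] fr(1)[OF I] fr(1)[OF J]]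
      unfolding ch_def card[OF I] .
  qed
  have "qatlas (2 * ?n) ?T (ch ` independent_indices)"
    unfolding qatlas_def
  proof (intro conjI ballI)
    show "is_qchart (2 * ?n) ?T a" if "a \<in> ch ` independent_indices" for a
      using that chart by blast
    have "(\<Union>a\<in>ch ` independent_indices. fst a) = (\<Union>I\<in>independent_indices. orbN ` nonvanishing I)"
      using chart by simp
    also have "\<dots> = orbN ` regular" unfolding regular_eq_Union image_UN ..
    finally show "(\<Union>a\<in>ch ` independent_indices. fst a) = topspace ?T" unfolding top .
    show "qcompatible (2 * ?n) a b"
      if "a \<in> ch ` independent_indices" "b \<in> ch ` independent_indices" for a b
      using that comp by blast
  qed
  then show "quasifold (2 * ?n) ?T" by (rule quasifold_if_qatlas)
  \<comment> \<open>The orbits over the interior belong to every chart, so the union of the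
    connected chart images is connected.\<close>
  obtain z1 where z1: "z1 \<in> nonvanishing {}" using stratum_interior unfolding nonvanishing_empty by blast
  have "connectedin M (\<Union>((\<lambda>I. orbN ` nonvanishing I) ` independent_indices))"
  proof (rule connectedin_Union)
    show "connectedin M S" if "S \<in> (\<lambda>I. orbN ` nonvanishing I) ` independent_indices" for S
      using that chart by blast
    have "orbN z1 \<in> orbN ` nonvanishing I" for I
      using z1 unfolding nonvanishing_def by blast
    then show "\<Inter>((\<lambda>I. orbN ` nonvanishing I) ` independent_indices) \<noteq> {}" by blast
  qed
  then show "connectedin M (orbN ` regular)" unfolding regular_eq_Union image_UN .
qed


section \<open>Closures of the pieces\<close>

text \<open>Keep the phases of \<open>z\<close> and move the squared moduli linearly to those of
  \<open>w\<close>. The level set is given by affine equations in the squared moduli, so the path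
  stays in it, and after the start only the coordinates vanishing for both ends vanish.\<close>

lemma orbN_in_closure_of_stratum:
  assumes z: "z \<in> Z" and w: "w \<in> stratum K" and K: "K \<subseteq> zeros z"
  shows "orbN z \<in> M closure_of (orbN ` stratum K)"
proof -
  \<comment> \<open>Where \<open>z\<close> vanishes the phase is set to 1: \<open>sgn 0 = 0\<close>
    would hold the coordinate at zero along the whole path.\<close>
  define ph where "ph j = (if z j = 0 then 1 else sgn (z j))" for j
  define \<gamma> where "\<gamma> e j = of_real (sqrt ((1 - e) * (cmod (z j))\<^sup>2 + e * (cmod (w j))\<^sup>2)) * ph j"
    for e :: real and j
  have wZ: "w \<in> Z" "\<And>j. j < d \<Longrightarrow> w j = 0 \<longleftrightarrow> j \<in> K" using w unfolding stratum_def by auto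
  have ph: "cmod (ph j) = 1" "of_real (cmod (z j)) * ph j = z j" for j
    unfolding ph_def by (auto simp: norm_sgn sgn_div_norm of_real_def)
  have \<gamma>0: "\<gamma> 0 = z" unfolding \<gamma>_def by (auto simp: ph(2))
  have cont: "continuous_on UNIV \<gamma>"
    unfolding \<gamma>_def by (intro continuous_on_coordinatewise_then_product continuous_intros)
  have mem: "\<gamma> e \<in> stratum K" if e: "0 < e" "e < 1" for e
  proof -
    have c: "(cmod (\<gamma> e j))\<^sup>2 = (1 - e) * (cmod (z j))\<^sup>2 + e * (cmod (w j))\<^sup>2" for j
      using e by (simp add: \<gamma>_def norm_mult ph(1))
    have "\<gamma> e \<in> Z"
      unfolding Z_iff
    proof (intro conjI allI impI)
      show "\<gamma> e \<in> Cspace d" using z wZ(1) unfolding Z_iff Cspace_def \<gamma>_def by simp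
      fix x assume x: "(\<Sum>j<d. x j *\<^sub>R X j) = 0"
      have "(\<Sum>j<d. x j * ((cmod (\<gamma> e j))\<^sup>2 + lam j))
          = (\<Sum>j<d. (1 - e) * (x j * ((cmod (z j))\<^sup>2 + lam j)) + e * (x j * ((cmod (w j))\<^sup>2 + lam j)))"
        by (intro sum.cong refl) (simp add: c algebra_simps)
      also have "\<dots> = (1 - e) * (\<Sum>j<d. x j * ((cmod (z j))\<^sup>2 + lam j))
          + e * (\<Sum>j<d. x j * ((cmod (w j))\<^sup>2 + lam j))"
        by (simp only: sum.distrib sum_distrib_left)
      also have "\<dots> = 0" using z wZ(1) x unfolding Z_iff by simp
      finally show "(\<Sum>j<d. x j * ((cmod (\<gamma> e j))\<^sup>2 + lam j)) = 0" .
    qed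
    moreover have "\<gamma> e j = 0 \<longleftrightarrow> j \<in> K" if j: "j < d" for j
    proof -
      have "\<gamma> e j = 0 \<longleftrightarrow> (cmod (\<gamma> e j))\<^sup>2 = 0" by simp
      also have "\<dots> \<longleftrightarrow> z j = 0 \<and> w j = 0"
        unfolding c using e by (subst add_nonneg_eq_0_iff) auto
      also have "\<dots> \<longleftrightarrow> j \<in> K" using wZ(2)[OF j] K unfolding zeros_def by auto
      finally show ?thesis .
    qed
    ultimately show ?thesis unfolding stratum_def by blast
  qed
  have "eventually (\<lambda>e. \<gamma> e \<in> stratum K) (at_right 0)"
    unfolding eventually_at_right_field using mem by (intro exI[where x = 1]) auto
  from closure_path[OF cont this] have "z \<in> closure (stratum K)" unfolding \<gamma>0 .
  moreover have "stratum K \<subseteq> Z" unfolding stratum_def by blast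
  ultimately have "z \<in> (top_of_set Z) closure_of (stratum K)"
    using z by (simp add: closure_of_subtopology inf_absorb2)
  then show ?thesis using continuous_map_image_closure_subset[OF continuous_map_orbN] by blast
qed

lemma closedin_zeros_superset: "closedin (top_of_set Z) {z \<in> Z. \<forall>k\<in>K. z k = 0}"
proof -
  have c: "closed (\<Inter>k\<in>K. {z :: nat \<Rightarrow> complex. z k = 0})"
    by (intro closed_INT ballI closed_Collect_eq) simp_all
  have eq: "{z \<in> Z. \<forall>k\<in>K. z k = 0} = Z \<inter> (\<Inter>k\<in>K. {z. z k = 0})" by auto
  show ?thesis unfolding eq using c by (rule closedin_closed_Int)
qed

lemma closedin_M_zeros: "closedin M (orbN ` {z \<in> Z. \<forall>k\<in>K. z k = 0})"
  by (rule closedin_M_image[OF _ closedin_zeros_superset]) simp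

lemma orbN_closure_of_stratum_imp:
  assumes z: "orbN z \<in> M closure_of (orbN ` stratum K)" "z \<in> Z" and K: "K \<subseteq> {..<d}"
  shows "K \<subseteq> zeros z"
proof -
  have "stratum K \<subseteq> {z \<in> Z. \<forall>k\<in>K. z k = 0}" using K unfolding stratum_def by auto
  then have "M closure_of (orbN ` stratum K) \<subseteq> orbN ` {z \<in> Z. \<forall>k\<in>K. z k = 0}"
    by (intro closure_of_minimal image_mono closedin_M_zeros)
  then have "z \<in> {z \<in> Z. orbN z \<in> orbN ` {z \<in> Z. \<forall>k\<in>K. z k = 0}}" using z by blast
  also have "\<dots> = {z \<in> Z. \<forall>k\<in>K. z k = 0}" by (rule saturated_preimage) auto
  finally show ?thesis using K unfolding zeros_def by auto
qed

lemma orbN_zeros: "orbN z = orbN w \<Longrightarrow> zeros z = zeros w"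
  unfolding orbN_eq_iff by auto

lemma closure_of_stratum_iff:
  assumes K: "K \<subseteq> {..<d}" "K' \<subseteq> {..<d}" and ne: "stratum K \<noteq> {}" "stratum K' \<noteq> {}"
  shows "orbN ` stratum K \<inter> M closure_of (orbN ` stratum K') \<noteq> {} \<longleftrightarrow> K' \<subseteq> K"
    and "orbN ` stratum K \<subseteq> M closure_of (orbN ` stratum K') \<longleftrightarrow> K' \<subseteq> K"
proof -
  have s: "z \<in> Z \<and> zeros z = K" if "z \<in> stratum K" for z using that stratum_iff[OF K(1)] by blast
  have 1: "K' \<subseteq> K" if "orbN ` stratum K \<inter> M closure_of (orbN ` stratum K') \<noteq> {}"
  proof -
    obtain z where "z \<in> stratum K" "orbN z \<in> M closure_of (orbN ` stratum K')" using \<open>orbN ` stratum K \<inter> _ \<noteq> {}\<close> by blast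
    then show ?thesis using orbN_closure_of_stratum_imp[OF _ _ K(2)] s by blast
  qed
  have 2: "orbN ` stratum K \<subseteq> M closure_of (orbN ` stratum K')" if "K' \<subseteq> K"
  proof -
    obtain w where w: "w \<in> stratum K'" using ne(2) by blast
    show ?thesis
    proof (rule image_subsetI)
      fix z assume "z \<in> stratum K"
      then show "orbN z \<in> M closure_of (orbN ` stratum K')"
        using orbN_in_closure_of_stratum[OF _ w, of z] s that by blast
    qed
  qed
  show "orbN ` stratum K \<inter> M closure_of (orbN ` stratum K') \<noteq> {} \<longleftrightarrow> K' \<subseteq> K"
    using 1 2 ne(1) by blast
  show "orbN ` stratum K \<subseteq> M closure_of (orbN ` stratum K') \<longleftrightarrow> K' \<subseteq> K"
    using 1 2 ne(1) by blast
qed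

lemma closure_of_regular: "M closure_of (orbN ` regular) = topspace M"
proof
  show "M closure_of (orbN ` regular) \<subseteq> topspace M" by (rule closure_of_subset_topspace)
  obtain w where w: "w \<in> stratum {}" using stratum_interior by blast
  have "stratum {} \<subseteq> regular"
    using empty_independent unfolding regular_eq_Union nonvanishing_empty[symmetric] by blast
  then have "M closure_of (orbN ` stratum {}) \<subseteq> M closure_of (orbN ` regular)"
    by (intro closure_of_mono image_mono)
  moreover have "topspace M \<subseteq> M closure_of (orbN ` stratum {})"
    unfolding topspace_M using orbN_in_closure_of_stratum[OF _ w] by blast
  ultimately show "topspace M \<subseteq> M closure_of (orbN ` regular)" by blast
qed

text \<open>Having no zeros outside \<open>K\<close> is an open condition, vanishing on
  \<open>K\<close> a closed one.\<close>

lemma locally_closed_stratum: "K \<subseteq> {..<d} \<Longrightarrow> locally_closed_in M (orbN ` stratum K)"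
  unfolding locally_closed_in_def
proof (intro exI conjI)
  assume K: "K \<subseteq> {..<d}"
  show "openin M (orbN ` nonvanishing K)" by (rule openin_M_nonvanishing)
  show "closedin M (orbN ` {z \<in> Z. \<forall>k\<in>K. z k = 0})" by (rule closedin_M_zeros)
  show "orbN ` stratum K = orbN ` nonvanishing K \<inter> orbN ` {z \<in> Z. \<forall>k\<in>K. z k = 0}"
  proof
    show "orbN ` stratum K \<subseteq> orbN ` nonvanishing K \<inter> orbN ` {z \<in> Z. \<forall>k\<in>K. z k = 0}"
      using K unfolding stratum_def nonvanishing_def zeros_def by blast
    show "orbN ` nonvanishing K \<inter> orbN ` {z \<in> Z. \<forall>k\<in>K. z k = 0} \<subseteq> orbN ` stratum K"
    proof
      fix m assume m: "m \<in> orbN ` nonvanishing K \<inter> orbN ` {z \<in> Z. \<forall>k\<in>K. z k = 0}"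
      then obtain z w where zw: "z \<in> nonvanishing K" "m = orbN z" "m = orbN w" "w \<in> Z" "\<forall>k\<in>K. w k = 0"
        by blast
      \<comment> \<open>The two conditions are met by possibly different points of one orbit; the
        vanishing set is an invariant of the orbit.\<close>
      then have "zeros z = zeros w" using orbN_zeros by blast
      moreover have "K \<subseteq> zeros w" using zw(5) K unfolding zeros_def by blast
      ultimately have "z \<in> stratum K" using zw(1) K unfolding nonvanishing_def by (auto simp: stratum_iff)
      then show "m \<in> orbN ` stratum K" using zw(2) by blast
    qed
  qed
qed

text \<open>Equalities valid on a face persist on its closure. Conversely the segment from a point
  of the smaller face to a point of the larger one lies in the larger open face, except for its
  start.\<close>

lemma face_le_iff:
  assumes ne: "open_face_of_index d X lam K \<noteq> {}" "open_face_of_index d X lam K' \<noteq> {}"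
    and K': "K' \<subseteq> {..<d}"
  shows "face_le (open_face_of_index d X lam K) (open_face_of_index d X lam K') \<longleftrightarrow> K' \<subseteq> K"
proof
  assume le: "face_le (open_face_of_index d X lam K) (open_face_of_index d X lam K')"
  obtain \<mu> where \<mu>: "\<mu> \<in> open_face_of_index d X lam K" using ne(1) by blast
  then have "\<mu> \<in> closure (open_face_of_index d X lam K')" using le unfolding face_le_def by blast
  moreover have "closed (\<Inter>k\<in>K'. {\<nu>. blinfun_apply \<nu> (X k) = lam k})"
    by (intro closed_INT ballI closed_Collect_eq continuous_intros)
  moreover have "open_face_of_index d X lam K' \<subseteq> (\<Inter>k\<in>K'. {\<nu>. blinfun_apply \<nu> (X k) = lam k})"
    using K' unfolding mem_open_face subset_iff by auto
  ultimately have "\<mu> \<in> (\<Inter>k\<in>K'. {\<nu>. blinfun_apply \<nu> (X k) = lam k})"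
    using closure_minimal by blast
  then show "K' \<subseteq> K" using \<mu> K' unfolding mem_open_face by auto
next
  assume sub: "K' \<subseteq> K"
  obtain \<nu> where \<nu>: "\<nu> \<in> open_face_of_index d X lam K'" using ne(2) by blast
  show "face_le (open_face_of_index d X lam K) (open_face_of_index d X lam K')"
    unfolding face_le_def
  proof
    fix \<mu> assume \<mu>: "\<mu> \<in> open_face_of_index d X lam K"
    define \<gamma> where "\<gamma> e = (1 - e) *\<^sub>R \<mu> + e *\<^sub>R \<nu>" for e
    have cont: "continuous_on UNIV \<gamma>" unfolding \<gamma>_def by (intro continuous_intros)
    have "\<gamma> e \<in> open_face_of_index d X lam K'" if e: "0 < e" "e < 1" for e
      unfolding mem_open_face
    proof (intro conjI allI impI)
      fix j assume j: "j < d"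
      have val: "blinfun_apply (\<gamma> e) (X j) - lam j
          = (1 - e) * (blinfun_apply \<mu> (X j) - lam j) + e * (blinfun_apply \<nu> (X j) - lam j)"
        by (simp only: \<gamma>_def blinfun.add_left blinfun.scaleR_left) (simp add: algebra_simps)
      have nn: "blinfun_apply \<mu> (X j) - lam j \<ge> 0" "blinfun_apply \<nu> (X j) - lam j \<ge> 0"
        using \<mu> \<nu> j unfolding mem_open_face by auto
      then have nn': "(1 - e) * (blinfun_apply \<mu> (X j) - lam j) \<ge> 0" "e * (blinfun_apply \<nu> (X j) - lam j) \<ge> 0"
        using e by simp_all
      with val show "lam j \<le> blinfun_apply (\<gamma> e) (X j)" by linarith
      have "blinfun_apply (\<gamma> e) (X j) = lam j \<longleftrightarrow> blinfun_apply (\<gamma> e) (X j) - lam j = 0" by simp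
      also have "\<dots> \<longleftrightarrow> blinfun_apply \<mu> (X j) = lam j \<and> blinfun_apply \<nu> (X j) = lam j"
        unfolding val using e by (simp add: add_nonneg_eq_0_iff[OF nn'])
      also have "\<dots> \<longleftrightarrow> j \<in> K'" using \<mu> \<nu> j sub unfolding mem_open_face by auto
      finally show "blinfun_apply (\<gamma> e) (X j) = lam j \<longleftrightarrow> j \<in> K'" .
    qed
    then have "eventually (\<lambda>e. \<gamma> e \<in> open_face_of_index d X lam K') (at_right 0)"
      unfolding eventually_at_right_field by (intro exI[where x = 1]) auto
    from closure_path[OF cont this] show "\<mu> \<in> closure (open_face_of_index d X lam K')"
      unfolding \<gamma>_def by simp
  qed
qed

end

locale polytope_pieces = polytope_data d X lam Q
  for d and X :: "nat \<Rightarrow> 'v::real_normed_vector" and lam and Q +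
  fixes n :: nat
  assumes dim_n: "dim (UNIV :: 'v set) = n"
begin

section \<open>The index set of the pieces and its order\<close>

abbreviation (input) "\<Delta> \<equiv> half_space_intersection d X lam"
abbreviation (input) "face K \<equiv> open_face_of_index d X lam K"

lemma singular_faceE:
  assumes "F \<in> singular_faces n d X lam"
  obtains K where "K \<subseteq> {..<d}" "F = face K" "\<not> indep_mod X {} K" "stratum K \<noteq> {}" "face K \<noteq> {}"
proof -
  have "F \<in> open_faces d X lam" using assms unfolding singular_faces_def by blast
  then obtain K where K: "K \<subseteq> {..<d}" "F = face K" "face K \<noteq> {}" by (rule open_faceE)
  have "\<not> indep_mod X {} K" using face_card_dim(2)[OF sp K(1) fin K(3), unfolded dim_n] assms K(2) by blast
  moreover have "stratum K \<noteq> {}" using K(3) stratum_empty_iff by blast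
  ultimately show ?thesis using that K by blast
qed

text \<open>The closure of \<open>F\<close> would contain the interior face, whose index set is
  empty; then \<open>F\<close> has empty index set as well, and the empty family is
  independent.\<close>

lemma Delta_not_le_singular:
  assumes "F \<in> singular_faces n d X lam"
  shows "\<not> face_le \<Delta> F"
proof
  assume le: "face_le \<Delta> F"
  obtain K where K: "K \<subseteq> {..<d}" "F = face K" "\<not> indep_mod X {} K" "stratum K \<noteq> {}" "face K \<noteq> {}"
    using assms by (rule singular_faceE)
  have "face {} \<subseteq> \<Delta>" unfolding open_face_of_index_def by blast
  then have "face_le (face {}) (face K)" using le unfolding face_le_def K(2) by blast
  then have "K = {}" using face_le_iff[OF interior_face K(5,1)] by blast
  then show False using K(3) by (simp add: indep_mod_empty)
qed

text \<open>This keeps the case distinction in \<open>piece\<close> from assigning the regular piece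
  to a singular face.\<close>

lemma Delta_not_singular: "\<Delta> \<notin> singular_faces n d X lam"
  using Delta_not_le_singular closure_subset unfolding face_le_def by blast

lemma face_le_Delta:
  assumes "F \<in> piece_index n d X lam"
  shows "face_le F \<Delta>"
proof (cases "F = \<Delta>")
  case True
  then show ?thesis unfolding face_le_def using closure_subset by blast
next
  case False
  then have "F \<in> singular_faces n d X lam" using assms unfolding piece_index_def by blast
  then obtain K where "F = face K" by (rule singular_faceE)
  then have "F \<subseteq> \<Delta>" unfolding open_face_of_index_def by blast
  then show ?thesis unfolding face_le_def using closure_subset by blast
qed

lemma piece_Delta: "piece n d X lam Q \<Delta> = orbN ` regular"
  unfolding piece_def by (simp add: regular_piece_eq[unfolded dim_n])

lemma piece_face:
  assumes "face K \<in> singular_faces n d X lam"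
  shows "piece n d X lam Q (face K) = orbN ` stratum K"
proof -
  have "face K \<noteq> \<Delta>" using assms Delta_not_singular by auto
  then show ?thesis unfolding piece_def by (simp add: Phi_preimage_face)
qed

lemma stratum_disjoint_regular:
  assumes "K \<subseteq> {..<d}" "\<not> indep_mod X {} K"
  shows "orbN ` stratum K \<inter> orbN ` regular = {}"
proof (rule ccontr)
  assume "orbN ` stratum K \<inter> orbN ` regular \<noteq> {}"
  then obtain z w where zw: "z \<in> stratum K" "w \<in> regular" "orbN z = orbN w" by blast
  have "zeros w = K" using zw(1) orbN_zeros[OF zw(3)] stratum_iff[OF assms(1)] by simp
  then show False using zw(2) assms(2) unfolding regular_def by simp
qed

lemma stratum_disjoint:
  assumes "K \<subseteq> {..<d}" "K' \<subseteq> {..<d}" "K \<noteq> K'"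
  shows "orbN ` stratum K \<inter> orbN ` stratum K' = {}"
proof (rule ccontr)
  assume "orbN ` stratum K \<inter> orbN ` stratum K' \<noteq> {}"
  then obtain z w where zw: "z \<in> stratum K" "w \<in> stratum K'" "orbN z = orbN w" by blast
  then show False
    using orbN_zeros[OF zw(3)] assms(3) stratum_iff[OF assms(1)] stratum_iff[OF assms(2)] by simp
qed

lemma regular_nonempty: "orbN ` regular \<noteq> {}"
  using stratum_interior empty_independent
  unfolding regular_eq_Union nonvanishing_empty[symmetric] by blast

lemma piece_index_cases:
  assumes "F \<in> piece_index n d X lam"
  obtains "F = \<Delta>" "piece n d X lam Q F = orbN ` regular"
  | K where "F \<in> singular_faces n d X lam" "K \<subseteq> {..<d}" "F = face K" "\<not> indep_mod X {} K"
      "stratum K \<noteq> {}" "face K \<noteq> {}" "piece n d X lam Q F = orbN ` stratum K"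
proof (cases "F = \<Delta>")
  case True
  then show ?thesis using that(1) piece_Delta by blast
next
  case False
  then have s: "F \<in> singular_faces n d X lam" using assms unfolding piece_index_def by blast
  then obtain K where K: "K \<subseteq> {..<d}" "F = face K" "\<not> indep_mod X {} K" "stratum K \<noteq> {}" "face K \<noteq> {}"
    by (rule singular_faceE)
  then show ?thesis using that(2)[OF s K] piece_face s by blast
qed

lemma piece_closure_iff:
  assumes i: "i \<in> piece_index n d X lam" and j: "j \<in> piece_index n d X lam"
  shows "(piece n d X lam Q i \<inter> M closure_of piece n d X lam Q j \<noteq> {} \<longleftrightarrow> face_le i j) \<and>
         (piece n d X lam Q i \<subseteq> M closure_of piece n d X lam Q j \<longleftrightarrow> face_le i j)"
  using j
proof (cases rule: piece_index_cases)
  case 1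
  have "piece n d X lam Q i \<subseteq> topspace M \<and> piece n d X lam Q i \<noteq> {}"
    using i
  proof (cases rule: piece_index_cases)
    case 1
    then show ?thesis using regular_nonempty openin_subset[OF openin_M_regular] by simp
  next
    case (2 K)
    then show ?thesis unfolding topspace_M using stratum_def by auto
  qed
  then show ?thesis using face_le_Delta[OF i] 1 closure_of_regular by auto
next
  case (2 K')
  note j' = 2
  show ?thesis
    using i
  proof (cases rule: piece_index_cases)
    case 1
    \<comment> \<open>An open set disjoint from a stratum is disjoint from its closure.\<close>
    have "orbN ` regular \<inter> M closure_of (orbN ` stratum K') = {}"
      using openin_Int_closure_of_eq_empty[OF openin_M_regular]
        stratum_disjoint_regular[OF j'(2,4)] by blast
    moreover have "\<not> face_le i j" using Delta_not_le_singular[OF j'(1)] 1(1) by simp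
    ultimately show ?thesis
      unfolding 1(2) j'(7) using regular_nonempty by blast
  next
    case (2 K)
    show ?thesis
      using closure_of_stratum_iff[OF 2(2) j'(2) 2(5) j'(5)] face_le_iff[OF 2(6) j'(6,2)]
      unfolding 2(7) j'(7) unfolding 2(3) j'(3) by simp
  qed
qed

lemma disjoint_family_pieces: "disjoint_family_on (piece n d X lam Q) (piece_index n d X lam)"
  unfolding disjoint_family_on_def
proof (intro ballI impI)
  fix i j assume i: "i \<in> piece_index n d X lam" and j: "j \<in> piece_index n d X lam" and ij: "i \<noteq> j"
  show "piece n d X lam Q i \<inter> piece n d X lam Q j = {}"
    using i
  proof (cases rule: piece_index_cases)
    case 1
    note i' = 1
    show ?thesis
      using j
    proof (cases rule: piece_index_cases)
      case 1
      then show ?thesis using i' ij by simp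
    next
      case (2 K)
      show ?thesis unfolding i'(2) 2(7) using stratum_disjoint_regular[OF 2(2,4)] by (simp add: Int_commute)
    qed
  next
    case (2 K)
    note i' = 2
    show ?thesis
      using j
    proof (cases rule: piece_index_cases)
      case 1
      show ?thesis unfolding i'(7) 1(2) by (rule stratum_disjoint_regular[OF i'(2,4)])
    next
      case (2 K')
      then have "K \<noteq> K'" using i'(3) ij by auto
      then show ?thesis unfolding i'(7) 2(7) by (rule stratum_disjoint[OF i'(2) 2(2)])
    qed
  qed
qed

lemma finite_piece_index: "finite (piece_index n d X lam)"
proof -
  have "finite (open_faces d X lam)" unfolding open_faces_def by simp
  then show ?thesis
    unfolding piece_index_def singular_faces_def by simp
qed

text \<open>Antisymmetry depends on this index set: sets with equal closures, such as the polytope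
  and its interior, are below each other. The interior is nonsingular and hence not an
  index.\<close>

lemma partial_order_pieces:
  "partial_order_on (piece_index n d X lam) (relation_of face_le (piece_index n d X lam))"
proof (rule partial_order_on_relation_ofI)
  show "face_le a a" for a :: "('v \<Rightarrow>\<^sub>L real) set" unfolding face_le_def by (rule closure_subset)
  show "face_le a c" if "face_le a b" "face_le b c" for a b c :: "('v \<Rightarrow>\<^sub>L real) set"
    using that closure_minimal[OF _ closed_closure, of b c] unfolding face_le_def by blast
  fix a b assume a: "a \<in> piece_index n d X lam" and b: "b \<in> piece_index n d X lam"
    and le: "face_le a b" "face_le b a"
  show "a = b"
    using a
  proof (cases rule: piece_index_cases)
    case 1
    then have "b \<notin> singular_faces n d X lam" using Delta_not_le_singular[of b] le(1) by auto
    then show ?thesis using b 1(1) unfolding piece_index_def by simp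
  next
    case (2 K)
    note a' = 2
    show ?thesis
      using b
    proof (cases rule: piece_index_cases)
      case 1
      then show ?thesis using le(2) Delta_not_le_singular[OF a'(1)] by simp
    next
      case (2 K')
      have "K' \<subseteq> K" using le(1) face_le_iff[OF a'(6) 2(6,2)] unfolding a'(3) 2(3) by blast
      moreover have "K \<subseteq> K'" using le(2) face_le_iff[OF 2(6) a'(6,2)] unfolding a'(3) 2(3) by blast
      ultimately have "K = K'" by blast
      then show ?thesis using a'(3) 2(3) by simp
    qed
  qed
qed

lemma topspace_M_pieces: "topspace M = (\<Union>F\<in>piece_index n d X lam. piece n d X lam Q F)"
proof
  show "topspace M \<subseteq> (\<Union>F\<in>piece_index n d X lam. piece n d X lam Q F)"
    unfolding topspace_M
  proof (rule image_subsetI)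
    fix z assume z: "z \<in> Z"
    show "orbN z \<in> (\<Union>F\<in>piece_index n d X lam. piece n d X lam Q F)"
    proof (cases "indep_mod X {} (zeros z)")
      case True
      then have "orbN z \<in> piece n d X lam Q \<Delta>" unfolding piece_Delta regular_def using z by blast
      then show ?thesis unfolding piece_index_def by blast
    next
      case False
      have s: "z \<in> stratum (zeros z)" using stratum_zeros[OF z] .
      then have ne: "face (zeros z) \<noteq> {}" using stratum_empty_iff[of "zeros z"] by blast
      then have "face (zeros z) \<in> singular_faces n d X lam"
        using face_card_dim(2)[OF sp zeros_subset fin ne, unfolded dim_n] False by blast
      then show ?thesis using piece_face s unfolding piece_index_def by blast
    qed
  qed
  show "(\<Union>F\<in>piece_index n d X lam. piece n d X lam Q F) \<subseteq> topspace M"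
  proof (rule UN_least)
    fix F assume "F \<in> piece_index n d X lam"
    then show "piece n d X lam Q F \<subseteq> topspace M"
    proof (cases rule: piece_index_cases)
      case 1
      then show ?thesis using openin_subset[OF openin_M_regular] by simp
    next
      case (2 K)
      then show ?thesis unfolding topspace_M using stratum_def by auto
    qed
  qed
qed

lemma decomposition:
  "decomposition_by_quasifolds M (piece_index n d X lam) face_le (piece n d X lam Q)"
  unfolding decomposition_by_quasifolds_def
proof (intro conjI)
  show "\<forall>i\<in>piece_index n d X lam.
      locally_closed_in M (piece n d X lam Q i) \<and> connectedin M (piece n d X lam Q i) \<and>
      (\<exists>k. quasifold k (subtopology M (piece n d X lam Q i)))"
  proof
    fix i assume "i \<in> piece_index n d X lam"
    then show "locally_closed_in M (piece n d X lam Q i) \<and> connectedin M (piece n d X lam Q i) \<and>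
      (\<exists>k. quasifold k (subtopology M (piece n d X lam Q i)))"
    proof (cases rule: piece_index_cases)
      case 1
      have "locally_closed_in M (orbN ` regular)"
        unfolding locally_closed_in_def
        using openin_M_regular openin_subset[OF openin_M_regular]
        by (intro exI[where x = "orbN ` regular"] exI[where x = "topspace M"]) auto
      then show ?thesis unfolding 1(2) using quasifold_regular by (auto intro: exI)
    next
      case (2 K)
      then show ?thesis
        using locally_closed_stratum[OF 2(2)] quasifold_stratum[OF 2(2,5)] by auto
    qed
  qed
  show "\<forall>i\<in>piece_index n d X lam. \<forall>j\<in>piece_index n d X lam.
        (piece n d X lam Q i \<inter> M closure_of piece n d X lam Q j \<noteq> {} \<longleftrightarrow>
          piece n d X lam Q i \<subseteq> M closure_of piece n d X lam Q j) \<and>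
        (piece n d X lam Q i \<subseteq> M closure_of piece n d X lam Q j \<longleftrightarrow> face_le i j)"
    using piece_closure_iff by blast
  show "\<exists>m\<in>piece_index n d X lam. (\<forall>i\<in>piece_index n d X lam. face_le m i \<longrightarrow> i = m) \<and>
             openin M (piece n d X lam Q m) \<and> M closure_of piece n d X lam Q m = topspace M"
  proof (intro bexI[where x = \<Delta>] conjI)
    show "\<forall>i\<in>piece_index n d X lam. face_le \<Delta> i \<longrightarrow> i = \<Delta>"
      using Delta_not_le_singular unfolding piece_index_def by blast
    show "openin M (piece n d X lam Q \<Delta>)" unfolding piece_Delta by (rule openin_M_regular)
    show "M closure_of piece n d X lam Q \<Delta> = topspace M"
      unfolding piece_Delta by (rule closure_of_regular)
    show "\<Delta> \<in> piece_index n d X lam" unfolding piece_index_def by blast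
  qed
qed (fact disjoint_family_pieces finite_piece_index partial_order_pieces topspace_M_pieces)+

lemma quasifold_singular:
  assumes "F \<in> singular_faces n d X lam"
  shows "quasifold (2 * affine_dim F) (subtopology M (Phi_preimage d X lam Q F))"
proof -
  obtain K where K: "K \<subseteq> {..<d}" "F = face K" "stratum K \<noteq> {}"
    using assms by (rule singular_faceE)
  show ?thesis unfolding K(2) Phi_preimage_face by (rule quasifold_stratum(1)[OF K(1,3)])
qed

end

theorem theorem5p3:
  fixes n d :: nat
    and X :: "nat \<Rightarrow> 'v::real_normed_vector"
    and lam :: "nat \<Rightarrow> real"
    and Q :: "'v set"
    and \<Delta> :: "('v \<Rightarrow>\<^sub>L real) set"
  assumes "\<exists>B. finite B \<and> span B = (UNIV :: 'v set)"
    and "dim (UNIV :: 'v set) = n"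
    and "polytope_with_normals n d X lam \<Delta>"
    and "quasilattice Q"
    and "\<forall>j<d. X j \<in> Q"
  shows "(\<forall>F \<in> singular_faces n d X lam. \<forall>p. affine_dim F = p \<longrightarrow>
            quasifold (2 * p) (subtopology (M_space d X lam Q) (Phi_preimage d X lam Q F)))
       \<and> quasifold (2 * n) (subtopology (M_space d X lam Q) (regular_piece n d X lam Q))
       \<and> decomposition_by_quasifolds (M_space d X lam Q) (piece_index n d X lam) face_le
            (piece n d X lam Q)"
proof -
  interpret polytope_pieces d X lam Q n
    using assms polytope_normals_span[OF assms(1,3)] polytope_interior_face[OF assms(3)]
    by unfold_locales auto
  have "quasifold (2 * n) (subtopology (M_space d X lam Q) (regular_piece n d X lam Q))"
    using quasifold_regular(1) unfolding dim_n regular_piece_eq[unfolded dim_n] .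
  with quasifold_singular decomposition show ?thesis by blast
qed

end
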